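(* Let $\varphi=\frac{1+\sqrt5}{2}$ be the golden ratio. Then the function $\lambda_\varphi:\mathbb{R}\to\mathbb{R}$, $x\mapsto \varphi x$, is definable (without parameters) in $\mathcal{R}_\varphi=(\mathbb{R},<,+,\mathbb{Z},\mathbb{Z}\varphi)$, and hence the first-order theory of $\mathcal{S}_\varphi=(\mathbb{R},<,+,\mathbb{Z},\lambda_\varphi)$ is decidable.
   Context: For $a\in\mathbb{R}$, $\mathcal{R}_a$ is the expansion of $(\mathbb{R},<,+)$ by unary predicates for $\mathbb{Z}$ and $\mathbb{Z}a=\{za:z\in\mathbb{Z}\}$, and $\mathcal{S}_a$ is the expansion of $(\mathbb{R},<,+)$ by a predicate for $\mathbb{Z}$ and the function $\lambda_a(x)=ax$. Definable means definable by a first-order formula without parameters. *)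

theory Defs
  imports Complex_Main "HOL-Library.Nat_Bijection"
begin

text \<open>
  Formulas are parametrised by their type of atoms, so that each of the two languages below has
  its own terms and atomic formulas. Variables are numbered; there are no constant symbols, hence
  no parameters.
\<close>

datatype 'at fm =
    Atom 'at
  | Neg "'at fm"
  | Conj "'at fm" "'at fm"
  | Ex nat "'at fm"

primrec fv :: "('at \<Rightarrow> nat set) \<Rightarrow> 'at fm \<Rightarrow> nat set" where
  "fv V (Atom b) = V b"
| "fv V (Neg p) = fv V p"
| "fv V (Conj p q) = fv V p \<union> fv V q"
| "fv V (Ex i p) = fv V p - {i}"

primrec sat :: "((nat \<Rightarrow> real) \<Rightarrow> 'at \<Rightarrow> bool) \<Rightarrow> (nat \<Rightarrow> real) \<Rightarrow> 'at fm \<Rightarrow> bool" where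
  "sat I e (Atom b) \<longleftrightarrow> I e b"
| "sat I e (Neg p) \<longleftrightarrow> \<not> sat I e p"
| "sat I e (Conj p q) \<longleftrightarrow> sat I e p \<and> sat I e q"
| "sat I e (Ex i p) \<longleftrightarrow> (\<exists>x. sat I (e(i := x)) p)"

text \<open>
  Subsets of the \<open>k\<close>-th power of the reals are sets of lists of length \<open>k\<close>. The values \<open>xs ! i\<close>
  with \<open>i \<ge> k\<close> are irrelevant because of the condition on the free variables.
\<close>

definition definable_set ::
  "('at \<Rightarrow> nat set) \<Rightarrow> ((nat \<Rightarrow> real) \<Rightarrow> 'at \<Rightarrow> bool) \<Rightarrow> nat \<Rightarrow> real list set \<Rightarrow> bool" where
  "definable_set V I k X \<longleftrightarrow>
     (\<exists>p. fv V p \<subseteq> {..<k} \<and> X = {xs. length xs = k \<and> sat I (\<lambda>i. xs ! i) p})"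

definition definable_fun ::
  "('at \<Rightarrow> nat set) \<Rightarrow> ((nat \<Rightarrow> real) \<Rightarrow> 'at \<Rightarrow> bool) \<Rightarrow> (real \<Rightarrow> real) \<Rightarrow> bool" where
  "definable_fun V I f \<longleftrightarrow> definable_set V I 2 {[x, f x] | x. True}"

definition theory_of ::
  "('at \<Rightarrow> nat set) \<Rightarrow> ((nat \<Rightarrow> real) \<Rightarrow> 'at \<Rightarrow> bool) \<Rightarrow> 'at fm set" where
  "theory_of V I = {p. fv V p = {} \<and> (\<forall>e. sat I e p)}"

text \<open>
  The languages of (R, <, +, Z, Za) and of (R, <, +, Z, x \<mapsto> ax): \<open>RMult\<close> is the predicate symbol for
  Za, \<open>SScale\<close> the function symbol for multiplication by a, whose value \<open>a\<close> is part of the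
  interpretation and not of the syntax.
\<close>

datatype R_tm = RVar nat | RAdd R_tm R_tm

datatype R_atom =
    REq R_tm R_tm
  | RLess R_tm R_tm
  | RInt R_tm
  | RMult R_tm

primrec R_tm_vars :: "R_tm \<Rightarrow> nat set" where
  "R_tm_vars (RVar i) = {i}"
| "R_tm_vars (RAdd s t) = R_tm_vars s \<union> R_tm_vars t"

primrec R_vars :: "R_atom \<Rightarrow> nat set" where
  "R_vars (REq s t) = R_tm_vars s \<union> R_tm_vars t"
| "R_vars (RLess s t) = R_tm_vars s \<union> R_tm_vars t"
| "R_vars (RInt t) = R_tm_vars t"
| "R_vars (RMult t) = R_tm_vars t"

primrec R_tm_val :: "(nat \<Rightarrow> real) \<Rightarrow> R_tm \<Rightarrow> real" where
  "R_tm_val e (RVar i) = e i"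
| "R_tm_val e (RAdd s t) = R_tm_val e s + R_tm_val e t"

primrec R_struct :: "real \<Rightarrow> (nat \<Rightarrow> real) \<Rightarrow> R_atom \<Rightarrow> bool" where
  "R_struct a e (REq s t) \<longleftrightarrow> R_tm_val e s = R_tm_val e t"
| "R_struct a e (RLess s t) \<longleftrightarrow> R_tm_val e s < R_tm_val e t"
| "R_struct a e (RInt t) \<longleftrightarrow> R_tm_val e t \<in> \<int>"
| "R_struct a e (RMult t) \<longleftrightarrow> R_tm_val e t \<in> {of_int z * a | z. True}"

datatype S_tm = SVar nat | SAdd S_tm S_tm | SScale S_tm

datatype S_atom =
    SEq S_tm S_tm
  | SLess S_tm S_tm
  | SInt S_tm

primrec S_tm_vars :: "S_tm \<Rightarrow> nat set" where
  "S_tm_vars (SVar i) = {i}"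
| "S_tm_vars (SAdd s t) = S_tm_vars s \<union> S_tm_vars t"
| "S_tm_vars (SScale t) = S_tm_vars t"

primrec S_vars :: "S_atom \<Rightarrow> nat set" where
  "S_vars (SEq s t) = S_tm_vars s \<union> S_tm_vars t"
| "S_vars (SLess s t) = S_tm_vars s \<union> S_tm_vars t"
| "S_vars (SInt t) = S_tm_vars t"

primrec S_tm_val :: "real \<Rightarrow> (nat \<Rightarrow> real) \<Rightarrow> S_tm \<Rightarrow> real" where
  "S_tm_val a e (SVar i) = e i"
| "S_tm_val a e (SAdd s t) = S_tm_val a e s + S_tm_val a e t"
| "S_tm_val a e (SScale t) = a * S_tm_val a e t"

primrec S_struct :: "real \<Rightarrow> (nat \<Rightarrow> real) \<Rightarrow> S_atom \<Rightarrow> bool" where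
  "S_struct a e (SEq s t) \<longleftrightarrow> S_tm_val a e s = S_tm_val a e t"
| "S_struct a e (SLess s t) \<longleftrightarrow> S_tm_val a e s < S_tm_val a e t"
| "S_struct a e (SInt t) \<longleftrightarrow> S_tm_val a e t \<in> \<int>"

text \<open>
  \<open>recursive n f\<close>: the restriction of \<open>f\<close> to lists of length \<open>n\<close> is an \<open>n\<close>-ary total recursive
  function. Minimisation is only applied to functions that have a zero for all values of the
  parameters, which yields exactly the total computable functions. The values of \<open>f\<close> at lists of
  any other length carry no meaning.
\<close>

inductive recursive :: "nat \<Rightarrow> (nat list \<Rightarrow> nat) \<Rightarrow> bool" where
  zero: "recursive n (\<lambda>_. 0)"
| succ: "recursive 1 (\<lambda>xs. Suc (xs ! 0))"
| proj: "i < n \<Longrightarrow> recursive n (\<lambda>xs. xs ! i)"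
| comp: "recursive (length gs) f \<Longrightarrow> (\<And>g. g \<in> set gs \<Longrightarrow> recursive n g) \<Longrightarrow>
    recursive n (\<lambda>xs. f (map (\<lambda>g. g xs) gs))"
| prec: "recursive n f \<Longrightarrow> recursive (Suc (Suc n)) g \<Longrightarrow>
    recursive (Suc n) (\<lambda>xs. rec_nat (f (tl xs)) (\<lambda>k r. g (k # r # tl xs)) (hd xs))"
| mu: "recursive (Suc n) f \<Longrightarrow> (\<And>xs. length xs = n \<Longrightarrow> \<exists>y. f (y # xs) = 0) \<Longrightarrow>
    recursive n (\<lambda>xs. LEAST y. f (y # xs) = 0)"

definition decidable_nat_set :: "nat set \<Rightarrow> bool" where
  "decidable_nat_set A \<longleftrightarrow> (\<exists>f. recursive 1 f \<and> (\<forall>m. f [m] = (if m \<in> A then 1 else 0)))"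

primrec S_tm_code :: "S_tm \<Rightarrow> nat" where
  "S_tm_code (SVar i) = prod_encode (0, i)"
| "S_tm_code (SAdd s t) = prod_encode (1, prod_encode (S_tm_code s, S_tm_code t))"
| "S_tm_code (SScale t) = prod_encode (2, S_tm_code t)"

primrec S_atom_code :: "S_atom \<Rightarrow> nat" where
  "S_atom_code (SEq s t) = prod_encode (0, prod_encode (S_tm_code s, S_tm_code t))"
| "S_atom_code (SLess s t) = prod_encode (1, prod_encode (S_tm_code s, S_tm_code t))"
| "S_atom_code (SInt t) = prod_encode (2, S_tm_code t)"

primrec fm_code :: "('at \<Rightarrow> nat) \<Rightarrow> 'at fm \<Rightarrow> nat" where
  "fm_code c (Atom b) = prod_encode (0, c b)"
| "fm_code c (Neg p) = prod_encode (1, fm_code c p)"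
| "fm_code c (Conj p q) = prod_encode (2, prod_encode (fm_code c p, fm_code c q))"
| "fm_code c (Ex i p) = prod_encode (3, prod_encode (i, fm_code c p))"

lemma S_tm_code_inject [simp]: "S_tm_code s = S_tm_code t \<longleftrightarrow> s = t"
proof (induction s arbitrary: t)
  case (SVar i) then show ?case by (cases t) auto
next
  case (SAdd s1 s2) then show ?case by (cases t) auto
next
  case (SScale s) then show ?case by (cases t) auto
qed

lemma S_atom_code_inject [simp]: "S_atom_code b = S_atom_code c \<longleftrightarrow> b = c"
  by (cases b; cases c) auto

lemma fm_code_inject:
  assumes "inj c"
  shows "fm_code c p = fm_code c q \<longleftrightarrow> p = q"
proof (induction p arbitrary: q)
  case (Atom b) then show ?case using assms by (cases q) (auto dest: injD)
next
  case (Neg p) then show ?case by (cases q) auto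
next
  case (Conj p1 p2) then show ?case by (cases q) auto
next
  case (Ex i p) then show ?case by (cases q) auto
qed

lemma inj_S_fm_code: "inj (fm_code S_atom_code)"
  by (intro injI) (simp add: fm_code_inject inj_on_def)

definition decidable_theory :: "('at \<Rightarrow> nat) \<Rightarrow> 'at fm set \<Rightarrow> bool" where
  "decidable_theory c T \<longleftrightarrow> decidable_nat_set (fm_code c ` T)"

definition golden_ratio :: real where
  "golden_ratio = (1 + sqrt 5) / 2"

end

theory Submission
  imports Defs "HOL-Library.Ramsey" "HOL-Library.FuncSet" "HOL-Number_Theory.Fib"
begin

text \<open>
  Decidability. Write a real number as \<open>n + r\<close> with an integer \<open>n\<close>, given by a finite signed sum of
  Fibonacci numbers, and a bounded \<open>r\<close>, given by an expansion in powers of \<open>1/\<phi>\<close>. Because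
  \<open>\<phi> F\<^sub>i = F\<^sub>i\<^sub>+\<^sub>1 - (-1/\<phi>)\<^sup>i\<close>, addition and multiplication by \<open>\<phi>\<close> become equations between
  \<open>1/\<phi>\<close>-expansions whose digits lie in \<open>\<int>[\<phi>]\<close>. Such an equation holds iff the orbit of its remainders
  stays bounded, and as the Galois conjugates of the remainders are bounded anyway, this is a
    condition on
  a finite automaton. Every formula thus defines an \<open>\<omega>\<close>-regular language of expansions. It is
  represented by a finite semigroup, where negation is trivial, conjunction is a product and
  quantification is a powerset construction justified by Ramsey's theorem; all of this is recursive in
  the code of the formula.

  Definability. The pairs \<open>(F\<^sub>k\<^sub>+\<^sub>1, F\<^sub>k \<phi>)\<close> are the best approximations of elements of \<open>\<int> \<phi>\<close> by
  integers, hence definable. For \<open>n \<ge> 0\<close> let \<open>n\<^sub>k\<close> be the greatest integer in \<open>[0, n]\<close> at distance less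
  than \<open>\<phi>\<^sup>-\<^sup>k\<close> from \<open>\<int> \<phi>\<close>. Then \<open>\<phi> n\<^sub>k\<close> is the greatest element of \<open>\<int> \<phi>\<close> in \<open>[0, \<phi> n]\<close> at distance
  less than \<open>\<phi>\<^sup>-\<^sup>k\<^sup>-\<^sup>1\<close> from \<open>\<int>\<close>, and the differences \<open>n\<^sub>k - n\<^sub>k\<^sub>+\<^sub>1\<close> are small combinations of \<open>F\<^sub>k\<close> and
  \<open>F\<^sub>k\<^sub>+\<^sub>1\<close>. As \<open>n\<^sub>k\<close> vanishes for large \<open>k\<close>, comparing these differences characterises the graph of
  \<open>n \<mapsto> \<phi> n\<close>, which extends to \<open>\<int> + \<int> \<phi>\<close> and by density to all real numbers.
\<close>

text \<open>Integer and fractional digits are read together, from the units position outwards, so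
  position \<open>n\<close> carries the weights \<open>fib n\<close> and \<open>\<gamma> ^ n\<close>
  at once. The obstacle is that the Fibonacci weights grow along the word and no finite memory can
  accumulate them. What is read instead is the conjugate sum of digits times
  \<open>\<psi> ^ n\<close>: it converges, it equals \<open>k - j \<phi>\<close> for the integer
  value \<open>j\<close> and a companion integer \<open>k\<close>, and irrationality of \<phi>
  recovers \<open>j\<close> from it. A carry between the two parts is a small integer, hence guessed
  from a finite list.

  Finite semigroups replace Buchi automata because complementation needs no determinisation and
  their tables are plain numbers on which recursive functions act. Only the fixed semigroups of
  properness and of the atomic relations come from existence proofs; whatever depends on the formula
  is computed.

  For definability, the language can neither name an index \<open>k\<close> nor multiply. An index
  is replaced by a tuple of consecutive best approximations, and a small combination by a finite
  disjunction over its coefficients.\<close>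

section \<open>Closure properties of the recursive functions\<close>

text \<open>\<open>recursive\<close> is a statement about a function on all lists, although only
  lists of length \<open>n\<close> carry meaning. Working up to agreement on those lists allows free
  rewriting of the function body.\<close>

definition recn :: "nat \<Rightarrow> (nat list \<Rightarrow> nat) \<Rightarrow> bool" where
  "recn n F \<longleftrightarrow> (\<exists>f. recursive n f \<and> (\<forall>xs. length xs = n \<longrightarrow> f xs = F xs))"

lemma recn_cong:
  assumes "recn n F" and "\<And>xs. length xs = n \<Longrightarrow> F xs = G xs"
  shows "recn n G"
  using assms unfolding recn_def by auto

lemma recn_zero: "recn n (\<lambda>_. 0)"
  unfolding recn_def using recursive.zero by blast

lemma recn_nth: "i < n \<Longrightarrow> recn n (\<lambda>xs. xs ! i)"
  unfolding recn_def using recursive.proj by blast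

lemma recn_comp:
  assumes F: "recn (length Gs) F" and G: "\<And>G. G \<in> set Gs \<Longrightarrow> recn n G"
  shows "recn n (\<lambda>xs. F (map (\<lambda>G. G xs) Gs))"
proof -
  obtain f where f: "recursive (length Gs) f" "\<And>xs. length xs = length Gs \<Longrightarrow> f xs = F xs"
    using F unfolding recn_def by auto
  from G have "\<forall>G\<in>set Gs. \<exists>g. recursive n g \<and> (\<forall>xs. length xs = n \<longrightarrow> g xs = G xs)"
    unfolding recn_def by auto
  then obtain c where c: "\<And>G. G \<in> set Gs \<Longrightarrow> recursive n (c G)"
    "\<And>G xs. G \<in> set Gs \<Longrightarrow> length xs = n \<Longrightarrow> c G xs = G xs"
    by metis
  have "recursive n (\<lambda>xs. f (map (\<lambda>g. g xs) (map c Gs)))"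
    by (rule recursive.comp) (use f c in auto)
  moreover have "f (map (\<lambda>g. g xs) (map c Gs)) = F (map (\<lambda>G. G xs) Gs)" if "length xs = n" for xs
  proof -
    have "map (\<lambda>g. g xs) (map c Gs) = map (\<lambda>G. G xs) Gs"
      using c(2) that by auto
    then show ?thesis by (metis f(2) length_map)
  qed
  ultimately show ?thesis unfolding recn_def by blast
qed

lemma recn_comp1: "recn 1 (\<lambda>xs. F (xs ! 0)) \<Longrightarrow> recn n A \<Longrightarrow> recn n (\<lambda>xs. F (A xs))"
  using recn_comp[of "[A]" "\<lambda>xs. F (xs ! 0)" n] by simp

lemma recn_comp2:
  "recn 2 (\<lambda>xs. F (xs ! 0) (xs ! 1)) \<Longrightarrow> recn n A \<Longrightarrow> recn n B \<Longrightarrow> recn n (\<lambda>xs. F (A xs) (B xs))"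
  using recn_comp[of "[A, B]" "\<lambda>xs. F (xs ! 0) (xs ! 1)" n] by (auto simp: numeral_2_eq_2)

lemma recn_Suc: "recn n A \<Longrightarrow> recn n (\<lambda>xs. Suc (A xs))"
proof (rule recn_comp1[of Suc])
  show "recn 1 (\<lambda>xs. Suc (xs ! 0))"
    unfolding recn_def using recursive.succ by blast
qed

lemma recn_const: "recn n (\<lambda>_. c)"
  by (induction c) (auto intro: recn_zero recn_Suc)

lemma recn_rec:
  assumes A: "recn n A" and B: "recn n B"
    and G: "recn (Suc (Suc n)) (\<lambda>ys. G (ys ! 0) (ys ! 1) (drop 2 ys))"
  shows "recn n (\<lambda>xs. rec_nat (A xs) (\<lambda>k r. G k r xs) (B xs))"
proof -
  obtain f where f: "recursive n f" "\<And>xs. length xs = n \<Longrightarrow> f xs = A xs"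
    using A unfolding recn_def by auto
  obtain g where g: "recursive (Suc (Suc n)) g"
    "\<And>ys. length ys = Suc (Suc n) \<Longrightarrow> g ys = G (ys ! 0) (ys ! 1) (drop 2 ys)"
    using G unfolding recn_def by auto
  have "recn (Suc n) (\<lambda>xs. rec_nat (f (tl xs)) (\<lambda>k r. g (k # r # tl xs)) (hd xs))"
    unfolding recn_def using recursive.prec[OF f(1) g(1)] by blast
  moreover have "rec_nat (f (tl xs)) (\<lambda>k r. g (k # r # tl xs)) m
      = rec_nat (A (tl xs)) (\<lambda>k r. G k r (tl xs)) m" if "length xs = Suc n" for xs :: "nat list" and m
    using that by (induction m) (simp_all add: f g)
  ultimately have 1: "recn (Suc n) (\<lambda>xs. rec_nat (A (tl xs)) (\<lambda>k r. G k r (tl xs)) (hd xs))"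
    by (rule recn_cong)
  \<comment> \<open>All projections together reproduce the parameter list behind \<open>B\<close>,
    so that recursion on the head of a list becomes recursion up to \<open>B\<close>.\<close>
  let ?Gs = "B # map (\<lambda>i xs. xs ! i) [0..<n]"
  have "recn n (\<lambda>xs. (\<lambda>xs. rec_nat (A (tl xs)) (\<lambda>k r. G k r (tl xs)) (hd xs)) (map (\<lambda>G. G xs) ?Gs))"
    by (rule recn_comp) (use 1 B recn_nth in auto)
  then show ?thesis
  proof (rule recn_cong)
    fix xs :: "nat list" assume "length xs = n"
    then have "map (\<lambda>G. G xs) (map (\<lambda>i xs. xs ! i) [0..<n]) = xs"
      by (auto simp: map_nth o_def)
    then show "rec_nat (A (tl (map (\<lambda>G. G xs) ?Gs))) (\<lambda>k r. G k r (tl (map (\<lambda>G. G xs) ?Gs)))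
       (hd (map (\<lambda>G. G xs) ?Gs)) = rec_nat (A xs) (\<lambda>k r. G k r xs) (B xs)"
      by simp
  qed
qed

lemma recn_mu:
  assumes F: "recn (Suc n) (\<lambda>ys. F (ys ! 0) (tl ys))"
    and ex: "\<And>xs. length xs = n \<Longrightarrow> \<exists>y. F y xs = 0"
  shows "recn n (\<lambda>xs. LEAST y. F y xs = 0)"
proof -
  obtain f where f: "recursive (Suc n) f" "\<And>xs. length xs = Suc n \<Longrightarrow> f xs = F (xs ! 0) (tl xs)"
    using F unfolding recn_def by auto
  have "recursive n (\<lambda>xs. LEAST y. f (y # xs) = 0)"
    by (rule recursive.mu) (use f ex in auto)
  then show ?thesis
    unfolding recn_def using f by (intro exI[of _ "\<lambda>xs. LEAST y. f (y # xs) = 0"]) auto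
qed

lemma recn_add: "recn n A \<Longrightarrow> recn n B \<Longrightarrow> recn n (\<lambda>xs. A xs + B xs)"
proof -
  assume "recn n A" "recn n B"
  then have "recn n (\<lambda>xs. rec_nat (A xs) (\<lambda>k r. Suc r) (B xs))"
    by (intro recn_rec recn_Suc recn_nth) auto
  moreover have "rec_nat x (\<lambda>k r. Suc r) y = x + y" for x y :: nat
    by (induction y) auto
  ultimately show ?thesis by simp
qed

lemma recn_pred: "recn n A \<Longrightarrow> recn n (\<lambda>xs. A xs - 1)"
proof -
  assume "recn n A"
  then have "recn n (\<lambda>xs. rec_nat 0 (\<lambda>k r. k) (A xs))"
    by (intro recn_rec recn_zero recn_nth) auto
  moreover have "rec_nat 0 (\<lambda>k r. k) y = y - 1" for y :: nat
    by (induction y) auto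
  ultimately show ?thesis by simp
qed

lemma recn_diff: "recn n A \<Longrightarrow> recn n B \<Longrightarrow> recn n (\<lambda>xs. A xs - B xs)"
proof -
  assume "recn n A" "recn n B"
  then have "recn n (\<lambda>xs. rec_nat (A xs) (\<lambda>k r. r - 1) (B xs))"
    by (intro recn_rec recn_pred recn_nth) auto
  moreover have "rec_nat x (\<lambda>k r. r - 1) y = x - y" for x y :: nat
    by (induction y) auto
  ultimately show ?thesis by simp
qed

lemma recn_mult2: "recn 2 (\<lambda>xs. xs ! 0 * xs ! 1)"
proof -
  have "recn 2 (\<lambda>xs. rec_nat 0 (\<lambda>k r. r + xs ! 0) (xs ! 1))"
  proof (rule recn_rec)
    show "recn (Suc (Suc 2)) (\<lambda>ys. ys ! 1 + drop 2 ys ! 0)"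
      by (rule recn_cong[OF recn_add[OF recn_nth[of 1] recn_nth[of 2]]]) auto
  qed (auto intro: recn_zero recn_nth)
  moreover have "rec_nat 0 (\<lambda>k r. r + x) y = x * y" for x y :: nat
    by (induction y) auto
  ultimately show ?thesis by simp
qed

lemma recn_mult: "recn n A \<Longrightarrow> recn n B \<Longrightarrow> recn n (\<lambda>xs. A xs * B xs)"
  using recn_comp2[OF recn_mult2] .

lemma recn_power2: "recn 2 (\<lambda>xs. xs ! 0 ^ xs ! 1)"
proof -
  have "recn 2 (\<lambda>xs. rec_nat 1 (\<lambda>k r. r * xs ! 0) (xs ! 1))"
  proof (rule recn_rec)
    show "recn (Suc (Suc 2)) (\<lambda>ys. ys ! 1 * drop 2 ys ! 0)"
      by (rule recn_cong[OF recn_mult[OF recn_nth[of 1] recn_nth[of 2]]]) auto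
  qed (auto intro: recn_const recn_nth)
  moreover have "rec_nat 1 (\<lambda>k r. r * x) y = x ^ y" for x y :: nat
    by (induction y) auto
  ultimately show ?thesis by simp
qed

lemma recn_triangle: "recn n A \<Longrightarrow> recn n (\<lambda>xs. triangle (A xs))"
proof -
  assume "recn n A"
  then have "recn n (\<lambda>xs. rec_nat 0 (\<lambda>k r. r + Suc k) (A xs))"
    by (intro recn_rec recn_add recn_Suc recn_nth recn_zero) auto
  moreover have "rec_nat 0 (\<lambda>k r. r + Suc k) y = triangle y" for y :: nat
    by (induction y) auto
  ultimately show ?thesis by simp
qed

lemma recn_prod_encode: "recn n A \<Longrightarrow> recn n B \<Longrightarrow> recn n (\<lambda>xs. prod_encode (A xs, B xs))"
  unfolding prod_encode_def by (auto intro!: recn_add recn_triangle)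

abbreviation pair :: "nat \<Rightarrow> nat \<Rightarrow> nat" where "pair x y \<equiv> prod_encode (x, y)"
abbreviation pfst :: "nat \<Rightarrow> nat" where "pfst z \<equiv> fst (prod_decode z)"
abbreviation psnd :: "nat \<Rightarrow> nat" where "psnd z \<equiv> snd (prod_decode z)"

text \<open>The index of the diagonal of the Cantor enumeration that contains \<open>z\<close>, that
  is, the sum of the two components. It is found by minimisation, and both components follow from it
  by subtraction.\<close>

definition diag :: "nat \<Rightarrow> nat" where "diag z = (LEAST s. Suc z - triangle (Suc s) = 0)"

lemma triangle_mono: "x \<le> y \<Longrightarrow> triangle x \<le> triangle y"
  by (rule lift_Suc_mono_le) auto

lemma diag_prod_encode: "diag (pair a b) = a + b"
  unfolding diag_def
proof (rule Least_equality)
  show "Suc (pair a b) - triangle (Suc (a + b)) = 0"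
    by (simp add: prod_encode_def)
next
  fix s assume "Suc (pair a b) - triangle (Suc s) = 0"
  then have "triangle (a + b) < triangle (Suc s)"
    by (simp add: prod_encode_def)
  then have "\<not> Suc s \<le> a + b"
    using triangle_mono[of "Suc s" "a + b"] by linarith
  then show "a + b \<le> s" by simp
qed

lemma pfst_eq: "pfst z = z - triangle (diag z)" and psnd_eq: "psnd z = diag z - pfst z"
proof -
  obtain a b where z: "z = pair a b" by (metis prod.collapse prod_decode_inverse)
  show "pfst z = z - triangle (diag z)" "psnd z = diag z - pfst z"
    unfolding z diag_prod_encode prod_encode_inverse
    by (simp_all add: prod_encode_def)
qed

lemma recn_diag: "recn n A \<Longrightarrow> recn n (\<lambda>xs. diag (A xs))"
proof (rule recn_comp1[of diag])
  show "recn 1 (\<lambda>xs. diag (xs ! 0))"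
    unfolding diag_def
  proof (rule recn_mu)
    show "recn (Suc 1) (\<lambda>ys. Suc (tl ys ! 0) - triangle (Suc (ys ! 0)))"
      by (rule recn_cong[OF recn_diff[OF recn_Suc[OF recn_nth[of 1]]
        recn_triangle[OF recn_Suc[OF recn_nth[of 0]]]]])
        (auto simp: nth_tl)
    have "n \<le> triangle n" for n by (induction n) auto
    then show "\<exists>y. Suc (xs ! 0) - triangle (Suc y) = 0" for xs
      by (metis diff_is_0_eq)
  qed
qed

lemma recn_pfst: "recn n A \<Longrightarrow> recn n (\<lambda>xs. pfst (A xs))"
  by (auto simp: pfst_eq intro!: recn_diff recn_triangle recn_diag)

lemma recn_psnd: "recn n A \<Longrightarrow> recn n (\<lambda>xs. psnd (A xs))"
  by (auto simp: psnd_eq intro!: recn_diff recn_diag recn_pfst)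

section \<open>Unary recursive functions\<close>

definition computable :: "(nat \<Rightarrow> nat) \<Rightarrow> bool" where "computable F \<longleftrightarrow> recn 1 (\<lambda>xs. F (xs ! 0))"
definition decidable :: "(nat \<Rightarrow> bool) \<Rightarrow> bool" where "decidable P \<longleftrightarrow> computable (\<lambda>n. of_bool (P n))"
definition computable2 :: "(nat \<Rightarrow> nat \<Rightarrow> nat) \<Rightarrow> bool" where
  "computable2 F \<longleftrightarrow> computable (\<lambda>z. F (pfst z) (psnd z))"

named_theorems computable_intros

lemma computable_id [computable_intros]: "computable (\<lambda>n. n)"
  unfolding computable_def by (rule recn_nth) simp

lemma computable_const [computable_intros]: "computable (\<lambda>n. c)"
  unfolding computable_def by (rule recn_const)

lemma computable_Suc [computable_intros]: "computable A \<Longrightarrow> computable (\<lambda>n. Suc (A n))"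
  unfolding computable_def by (rule recn_Suc)

lemma computable_arith [computable_intros]:
  assumes "computable A" "computable B"
  shows "computable (\<lambda>n. A n + B n)" "computable (\<lambda>n. A n - B n)" "computable (\<lambda>n. A n * B n)"
    "computable (\<lambda>n. A n ^ B n)"
    "computable (\<lambda>n. pair (A n) (B n))"
  using assms unfolding computable_def
  by (auto intro: recn_add recn_diff recn_mult recn_comp2[OF recn_power2] recn_prod_encode)

lemma computable_pfst [computable_intros]: "computable A \<Longrightarrow> computable (\<lambda>n. pfst (A n))"
  and computable_psnd [computable_intros]: "computable A \<Longrightarrow> computable (\<lambda>n. psnd (A n))"
  unfolding computable_def by (auto intro: recn_pfst recn_psnd)

lemma computable_comp: "computable F \<Longrightarrow> computable A \<Longrightarrow> computable (\<lambda>n. F (A n))"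
  unfolding computable_def by (rule recn_comp1)

lemma computable2D: "computable2 F \<Longrightarrow> computable A \<Longrightarrow> computable B \<Longrightarrow> computable (\<lambda>n. F (A n) (B n))"
  unfolding computable2_def using computable_comp[of "\<lambda>z. F (pfst z) (psnd z)" "\<lambda>n. pair (A n) (B n)"]
  by (simp add: computable_arith)

lemma computable_rec [computable_intros]:
  assumes "computable A" "computable (\<lambda>z. G (pfst z) (pfst (psnd z)) (psnd (psnd z)))" "computable B"
  shows "computable (\<lambda>n. rec_nat (A n) (\<lambda>k r. G k r n) (B n))"
  unfolding computable_def
proof (rule recn_rec)
  show "recn (Suc (Suc 1)) (\<lambda>ys. G (ys ! 0) (ys ! 1) (drop 2 ys ! 0))"
  proof (rule recn_cong)
    show "recn (Suc (Suc 1)) (\<lambda>ys. (\<lambda>z. G (pfst z) (pfst (psnd z)) (psnd (psnd z)))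
        (pair (ys ! 0) (pair (ys ! 1) (ys ! 2))))"
      by (rule recn_comp1[OF assms(2)[unfolded computable_def]]) (intro recn_prod_encode recn_nth; simp)
  qed auto
qed (use assms in \<open>auto simp: computable_def\<close>)

lemma decidable_not [computable_intros]: "decidable P \<Longrightarrow> decidable (\<lambda>n. \<not> P n)"
proof -
  have *: "of_bool (\<not> b) = 1 - (of_bool b :: nat)" for b by simp
  show "decidable P \<Longrightarrow> ?thesis" unfolding decidable_def * by (intro computable_intros)
qed

lemma decidable_conj [computable_intros]: "decidable P \<Longrightarrow> decidable Q \<Longrightarrow> decidable (\<lambda>n. P n \<and> Q n)"
  unfolding decidable_def of_bool_conj by (intro computable_intros)

lemma decidable_disj [computable_intros]: "decidable P \<Longrightarrow> decidable Q \<Longrightarrow> decidable (\<lambda>n. P n \<or> Q n)"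
  using decidable_not[OF decidable_conj[OF decidable_not[of P] decidable_not[of Q]]] by simp

lemma decidable_imp [computable_intros]: "decidable P \<Longrightarrow> decidable Q \<Longrightarrow> decidable (\<lambda>n. P n \<longrightarrow> Q n)"
  unfolding imp_conv_disj by (intro decidable_disj decidable_not)

lemma decidable_iff [computable_intros]: "decidable P \<Longrightarrow> decidable Q \<Longrightarrow> decidable (\<lambda>n. P n \<longleftrightarrow> Q n)"
  unfolding iff_conv_conj_imp by (intro decidable_conj decidable_imp)

lemma decidable_le [computable_intros]: "computable A \<Longrightarrow> computable B \<Longrightarrow> decidable (\<lambda>n. A n \<le> B n)"
proof -
  have *: "of_bool (a \<le> b) = 1 - (a - b)" for a b :: nat by auto
  show "computable A \<Longrightarrow> computable B \<Longrightarrow> ?thesis" unfolding decidable_def * by (intro computable_intros)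
qed

lemma decidable_less [computable_intros]: "computable A \<Longrightarrow> computable B \<Longrightarrow> decidable (\<lambda>n. A n < B n)"
  unfolding less_eq_Suc_le by (intro computable_intros)

lemma decidable_eq [computable_intros]: "computable A \<Longrightarrow> computable B \<Longrightarrow> decidable (\<lambda>n. A n = B n)"
  unfolding order.eq_iff by (intro computable_intros)

lemma computable_of_bool [computable_intros]: "decidable P \<Longrightarrow> computable (\<lambda>n. of_bool (P n))"
  by (simp add: decidable_def)

lemma computable_if [computable_intros]: "decidable P \<Longrightarrow> computable A \<Longrightarrow> computable B \<Longrightarrow> computable
  (\<lambda>n. if P n then A n else B n)"
proof -
  have *: "(if b then x else y) = of_bool b * x + (1 - of_bool b) * y" for b and x y :: nat by simp
  show "decidable P \<Longrightarrow> computable A \<Longrightarrow> computable B \<Longrightarrow> ?thesis" unfolding * by (intro computable_intros)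
qed

lemma decidable_comp: "decidable P \<Longrightarrow> computable A \<Longrightarrow> decidable (\<lambda>n. P (A n))"
  unfolding decidable_def by (rule computable_comp)

lemma computable_Least:
  assumes Q: "decidable (\<lambda>z. Q (pfst z) (psnd z))" and ex: "\<And>n. \<exists>y. Q n y"
  shows "computable (\<lambda>n. LEAST y. Q n y)"
proof -
  have *: "computable (\<lambda>z. 1 - of_bool (Q (pfst z) (psnd z)))"
    by (intro computable_intros Q)
  have "recn (Suc 1) (\<lambda>ys. 1 - of_bool (Q (tl ys ! 0) (ys ! 0)))"
  proof (rule recn_cong)
    show "recn (Suc 1) (\<lambda>ys. (\<lambda>z. 1 - of_bool (Q (pfst z) (psnd z))) (pair (ys ! 1) (ys ! 0)))"
      by (rule recn_comp1[OF *[unfolded computable_def]]) (intro recn_prod_encode recn_nth; simp)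
  qed (auto simp: nth_tl)
  then have "recn 1 (\<lambda>xs. LEAST y. 1 - of_bool (Q (xs ! 0) y) = (0::nat))"
    by (rule recn_mu) (use ex in auto)
  moreover have "1 - of_bool b = (0::nat) \<longleftrightarrow> b" for b by simp
  ultimately show ?thesis by (simp only: computable_def)
qed

lemma decidable_ex_less [computable_intros]:
  assumes "computable B" and Q: "decidable (\<lambda>z. Q (pfst z) (psnd z))"
  shows "decidable (\<lambda>n. \<exists>x<B n. Q n x)"
proof -
  \<comment> \<open>The bound \<open>b\<close> serves as a sentinel: the unbounded search always
    succeeds, and its result is below \<open>b\<close> iff there is a genuine witness.\<close>
  have *: "(\<exists>x<b. P x) \<longleftrightarrow> (LEAST x. x = b \<or> P x) < b" for b :: nat and P
  proof
    assume "\<exists>x<b. P x"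
    then obtain x where "x < b" "P x" by blast
    then show "(LEAST x. x = b \<or> P x) < b"
      using Least_le[of "\<lambda>x. x = b \<or> P x" x] by linarith
  next
    assume "(LEAST x. x = b \<or> P x) < b"
    then show "\<exists>x<b. P x"
      using LeastI[of "\<lambda>x. x = b \<or> P x" b] by auto
  qed
  show ?thesis unfolding *
    by (intro computable_intros computable_Least Q assms(1) computable_comp[OF assms(1)]) blast
qed

lemma decidable_all_less [computable_intros]:
  assumes "computable B" and Q: "decidable (\<lambda>z. Q (pfst z) (psnd z))"
  shows "decidable (\<lambda>n. \<forall>x<B n. Q n x)"
  using decidable_not[OF decidable_ex_less[OF assms(1), of "\<lambda>n x. \<not> Q n x"]] decidable_not[OF Q] by simp

lemma computable_div [computable_intros]: "computable A \<Longrightarrow> computable B \<Longrightarrow> computable (\<lambda>n. A n div B n)"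
proof -
  have *: "a div b = (LEAST q. b = 0 \<or> a < Suc q * b)" for a b :: nat
  proof (cases "b = 0")
    case False
    show ?thesis
    proof (rule Least_equality[symmetric])
      show "b = 0 \<or> a < Suc (a div b) * b"
        using False dividend_less_div_times[of b a] by (auto simp: algebra_simps)
      show "a div b \<le> y" if "b = 0 \<or> a < Suc y * b" for y
        using that False less_mult_imp_div_less[of a "Suc y" b] by simp
    qed
  qed (auto intro: Least_equality[symmetric])
  have "\<exists>q. b = 0 \<or> a < Suc q * b" for a b :: nat
    by (rule exI[of _ a]) (cases b; simp)
  then have "computable2 (\<lambda>a b. a div b)"
    unfolding computable2_def * by (intro computable_Least computable_intros)
  from computable2D[OF this] show "computable A \<Longrightarrow> computable B \<Longrightarrow> ?thesis" .
qed

lemma computable_mod [computable_intros]: "computable A \<Longrightarrow> computable B \<Longrightarrow> computable (\<lambda>n. A n mod B n)"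
  unfolding modulo_nat_def by (intro computable_intros)

lemma decidable_mem [computable_intros]: "computable A \<Longrightarrow> computable B \<Longrightarrow> decidable
  (\<lambda>n. A n \<in> set_decode (B n))"
  unfolding set_decode_def mem_Collect_eq odd_iff_mod_2_eq_one by (intro computable_intros)

lemma mem_set_decode_less: "x \<in> set_decode m \<Longrightarrow> x < m"
proof -
  assume "x \<in> set_decode m"
  then have "m div 2 ^ x \<noteq> 0" unfolding set_decode_def by (auto intro: ccontr)
  then have "2 ^ x \<le> m" by (metis div_less not_less)
  then show ?thesis using less_exp[of x] by linarith
qed

lemma computable_set_encode [computable_intros]:
  assumes "computable B" and Q: "decidable (\<lambda>z. Q (pfst z) (psnd z))"
  shows "computable (\<lambda>n. set_encode {x. x < B n \<and> Q n x})"
proof -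
  \<comment> \<open>The code is found by search. Comparing the two sets below \<open>b + c\<close>
    suffices, since members of \<open>set_decode c\<close> are below \<open>c\<close>.\<close>
  have *: "set_encode {x. x < b \<and> P x} = (LEAST c. \<forall>x<b + c. x \<in> set_decode c \<longleftrightarrow> x < b \<and> P x)"
    (is "?s = _") for b :: nat and P
  proof (rule Least_equality[symmetric])
    show "\<forall>x<b + ?s. x \<in> set_decode ?s \<longleftrightarrow> x < b \<and> P x"
      by simp
    fix c assume c: "\<forall>x<b + c. x \<in> set_decode c \<longleftrightarrow> x < b \<and> P x"
    have "set_decode c = {x. x < b \<and> P x}"
    proof (rule set_eqI)
      show "x \<in> set_decode c \<longleftrightarrow> x \<in> {x. x < b \<and> P x}" for x
        using c[rule_format, of x] mem_set_decode_less[of x c] by fastforce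
    qed
    then show "?s \<le> c" by (metis order_refl set_decode_inverse)
  qed
  have ex: "\<exists>c. \<forall>x<b + c. x \<in> set_decode c \<longleftrightarrow> x < b \<and> P x" for b :: nat and P
    by (rule exI[of _ "set_encode {x. x < b \<and> P x}"]) simp
  have Q': "decidable (\<lambda>z. Q (A z) (C z))" if "computable A" "computable C" for A C
    using decidable_comp[OF Q computable_arith(5)[OF that]] by simp
  show ?thesis unfolding *
    by (intro computable_Least ex computable_intros computable_comp[OF assms(1)] Q')
qed

section \<open>Tables and course-of-values recursion\<close>

text \<open>Read as a table, \<open>m\<close> is the code of a finite set of pairs; the disjunct \<open>y = m\<close> only makes
  the search succeed for an argument without entry.\<close>

definition app :: "nat \<Rightarrow> nat \<Rightarrow> nat" where
  "app m x = (LEAST y. pair x y \<in> set_decode m \<or> y = m)"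

definition tab :: "(nat \<Rightarrow> nat) \<Rightarrow> nat \<Rightarrow> nat" where
  "tab F b = (LEAST m. \<forall>x<b. app m x = F x)"

lemma ex_table: "\<exists>m. \<forall>x<b. app m x = F x"
proof
  let ?S = "(\<lambda>x. pair x (F x)) ` {..<b}"
  show "\<forall>x<b. app (set_encode ?S) x = F x"
  proof (intro allI impI)
    fix x assume x: "x < b"
    \<comment> \<open>The entry lies strictly below the code of the table, so the search meets it
      before the fallback value \<open>y = m\<close>.\<close>
    then have "pair x (F x) < set_encode ?S"
      by (intro mem_set_decode_less) simp
    then have "F x < set_encode ?S"
      using le_prod_encode_2[of "F x" x] by linarith
    then show "app (set_encode ?S) x = F x"
      unfolding app_def using x by (intro Least_equality) auto
  qed
qed

lemma app_tab [simp]: "x < b \<Longrightarrow> app (tab F b) x = F x"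
  unfolding tab_def using LeastI_ex[OF ex_table[of b F]] by blast

lemma computable_app [computable_intros]: "computable A \<Longrightarrow> computable B \<Longrightarrow> computable
  (\<lambda>n. app (A n) (B n))"
proof -
  have "computable2 app"
    unfolding computable2_def app_def by (intro computable_Least computable_intros) blast
  from computable2D[OF this] show "computable A \<Longrightarrow> computable B \<Longrightarrow> ?thesis" .
qed

lemma computable_tab [computable_intros]:
  assumes B: "computable B" and F: "computable (\<lambda>z. F (pfst z) (psnd z))"
  shows "computable (\<lambda>n. tab (F n) (B n))"
  unfolding tab_def
  by (intro computable_Least ex_table computable_intros computable_comp[OF B]
    computable2D[OF F[folded computable2_def]])

text \<open>The recursion carries a table of all earlier values. Its code stays hidden behind an
  existential: the step functions look up only arguments below \<open>x\<close>, so agreement there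
  is what later inductions use.\<close>

lemma course_of_values:
  assumes G: "computable (\<lambda>z. G (pfst z) (pfst (psnd z)) (psnd (psnd z)))"
  shows "\<exists>f. computable2 f \<and> (\<forall>p x. \<exists>m. f p x = G p x m \<and> (\<forall>y<x. app m y = f p y))"
proof -
  have G3: "computable (\<lambda>n. G (A n) (B n) (C n))" if "computable A" "computable B" "computable C"
    for A B C
    using computable_comp[OF G, of "\<lambda>n. pair (A n) (pair (B n) (C n))"] that by
      (simp add: computable_arith)
  define T where "T p x = rec_nat 0 (\<lambda>k r. tab (\<lambda>y. if y = k then G p k r else app r y) (Suc k)) x"
    for p x
  define f where "f p x = G p x (T p x)" for p x
  have T: "app (T p x) y = f p y" if "y < x" for p x y
    using that
  proof (induction x)
    case (Suc x)
    have "app (T p (Suc x)) y = (if y = x then G p x (T p x) else app (T p x) y)"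
      using Suc.prems by (simp add: T_def)
    then show ?case using Suc by (auto simp: f_def)
  qed simp
  have "computable2 f"
    unfolding computable2_def f_def T_def by (intro G3 computable_intros)
  moreover have "f p x = G p x (T p x)" "\<forall>y<x. app (T p x) y = f p y" for p x
    using T by (auto simp: f_def)
  ultimately show ?thesis by blast
qed

section \<open>Recognition of \<open>\<omega>\<close>-languages by finite semigroups\<close>

definition words :: "nat \<Rightarrow> nat list set" where
  "words L = {u. u \<noteq> [] \<and> set u \<subseteq> {..<L}}"

definition seg :: "(nat \<Rightarrow> nat) \<Rightarrow> nat \<Rightarrow> nat \<Rightarrow> nat list" where
  "seg w i j = map w [i..<j]"

definition factors :: "(nat list \<Rightarrow> 's) \<Rightarrow> (nat \<Rightarrow> nat) \<Rightarrow> (nat \<Rightarrow> nat) \<Rightarrow> 's \<Rightarrow> 's \<Rightarrow> bool" where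
  "factors v w f s e \<longleftrightarrow> strict_mono f \<and> 0 < f 0 \<and> v (seg w 0 (f 0)) = s \<and>
     (\<forall>i. v (seg w (f i) (f (Suc i))) = e)"

text \<open>The classical recognition by linked pairs \<open>(s, e)\<close>. Every factorisation of
  a word must give the same answer, hence complementation only negates \<open>P\<close>; Ramsey's
  theorem provides at least one, hence \<open>P\<close> determines the language on words over
  \<open>L\<close>.\<close>

definition recognizes ::
  "nat \<Rightarrow> (nat list \<Rightarrow> 's) \<Rightarrow> ('s \<Rightarrow> 's \<Rightarrow> 's) \<Rightarrow> ('s \<Rightarrow> 's \<Rightarrow> bool) \<Rightarrow> (nat \<Rightarrow> nat) set \<Rightarrow> bool" where
  "recognizes L v m P A \<longleftrightarrow> finite (v ` words L) \<and>
     (\<forall>u\<in>words L. \<forall>u'\<in>words L. v (u @ u') = m (v u) (v u')) \<and>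
     (\<forall>w f s e. (\<forall>n. w n < L) \<longrightarrow> factors v w f s e \<longrightarrow> m e e = e \<longrightarrow> m s e = s \<longrightarrow>
        (w \<in> A \<longleftrightarrow> P s e))"

lemma recognizesD:
  assumes "recognizes L v m P A"
  shows "finite (v ` words L)"
    and "u \<in> words L \<Longrightarrow> u' \<in> words L \<Longrightarrow> v (u @ u') = m (v u) (v u')"
    and "(\<And>n. w n < L) \<Longrightarrow> factors v w f s e \<Longrightarrow> m e e = e \<Longrightarrow> m s e = s \<Longrightarrow> w \<in> A \<longleftrightarrow> P s e"
  using assms unfolding recognizes_def by blast+

lemma recognizesI:
  assumes "finite (v ` words L)"
    and "\<And>u u'. u \<in> words L \<Longrightarrow> u' \<in> words L \<Longrightarrow> v (u @ u') = m (v u) (v u')"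
    and "\<And>w f s e. \<forall>n. w n < L \<Longrightarrow> factors v w f s e \<Longrightarrow> m e e = e \<Longrightarrow> m s e = s \<Longrightarrow>
      w \<in> A \<longleftrightarrow> P s e"
  shows "recognizes L v m P A"
  using assms unfolding recognizes_def by simp

lemma words_append: "u \<in> words L \<Longrightarrow> u' \<in> words L \<Longrightarrow> u @ u' \<in> words L"
  unfolding words_def by auto

lemma seg_words: "(\<And>n. w n < L) \<Longrightarrow> i < j \<Longrightarrow> seg w i j \<in> words L"
  unfolding seg_def words_def by auto

lemma seg_append: "i \<le> j \<Longrightarrow> j \<le> k \<Longrightarrow> seg w i j @ seg w j k = seg w i k"
  unfolding seg_def by (metis le_Suc_ex map_append upt_add_eq_append)

lemma seg_hom:
  assumes "recognizes L v m P A" "\<And>n. w n < L" "i < j" "j < k"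
  shows "v (seg w i k) = m (v (seg w i j)) (v (seg w j k))"
  using recognizesD(2)[OF assms(1) seg_words[of w L i j] seg_words[of w L j k]] assms
    seg_append[of i j k w] by simp

text \<open>Pairs of cut points are coloured by the value of the segment between them, and an
  infinite homogeneous set is taken. Cuts are chosen among the given positions \<open>f\<close>,
  because the projection argument refines an existing factorisation.\<close>

lemma ramsey_factors:
  fixes f :: "nat \<Rightarrow> nat"
  assumes R: "recognizes L v m P A" and w: "\<And>n. w n < L" and f: "strict_mono f" "0 < f 0"
  obtains h s e where "strict_mono h" "factors v w (f \<circ> h) s e" "m e e = e" "m s e = s"
proof -
  let ?V = "v ` words L"
  obtain g where g: "bij_betw g ?V {0..<card ?V}"
    using ex_bij_betw_finite_nat[OF recognizesD(1)[OF R]] by blast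
  let ?c = "\<lambda>X. v (seg w (f (Min X)) (f (Max X)))"
  have c: "?c {x, y} \<in> ?V" if "x \<noteq> y" for x y
  proof -
    have "f (Min {x, y}) < f (Max {x, y})"
      using that by (intro strict_monoD[OF f(1)]) auto
    then show ?thesis using seg_words[of w L] w by blast
  qed
  have "\<exists>Y t. Y \<subseteq> UNIV \<and> infinite Y \<and> t < card ?V \<and>
      (\<forall>x\<in>Y. \<forall>y\<in>Y. x \<noteq> y \<longrightarrow> g (?c {x, y}) = t)"
    by (rule Ramsey2) (use c g in \<open>auto simp: bij_betw_def\<close>)
  then obtain Y t where Y: "infinite Y" and t': "\<forall>x\<in>Y. \<forall>y\<in>Y. x \<noteq> y \<longrightarrow> g (?c {x, y}) = t"
    by (elim exE conjE)
  note t = t'[rule_format]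
  define k where "k = enumerate Y"
  have k: "strict_mono k" "\<And>i. k i \<in> Y"
    unfolding k_def using Y by (auto intro: strict_mono_enumerate enumerate_in_set)
  define e where "e = ?c {k 0, k 1}"
  have e: "v (seg w (f (k i)) (f (k j))) = e" if "i < j" for i j
  proof -
    have "k i < k j" "k 0 < k 1" using k(1) that by (auto simp: strict_monoD)
    then have "g (?c {k i, k j}) = g (?c {k 0, k 1})"
      using t k(2) by (metis less_irrefl)
    then have "?c {k i, k j} = e"
      unfolding e_def using c \<open>k i < k j\<close> \<open>k 0 < k 1\<close> g
      by (metis bij_betw_imp_inj_on inj_on_eq_iff less_irrefl)
    with \<open>k i < k j\<close> show ?thesis by simp
  qed
  have fk: "f (k i) < f (k j)" if "i < j" for i j
    using that f(1) k(1) by (simp add: strict_monoD)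
  have pos: "0 < f (k i)" for i
    using f strict_mono_less_eq[OF f(1), of 0 "k i"] by simp
  \<comment> \<open>The prefix ends at \<open>k 1\<close> and not at \<open>k 0\<close>: it then
    already contains a last block of value \<open>e\<close>, which by idempotence absorbs another
    one, so that \<open>m s e = s\<close>.\<close>
  define s where "s = v (seg w 0 (f (k 1)))"
  have hom: "v (seg w i k) = m (v (seg w i j)) (v (seg w j k))" if "i < j" "j < k" for i j k
    using seg_hom[OF R w that] .
  show ?thesis
  proof
    show "strict_mono (k \<circ> Suc)"
      using k(1) by (simp add: strict_mono_def)
    show "factors v w (f \<circ> (k \<circ> Suc)) s e"
      using f(1) k(1) pos e by (simp add: factors_def s_def strict_mono_def)
    show "m e e = e"
      using hom[OF fk[of 0 1] fk[of 1 2]] e[of 0 1] e[of 1 2] e[of 0 2] by simp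
    show "m s e = s"
    proof -
      have "m s e = v (seg w 0 (f (k 2)))"
        using hom[OF pos[of 1] fk[of 1 2]] e[of 1 2] by (simp add: s_def)
      also have "\<dots> = m (v (seg w 0 (f (k 0)))) e"
        using hom[OF pos[of 0] fk[of 0 2]] e[of 0 2] by simp
      also have "\<dots> = s"
        using hom[OF pos[of 0] fk[of 0 1]] e[of 0 1] by (simp add: s_def)
      finally show ?thesis .
    qed
  qed
qed

lemma recognizes_Compl:
  "recognizes L v m P A \<Longrightarrow> recognizes L v m (\<lambda>s e. \<not> P s e) (- A)"
  unfolding recognizes_def by simp

lemma recognizes_Int:
  assumes "recognizes L v1 m1 P1 A1" "recognizes L v2 m2 P2 A2"
  shows "recognizes L (\<lambda>u. (v1 u, v2 u)) (\<lambda>x y. (m1 (fst x) (fst y), m2 (snd x) (snd y)))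
    (\<lambda>x y. P1 (fst x) (fst y) \<and> P2 (snd x) (snd y)) (A1 \<inter> A2)"
proof -
  have "finite (v1 ` words L \<times> v2 ` words L)"
    using assms by (simp add: recognizes_def)
  then have "finite ((\<lambda>u. (v1 u, v2 u)) ` words L)"
    by (rule rev_finite_subset) auto
  moreover have "w \<in> A1 \<inter> A2 \<longleftrightarrow> P1 (fst s) (fst e) \<and> P2 (snd s) (snd e)"
    if w: "\<forall>n. w n < L" and fac: "factors (\<lambda>u. (v1 u, v2 u)) w f s e"
      and "(m1 (fst e) (fst e), m2 (snd e) (snd e)) = e" "(m1 (fst s) (fst e), m2 (snd s) (snd e)) = s"
    for w f s e
  proof -
    have "factors v1 w f (fst s) (fst e)" "factors v2 w f (snd s) (snd e)"
      using fac by (auto simp: factors_def)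
    then show ?thesis
      using recognizesD(3)[OF assms(1)] recognizesD(3)[OF assms(2)] w that(3,4)
      by (metis IntD1 IntD2 IntI fst_conv snd_conv)
  qed
  ultimately show ?thesis
    using recognizesD(2)[OF assms(1)] recognizesD(2)[OF assms(2)]
    unfolding recognizes_def by auto
qed

lemma recognizes_vimage:
  assumes R: "recognizes L' v m P A" and f: "\<And>a. a < L \<Longrightarrow> f a < L'"
  shows "recognizes L (\<lambda>u. v (map f u)) m P {w. f \<circ> w \<in> A}"
proof -
  have words: "map f u \<in> words L'" if "u \<in> words L" for u
    using that f by (auto simp: words_def)
  then have "finite ((\<lambda>u. v (map f u)) ` words L)"
    by (intro finite_subset[OF _ recognizesD(1)[OF R]]) auto
  moreover have "w \<in> {w. f \<circ> w \<in> A} \<longleftrightarrow> P s e"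
    if w: "\<forall>n. w n < L" and fac: "factors (\<lambda>u. v (map f u)) w g s e" and "m e e = e" "m s e = s"
    for w g s e
  proof -
    have "factors v (f \<circ> w) g s e"
      using fac by (simp add: factors_def seg_def)
    then show ?thesis
      using recognizesD(3)[OF R] w f that(3,4) by (metis comp_apply mem_Collect_eq)
  qed
  ultimately show ?thesis
    using recognizesD(2)[OF R words words] unfolding recognizes_def by simp
qed

definition variants :: "nat \<Rightarrow> (nat \<Rightarrow> nat \<Rightarrow> bool) \<Rightarrow> nat list \<Rightarrow> nat list set" where
  "variants L R u = {u'. list_all2 (\<lambda>a a'. a' < L \<and> R a a') u u'}"

lemma variants_words: "u \<in> words L \<Longrightarrow> u' \<in> variants L R u \<Longrightarrow> u' \<in> words L"
  unfolding words_def variants_def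
  by (auto simp: list_all2_conv_all_nth in_set_conv_nth)

lemma variants_append: "variants L R (u @ u') = {x @ y |x y. x \<in> variants L R u \<and> y \<in> variants L R u'}"
proof (intro set_eqI iffI)
  fix z assume "z \<in> variants L R (u @ u')"
  then show "z \<in> {x @ y |x y. x \<in> variants L R u \<and> y \<in> variants L R u'}"
    unfolding variants_def list_all2_append1 mem_Collect_eq by (elim exE conjE) blast
qed (auto simp: variants_def intro: list_all2_appendI)

lemma ex_block:
  fixes f :: "nat \<Rightarrow> nat"
  assumes "strict_mono f" "f 0 \<le> n"
  obtains i where "f i \<le> n" "n < f (Suc i)"
proof -
  have fin: "finite {i. f i \<le> n}"
    by (rule finite_subset[of _ "{..n}"])
      (auto intro: le_trans[OF strict_mono_imp_increasing[OF assms(1)]])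
  let ?i = "Max {i. f i \<le> n}"
  have "?i \<in> {i. f i \<le> n}" using assms(2) by (intro Max_in fin) auto
  moreover have "\<not> f (Suc ?i) \<le> n"
    using Max_ge[OF fin, of "Suc ?i"] by auto
  ultimately show ?thesis using that[of ?i] by auto
qed

lemma glue_segments:
  assumes f: "strict_mono f" "0 < f 0"
    and u0: "length u0 = f 0" and u: "\<And>i. length (u i) = f (Suc i) - f i"
  obtains w where "seg w 0 (f 0) = u0" "\<And>i. seg w (f i) (f (Suc i)) = u i"
proof -
  define blk where "blk n = (THE i. f i \<le> n \<and> n < f (Suc i))" for n
  have blk: "blk n = i" if "f i \<le> n" "n < f (Suc i)" for i n
    unfolding blk_def
  proof (rule the_equality)
    show "j = i" if "f j \<le> n \<and> n < f (Suc j)" for j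
    proof -
      have "f j < f (Suc i)" "f i < f (Suc j)"
        using that \<open>f i \<le> n\<close> \<open>n < f (Suc i)\<close> by linarith+
      then show ?thesis using f(1) by (simp add: strict_mono_less)
    qed
  qed (use that in simp)
  define w where "w n = (if n < f 0 then u0 ! n else u (blk n) ! (n - f (blk n)))" for n
  have f0: "f 0 \<le> f i" for i using f(1) by (simp add: strict_mono_less_eq)
  have "seg w 0 (f 0) = u0"
    by (rule nth_equalityI) (auto simp: seg_def u0 w_def)
  moreover have "seg w (f i) (f (Suc i)) = u i" for i
  proof (rule nth_equalityI)
    show "length (seg w (f i) (f (Suc i))) = length (u i)" by (simp add: seg_def u)
    fix k assume "k < length (seg w (f i) (f (Suc i)))"
    then have k: "f i + k < f (Suc i)" by (simp add: seg_def)
    then have "blk (f i + k) = i" by (intro blk) auto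
    then show "seg w (f i) (f (Suc i)) ! k = u i ! k"
      using k f0[of i] by (simp add: seg_def w_def)
  qed
  ultimately show ?thesis by (rule that)
qed

lemma ex_segment:
  fixes f :: "nat \<Rightarrow> nat"
  assumes "strict_mono f"
  shows "(\<exists>k<f 0. n = k) \<or> (\<exists>i k. k < f (Suc i) - f i \<and> n = f i + k)"
proof (cases "n < f 0")
  case False
  then obtain i where "f i \<le> n" "n < f (Suc i)"
    by (metis ex_block[OF assms] not_less)
  then show ?thesis by (intro disjI2 exI[of _ i] exI[of _ "n - f i"]) auto
qed simp

text \<open>Ramsey's theorem supplies an idempotent element of the idempotent set \<open>E\<close> along a coarsening of the
  given factorisation.\<close>

lemma recognizes_project:
  fixes R :: "nat \<Rightarrow> nat \<Rightarrow> bool"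
  assumes S: "recognizes L v m P A"
  shows "recognizes L (\<lambda>u. v ` variants L R u) (\<lambda>X Y. {m x y |x y. x \<in> X \<and> y \<in> Y})
    (\<lambda>X Y. \<exists>x\<in>X. \<exists>y\<in>Y. m y y = y \<and> m x y = x \<and> P x y)
    {w. \<exists>w'. (\<forall>n. w' n < L \<and> R (w n) (w' n)) \<and> w' \<in> A}"
    (is "recognizes L ?v ?m ?P ?A")
proof -
  have "?v ` words L \<subseteq> Pow (v ` words L)"
    using variants_words by blast
  then have fin: "finite (?v ` words L)"
    using recognizesD(1)[OF S] by (simp add: finite_subset)
  have hom: "?v (u @ u') = ?m (?v u) (?v u')" if u: "u \<in> words L" "u' \<in> words L" for u u'
  proof -
    have *: "v (x @ y) = m (v x) (v y)" if "x \<in> variants L R u" "y \<in> variants L R u'" for x y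
      using recognizesD(2)[OF S] variants_words u that by metis
    show ?thesis
      unfolding variants_append using * by (force simp: image_iff)
  qed
  have "w \<in> ?A \<longleftrightarrow> ?P X E"
    if w: "\<forall>n. w n < L" and fac: "factors ?v w f X E" and EE: "?m E E = E" and XE: "?m X E = X"
    for w f X E
  proof
    have f: "strict_mono f" "0 < f 0" and X: "?v (seg w 0 (f 0)) = X"
      and E: "\<And>i. ?v (seg w (f i) (f (Suc i))) = E"
      using fac by (auto simp: factors_def)
    {
      assume "w \<in> ?A"
      then obtain w' where w': "\<And>n. w' n < L" "\<And>n. R (w n) (w' n)" "w' \<in> A" by blast
      have var: "seg w' i j \<in> variants L R (seg w i j)" for i j
        using w' by (auto simp: variants_def seg_def list_all2_conv_all_nth)
      obtain h s e where h: "strict_mono h" and fac': "factors v w' (f \<circ> h) s e"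
        and se: "m e e = e" "m s e = s"
        by (rule ramsey_factors[OF S w'(1) f])
      have fm: "f i < f j" if "i < j" for i j using f that by (simp add: strict_monoD)
      have inE: "?v (seg w (f i) (f (i + Suc k))) = E" for i k
      proof (induction k)
        case (Suc k)
        have "?v (seg w (f i) (f (i + Suc (Suc k))))
            = ?v (seg w (f i) (f (i + Suc k)) @ seg w (f (i + Suc k)) (f (i + Suc (Suc k))))"
          using fm[of i "i + Suc k"] fm[of "i + Suc k" "i + Suc (Suc k)"] by (subst seg_append) auto
        also have "\<dots> = ?m E E"
          using hom[OF seg_words seg_words] w fm Suc E[of "i + Suc k"] by simp
        finally show ?case using EE by simp
      qed (use E in simp)
      have inX: "?v (seg w 0 (f k)) = X" for k
      proof (cases k)
        case (Suc j)
        have "?v (seg w 0 (f k)) = ?v (seg w 0 (f 0) @ seg w (f 0) (f k))"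
          using f(2) fm[of 0 k] Suc by (subst seg_append) auto
        also have "\<dots> = ?m X E"
          using hom[OF seg_words seg_words] w fm[of 0 k] f(2) X inE[of 0 j] Suc by simp
        finally show ?thesis using XE by simp
      qed (use X in simp)
      have "s = v (seg w' 0 (f (h 0)))" "e = v (seg w' (f (h 0)) (f (h 1)))"
        using fac' by (auto simp: factors_def)
      moreover have "h 1 = h 0 + Suc (h 1 - h 0 - 1)"
        using strict_monoD[OF h, of 0 1] by simp
      ultimately have "s \<in> X" "e \<in> E"
        using var inX[of "h 0"] inE[of "h 0" "h 1 - h 0 - 1"] by (metis imageI)+
      moreover have "P s e"
        using recognizesD(3)[OF S w'(1) fac' se] w'(3) by simp
      ultimately show "?P X E" using se by blast
    next
      assume "?P X E"
      \<comment> \<open>Every block of \<open>w\<close> has a variant of value \<open>y\<close>.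
        Gluing these variants at the same cuts gives a word that is factorised by the linked pair
        \<open>(x, y)\<close>.\<close>
      then obtain x y where xy: "x \<in> X" "y \<in> E" "m y y = y" "m x y = x" "P x y" by blast
      obtain u0 where u0: "u0 \<in> variants L R (seg w 0 (f 0))" "v u0 = x"
        using xy(1) X by blast
      have "\<exists>u. u \<in> variants L R (seg w (f i) (f (Suc i))) \<and> v u = y" for i
        using xy(2) E[of i] by blast
      then obtain u where u: "\<And>i. u i \<in> variants L R (seg w (f i) (f (Suc i)))" "\<And>i. v (u i) = y"
        by metis
      obtain w' where w': "seg w' 0 (f 0) = u0" "\<And>i. seg w' (f i) (f (Suc i)) = u i"
      proof (rule glue_segments[OF f, of u0 u])
        show "length u0 = f 0"
          using u0(1) by (auto simp: variants_def seg_def dest: list_all2_lengthD)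
        show "length (u i) = f (Suc i) - f i" for i
          using u(1)[of i] by (auto simp: variants_def seg_def dest: list_all2_lengthD)
      qed blast
      have "w' n < L \<and> R (w n) (w' n)" for n
        using ex_segment[OF f(1), of n]
      proof (elim disjE exE conjE)
        fix k assume "k < f 0" "n = k"
        then show ?thesis
          using u0(1) w'(1)[symmetric] by (auto simp: variants_def seg_def list_all2_conv_all_nth)
      next
        fix i k assume "k < f (Suc i) - f i" "n = f i + k"
        then show ?thesis
          using u(1)[of i] w'(2)[of i, symmetric]
          by (auto simp: variants_def seg_def list_all2_conv_all_nth)
      qed
      moreover from this have "w' \<in> A"
      proof -
        have "factors v w' f x y"
          using f w' u0 u by (simp add: factors_def)
        then show ?thesis using recognizesD(3)[OF S] \<open>\<And>n. w' n < L \<and> R (w n) (w' n)\<close> xy by blast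
      qed
      ultimately show "w \<in> ?A" by blast
    }
  qed
  with fin hom show ?thesis by (rule recognizesI)
qed

section \<open>Numerical codes of recognising semigroups\<close>

text \<open>A number \<open>d\<close> stands for a bound on the elements, the multiplication table, the values of the
  letters and the table of accepting pairs.\<close>

abbreviation "dN d \<equiv> pfst d"
abbreviation "dM d \<equiv> pfst (psnd d)"
abbreviation "dH d \<equiv> pfst (psnd (psnd d))"
abbreviation "dP d \<equiv> psnd (psnd (psnd d))"
abbreviation "mkd n m h p \<equiv> pair n (pair m (pair h p))"
abbreviation "mulD d x y \<equiv> app (dM d) (pair x y)"
abbreviation "letD d a \<equiv> app (dH d) a"
abbreviation "accD d x y \<equiv> app (dP d) (pair x y) \<noteq> 0"

fun val :: "nat \<Rightarrow> nat list \<Rightarrow> nat" where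
  "val d [] = 0"
| "val d [a] = letD d a"
| "val d (a # b # u) = mulD d (letD d a) (val d (b # u))"

text \<open>The bound \<open>dN d\<close> on the values of words lets the constructions below
  quantify over semigroup elements by bounded, hence decidable, quantifiers.\<close>

definition recog :: "nat \<Rightarrow> nat \<Rightarrow> (nat \<Rightarrow> nat) set \<Rightarrow> bool" where
  "recog L d A \<longleftrightarrow> recognizes L (val d) (mulD d) (accD d) A \<and> (\<forall>u\<in>words L. val d u < dN d)"

lemma pair_less: "x < n \<Longrightarrow> y < n \<Longrightarrow> pair x y < pair n n"
  using triangle_mono[of "x + y" "n + n"] by (simp add: prod_encode_def)

lemma pair_le: "x \<le> n \<Longrightarrow> y \<le> k \<Longrightarrow> pair x y \<le> pair n k"
  using triangle_mono[of "x + y" "n + k"] by (simp add: prod_encode_def)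

text \<open>Transport along an injection \<open>g\<close> of an abstract semigroup into the numbers.
  Injectivity on the values of words turns the equations of a numerical linked pair back into
  equations for \<open>m\<close>, so the acceptance conditions can be compared.\<close>

lemma recogI:
  assumes R: "recognizes L v m P A" and g: "inj_on g (v ` words L)"
    and H: "\<And>a. a < L \<Longrightarrow> letD d a = g (v [a])"
    and M: "\<And>x y. x \<in> v ` words L \<Longrightarrow> y \<in> v ` words L \<Longrightarrow> mulD d (g x) (g y) = g (m x y)"
    and P: "\<And>x y. x \<in> v ` words L \<Longrightarrow> y \<in> v ` words L \<Longrightarrow> accD d (g x) (g y) \<longleftrightarrow> P x y"
    and N: "\<And>x. x \<in> v ` words L \<Longrightarrow> g x < dN d"
  shows "recog L d A"
proof -
  have val: "val d u = g (v u)" if "u \<in> words L" for u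
    using that H M
  proof (induction d u rule: val.induct)
    case (3 d a b u)
    then have 1: "[a] \<in> words L" "b # u \<in> words L" by (auto simp: words_def)
    have "v (a # b # u) = m (v [a]) (v (b # u))"
      using recognizesD(2)[OF R 1] by simp
    moreover have "val d (b # u) = g (v (b # u))" "letD d a = g (v [a])"
      using 3 1 by (auto simp: words_def)
    ultimately show ?case
      using "3.prems"(3)[OF imageI imageI, OF 1] by simp
  qed (use H in \<open>auto simp: words_def\<close>)
  have m: "m x y \<in> v ` words L" if "x \<in> v ` words L" "y \<in> v ` words L" for x y
    using that recognizesD(2)[OF R, symmetric] words_append by fastforce
  have "val d ` words L = g ` v ` words L"
    using val by (auto simp: image_image)
  then have "finite (val d ` words L)"
    using recognizesD(1)[OF R] by simp
  moreover have "val d (u @ u') = mulD d (val d u) (val d u')" if "u \<in> words L" "u' \<in> words L" for u u'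
    using that val words_append M recognizesD(2)[OF R] by simp
  moreover have "w \<in> A \<longleftrightarrow> accD d s e"
    if w: "\<forall>n. w n < L" and fac: "factors (val d) w f s e" and ee: "mulD d e e = e" and se:
      "mulD d s e = s"
    for w f s e
  proof -
    define s' e' where "s' = v (seg w 0 (f 0))" and "e' = v (seg w (f 0) (f 1))"
    have f: "strict_mono f" "0 < f 0" "f i < f (Suc i)" for i
      using fac by (auto simp: factors_def strict_mono_less)
    have in_words: "seg w 0 (f 0) \<in> words L" "seg w (f i) (f (Suc i)) \<in> words L" for i
      using seg_words w f by blast+
    have V: "s' \<in> v ` words L" "e' \<in> v ` words L"
      using in_words(1) in_words(2)[of 0] by (auto simp: s'_def e'_def)
    have s: "s = g s'" and e: "\<And>i. e = g (v (seg w (f i) (f (Suc i))))"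
      using fac val in_words by (auto simp: factors_def s'_def)
    have e': "v (seg w (f i) (f (Suc i))) = e'" for i
      unfolding e'_def
      by (rule inj_onD[OF g]) (use e[of i] e[of 0] in_words(2)[of i] in_words(2)[of 0] in auto)
    have "factors v w f s' e'"
      using f e' by (simp add: factors_def s'_def)
    moreover have "e = g e'" using e[of 0] e' by simp
    then have "m e' e' = e'" "m s' e' = s'"
      using ee se s M V m g by (auto simp: inj_on_eq_iff)
    ultimately have "w \<in> A \<longleftrightarrow> P s' e'"
      using recognizesD(3)[OF R] w by blast
    then show ?thesis using P V s \<open>e = g e'\<close> by simp
  qed
  ultimately show ?thesis
    unfolding recog_def recognizes_def using val N by auto
qed

text \<open>Any numbering of the finitely many values gives a code. The choice is not effective,
  which is enough for languages that do not depend on the formula to be decided.\<close>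

lemma ex_recog:
  assumes R: "recognizes L v m P A"
  shows "\<exists>d. recog L d A"
proof -
  let ?V = "v ` words L"
  obtain g where g: "bij_betw g ?V {0..<card ?V}"
    using ex_bij_betw_finite_nat[OF recognizesD(1)[OF R]] by blast
  let ?n = "card ?V" and ?i = "inv_into ?V g"
  let ?d = "mkd ?n (tab (\<lambda>z. g (m (?i (pfst z)) (?i (psnd z)))) (pair ?n ?n)) (tab (\<lambda>a. g (v [a])) L)
    (tab (\<lambda>z. of_bool (P (?i (pfst z)) (?i (psnd z)))) (pair ?n ?n))"
  have lt: "g x < ?n" and inv: "?i (g x) = x" if "x \<in> ?V" for x
    using that g by (auto simp: bij_betw_def)
  have "recog L ?d A"
    by (rule recogI[OF R bij_betw_imp_inj_on[OF g]]) (simp_all add: lt inv pair_less)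
  then show ?thesis ..
qed

definition negd :: "nat \<Rightarrow> nat" where
  "negd d = mkd (dN d) (dM d) (dH d) (tab (\<lambda>z. of_bool (app (dP d) z = 0)) (pair (dN d) (dN d)))"

lemma recog_negd:
  assumes "recog L d A"
  shows "recog L (negd d) (- A)"
proof -
  have R: "recognizes L (val d) (mulD d) (accD d) A" and N: "\<And>u. u \<in> words L \<Longrightarrow> val d u < dN d"
    using assms by (auto simp: recog_def)
  show ?thesis
    by (rule recogI[OF recognizes_Compl[OF R], where g = "\<lambda>x. x"])
      (auto simp: negd_def N pair_less)
qed

definition conjd :: "nat \<Rightarrow> nat \<Rightarrow> nat \<Rightarrow> nat" where
  "conjd L d e = (let n = Suc (pair (dN d) (dN e)) in
     mkd n (tab (\<lambda>z. pair (mulD d (pfst (pfst z)) (pfst (psnd z)))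
       (mulD e (psnd (pfst z)) (psnd (psnd z)))) (pair n n))
       (tab (\<lambda>a. pair (letD d a) (letD e a)) L)
       (tab (\<lambda>z. of_bool (accD d (pfst (pfst z)) (pfst (psnd z)) \<and> accD e (psnd (pfst z))
         (psnd (psnd z)))) (pair n n)))"

lemma recog_conjd:
  assumes "recog L d A" "recog L e B"
  shows "recog L (conjd L d e) (A \<inter> B)"
proof -
  have R: "recognizes L (val d) (mulD d) (accD d) A" and N: "\<And>u. u \<in> words L \<Longrightarrow> val d u < dN d"
    and R': "recognizes L (val e) (mulD e) (accD e) B" and N': "\<And>u. u \<in> words L \<Longrightarrow> val e u < dN e"
    using assms by (auto simp: recog_def)
  have lt: "pair (val d u) (val e u) < Suc (pair (dN d) (dN e))" if "u \<in> words L" for u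
    using N[OF that] N'[OF that] by (intro le_imp_less_Suc pair_le) auto
  show ?thesis
    by (rule recogI[OF recognizes_Int[OF R R'], where g = prod_encode])
      (auto simp: conjd_def Let_def lt pair_less intro: inj_prod_encode)
qed

definition mapd :: "nat \<Rightarrow> (nat \<Rightarrow> nat) \<Rightarrow> nat \<Rightarrow> nat" where
  "mapd L f d = mkd (dN d) (dM d) (tab (\<lambda>a. letD d (f a)) L) (dP d)"

lemma recog_mapd:
  assumes "recog L' d A" and f: "\<And>a. a < L \<Longrightarrow> f a < L'"
  shows "recog L (mapd L f d) {w. f \<circ> w \<in> A}"
proof -
  have R: "recognizes L' (val d) (mulD d) (accD d) A" and N: "\<And>u. u \<in> words L' \<Longrightarrow> val d u < dN d"
    using assms by (auto simp: recog_def)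
  have words: "map f u \<in> words L'" if "u \<in> words L" for u
    using that f by (auto simp: words_def)
  show ?thesis
    by (rule recogI[OF recognizes_vimage[OF R f], where g = "\<lambda>x. x"])
      (auto simp: mapd_def N words)
qed

text \<open>The powerset semigroup: a set of elements below \<open>n\<close> is coded by a number
  below \<open>2 ^ n\<close>. A pair of sets accepts when it contains an accepting linked
  pair.\<close>

definition projd :: "nat \<Rightarrow> (nat \<Rightarrow> nat \<Rightarrow> bool) \<Rightarrow> nat \<Rightarrow> nat" where
  "projd L R d = (let n = dN d; k = pair (2 ^ n) (2 ^ n) in
     mkd (2 ^ n)
       (tab (\<lambda>z. set_encode {v. v < n \<and> (\<exists>x<n. \<exists>y<n. x \<in> set_decode (pfst z) \<and> y \<in> set_decode (psnd z) \<and>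
          mulD d x y = v)}) k)
       (tab (\<lambda>a. set_encode {v. v < n \<and> (\<exists>b<L. R a b \<and> letD d b = v)}) L)
       (tab (\<lambda>z. of_bool (\<exists>x<n. \<exists>y<n. x \<in> set_decode (pfst z) \<and> y \<in> set_decode (psnd z) \<and>
          mulD d y y = y \<and> mulD d x y = x \<and> accD d x y)) k))"

lemma set_encode_less: 
  assumes "X \<subseteq> {..<n}"
  shows "set_encode X < 2 ^ n"
proof -
  have "set_encode X \<le> sum ((^) 2) {..<n}"
    unfolding set_encode_def by (rule sum_mono2) (use assms in auto)
  also have "\<dots> = 2 ^ n - 1"
    using sum_power2[of n] by (simp add: lessThan_atLeast0)
  also have "\<dots> < 2 ^ n" by simp
  finally show ?thesis .
qed

lemma recog_projd:
  assumes "recog L d A"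
  shows "recog L (projd L R d) {w. \<exists>w'. (\<forall>n. w' n < L \<and> R (w n) (w' n)) \<and> w' \<in> A}"
proof -
  have S: "recognizes L (val d) (mulD d) (accD d) A" and N: "\<And>u. u \<in> words L \<Longrightarrow> val d u < dN d"
    using assms by (auto simp: recog_def)
  have mul: "mulD d (val d u) (val d u') < dN d" if "u \<in> words L" "u' \<in> words L" for u u'
    using recognizesD(2)[OF S that] words_append[OF that] N by metis
  have sub: "val d ` variants L R u \<subseteq> val d ` words L" if "u \<in> words L" for u
    using variants_words[OF that] by blast
  have sub': "val d ` variants L R u \<subseteq> {..<dN d}" if "u \<in> words L" for u
    by (intro image_subsetI) (simp add: N variants_words[OF that])
  have fin: "finite (val d ` variants L R u)" if "u \<in> words L" for u
    using finite_subset[OF sub'[OF that]] by simp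
  have enc: "set_encode (val d ` variants L R u) < 2 ^ dN d" if "u \<in> words L" for u
    by (rule set_encode_less) (rule sub'[OF that])
  show ?thesis
  proof (rule recogI[OF recognizes_project[OF S, of R], where g = set_encode])
    show "inj_on set_encode ((\<lambda>u. val d ` variants L R u) ` words L)"
      by (rule inj_on_subset[OF inj_on_set_encode]) (use fin in auto)
    fix a assume a: "a < L"
    then have "[a] \<in> words L" by (simp add: words_def)
    have "variants L R [a] = {[b] |b. b < L \<and> R a b}"
      unfolding variants_def by (auto simp: list_all2_Cons1)
    then have "val d ` variants L R [a] = {letD d b |b. b < L \<and> R a b}"
      by force
    also have "\<dots> = {v. v < dN d \<and> (\<exists>b<L. R a b \<and> letD d b = v)}"
      using N[of "[_]"] by (auto simp: words_def)
    finally show "letD (projd L R d) a = set_encode (val d ` variants L R [a])"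
      using a by (simp add: projd_def Let_def)
  next
    fix x assume "x \<in> (\<lambda>u. val d ` variants L R u) ` words L"
    then show "set_encode x < dN (projd L R d)"
      using enc by (auto simp: projd_def Let_def)
  next
    fix X Y assume "X \<in> (\<lambda>u. val d ` variants L R u) ` words L"
      "Y \<in> (\<lambda>u. val d ` variants L R u) ` words L"
    then have XY: "X \<subseteq> val d ` words L" "Y \<subseteq> val d ` words L" "finite X" "finite Y"
      "set_encode X < 2 ^ dN d" "set_encode Y < 2 ^ dN d"
      using sub fin enc by blast+
    have lt: "x < dN d" if "x \<in> X \<or> x \<in> Y" for x
      using that XY N by blast
    have "{v. v < dN d \<and> (\<exists>x<dN d. \<exists>y<dN d. x \<in> X \<and> y \<in> Y \<and> mulD d x y = v)}
        = {mulD d x y |x y. x \<in> X \<and> y \<in> Y}"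
      using lt mul XY(1,2) by blast
    then show "mulD (projd L R d) (set_encode X) (set_encode Y)
        = set_encode {mulD d x y |x y. x \<in> X \<and> y \<in> Y}"
      using XY by (simp add: projd_def Let_def pair_less)
    show "accD (projd L R d) (set_encode X) (set_encode Y) \<longleftrightarrow>
      (\<exists>x\<in>X. \<exists>y\<in>Y. mulD d y y = y \<and> mulD d x y = x \<and> accD d x y)"
      using XY lt by (simp add: projd_def Let_def pair_less) blast
  qed
qed

lemma computable_negd [computable_intros]:
  assumes "computable D"
  shows "computable (\<lambda>n. negd (D n))"
  unfolding negd_def by (intro computable_intros computable_comp[OF assms])

lemma computable_conjd [computable_intros]:
  assumes K: "computable K" and D: "computable D" and E: "computable E"
  shows "computable (\<lambda>n. conjd (K n) (D n) (E n))"
  unfolding conjd_def Let_def by (intro computable_intros computable_comp[OF K]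
    computable_comp[OF D] computable_comp[OF E])

lemma computable_mapd [computable_intros]:
  assumes K: "computable K" and F: "computable (\<lambda>z. F (pfst z) (psnd z))" and D: "computable D"
  shows "computable (\<lambda>n. mapd (K n) (F n) (D n))"
  unfolding mapd_def by (intro computable_intros computable_comp[OF K] computable_comp[OF D]
    computable2D[OF F[folded computable2_def]])

lemma computable_projd [computable_intros]:
  assumes K: "computable K" and R: "decidable (\<lambda>z. R (pfst z) (pfst (psnd z)) (psnd (psnd z)))" and
    D: "computable D"
  shows "computable (\<lambda>n. projd (K n) (R n) (D n))"
proof -
  have R': "decidable (\<lambda>n. R (A n) (B n) (C n))" if "computable A" "computable B" "computable C" for
    A B C
    using decidable_comp[OF R, of "\<lambda>n. pair (A n) (pair (B n) (C n))"] that by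
      (simp add: computable_intros)
  show ?thesis
    unfolding projd_def Let_def
    by (intro computable_intros R' computable_comp[OF K] computable_comp[OF D])
qed

section \<open>Safety automata\<close>

definition recognizable :: "nat \<Rightarrow> (nat \<Rightarrow> nat) set \<Rightarrow> bool" where
  "recognizable L A \<longleftrightarrow> (\<exists>d. recog L d A)"

lemma recognizable_cong:
  assumes "recognizable L A" and eq: "\<And>w. (\<And>n. w n < L) \<Longrightarrow> w \<in> A \<longleftrightarrow> w \<in> B"
  shows "recognizable L B"
proof -
  obtain d where d: "recog L d A" using assms(1) by (auto simp: recognizable_def)
  then have R: "recognizes L (val d) (mulD d) (accD d) A" by (simp add: recog_def)
  have "recognizes L (val d) (mulD d) (accD d) B"
    by (rule recognizesI) (use recognizesD[OF R] eq in auto)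
  with d show ?thesis unfolding recognizable_def recog_def by blast
qed

lemma recognizable_Compl: "recognizable L A \<Longrightarrow> recognizable L (- A)"
  unfolding recognizable_def using recog_negd by blast

lemma recognizable_Int: "recognizable L A \<Longrightarrow> recognizable L B \<Longrightarrow> recognizable L (A \<inter> B)"
  unfolding recognizable_def using recog_conjd by blast

lemma recognizable_Un: "recognizable L A \<Longrightarrow> recognizable L B \<Longrightarrow> recognizable L (A \<union> B)"
  using recognizable_Compl[OF recognizable_Int[OF recognizable_Compl recognizable_Compl, of L A B]]
  by simp

definition run :: "(nat \<Rightarrow> 'q \<Rightarrow> 'q) \<Rightarrow> 'q \<Rightarrow> (nat \<Rightarrow> nat) \<Rightarrow> nat \<Rightarrow> 'q" where
  "run \<Delta> q w n = rec_nat q (\<lambda>k. \<Delta> (w k)) n"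

lemma run_simps [simp]: "run \<Delta> q w 0 = q" "run \<Delta> q w (Suc n) = \<Delta> (w n) (run \<Delta> q w n)"
  by (simp_all add: run_def)

lemma fold_seg_run: "i \<le> j \<Longrightarrow> fold \<Delta> (seg w i j) (run \<Delta> q w i) = run \<Delta> q w j"
proof (induction j)
  case (Suc j)
  then show ?case by (cases "i = Suc j") (simp_all add: seg_def)
qed (simp add: seg_def)

text \<open>The semigroup consists of the state transformations. After the prefix and one block the
  state is \<open>e (s q)\<close>, and idempotence of \<open>e\<close> freezes it at all later cuts.
  As a failure of \<open>G\<close> is never repaired, \<open>G\<close> at the cuts means
  \<open>G\<close> everywhere.\<close>

lemma recognizable_safety:
  assumes fin: "finite Q" and q: "q \<in> Q" and \<Delta>: "\<And>a x. a < L \<Longrightarrow> x \<in> Q \<Longrightarrow> \<Delta> a x \<in> Q"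
    and sink: "\<And>a x. \<not> G x \<Longrightarrow> \<not> G (\<Delta> a x)"
  shows "recognizable L {w. \<forall>n. G (run \<Delta> q w n)}"
proof -
  let ?v = "\<lambda>u. restrict (fold \<Delta> u) Q"
  let ?m = "\<lambda>x y. restrict (\<lambda>q. y (x q)) Q"
  have fold: "fold \<Delta> u x \<in> Q" if "set u \<subseteq> {..<L}" "x \<in> Q" for u x
    using that by (induction u arbitrary: x) (auto simp: \<Delta>)
  have "recognizes L ?v ?m (\<lambda>s e. G (e (s q))) {w. \<forall>n. G (run \<Delta> q w n)}"
  proof (rule recognizesI)
    have "?v ` words L \<subseteq> Q \<rightarrow>\<^sub>E Q"
      using fold by (auto simp: words_def)
    then show "finite (?v ` words L)"
      by (rule finite_subset) (simp add: finite_PiE fin)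
  next
    fix u u' assume "u \<in> words L" "u' \<in> words L"
    then show "?v (u @ u') = ?m (?v u) (?v u')"
      using fold by (auto simp: words_def fun_eq_iff)
  next
    fix w f s e
    assume w: "\<forall>n. w n < L" and fac: "factors ?v w f s e" and ee: "?m e e = e" and "?m s e = s"
    have f: "strict_mono f" "0 < f 0" "f i \<le> f (Suc i)" for i
      using fac by (auto simp: factors_def strict_mono_less_eq)
    have Q: "run \<Delta> q w n \<in> Q" for n
      by (induction n) (use q w \<Delta> in auto)
    have s: "run \<Delta> q w (f 0) = s q"
      using fac fold_seg_run[of 0 "f 0" \<Delta> w q] q by (auto simp: factors_def)
    have e: "run \<Delta> q w (f (Suc i)) = e (run \<Delta> q w (f i))" for i
    proof -
      have "e = ?v (seg w (f i) (f (Suc i)))" using fac by (simp add: factors_def)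
      then show ?thesis using fold_seg_run[OF f(3)[of i], of \<Delta> w q] Q by simp
    qed
    have const: "run \<Delta> q w (f (Suc i)) = e (s q)" for i
    proof (induction i)
      case 0
      show ?case using e[of 0] s by simp
    next
      case (Suc i)
      have "e (e (s q)) = ?m e e (s q)" using Q[of "f 0"] s by simp
      then show ?case using e[of "Suc i"] Suc ee by simp
    qed
    have down: "G (run \<Delta> q w i)" if "G (run \<Delta> q w j)" "i \<le> j" for i j
      using that(2,1) by (induction rule: dec_induct) (use sink in auto)
    have le: "n \<le> f (Suc n)" for n
      using strict_mono_imp_increasing[OF f(1), of "Suc n"] by simp
    show "w \<in> {w. \<forall>n. G (run \<Delta> q w n)} \<longleftrightarrow> G (e (s q))"
    proof
      assume "w \<in> {w. \<forall>n. G (run \<Delta> q w n)}"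
      then have "G (run \<Delta> q w (f (Suc 0)))" by simp
      then show "G (e (s q))" by (simp only: const)
    next
      assume "G (e (s q))"
      then have "G (run \<Delta> q w (f (Suc n)))" for n by (simp only: const)
      then show "w \<in> {w. \<forall>n. G (run \<Delta> q w n)}" using down[OF _ le] by simp
    qed
  qed
  then show ?thesis
    unfolding recognizable_def by (rule ex_recog)
qed

lemma recognizable_always: "recognizable L {w. \<forall>n. w n \<in> Z}"
proof -
  let ?\<Delta> = "\<lambda>a b. b \<and> a \<in> Z"
  have "recognizable L {w. \<forall>n. run ?\<Delta> True w n}"
    by (rule recognizable_safety[where Q = UNIV]) auto
  moreover have "(\<forall>n. run ?\<Delta> True w n) \<longleftrightarrow> (\<forall>n. w n \<in> Z)" for w
  proof
    assume "\<forall>n. run ?\<Delta> True w n"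
    then have "run ?\<Delta> True w (Suc n)" for n by blast
    then show "\<forall>n. w n \<in> Z" by simp
  next
    assume *: "\<forall>n. w n \<in> Z"
    show "\<forall>n. run ?\<Delta> True w n"
    proof
      show "run ?\<Delta> True w n" for n using * by (induction n) auto
    qed
  qed
  ultimately show ?thesis by simp
qed

text \<open>Two elements suffice, telling whether all letters of a block lie in \<open>Z\<close>;
  the repeated value \<open>e\<close> alone decides whether exceptions recur.\<close>

lemma recognizable_eventually: "recognizable L {w. finite {n. w n \<notin> Z}}"
proof -
  have "recognizes L (\<lambda>u. set u \<subseteq> Z) (\<and>) (\<lambda>s e. e) {w. finite {n. w n \<notin> Z}}"
  proof (rule recognizesI)
    fix w f s e assume fac: "factors (\<lambda>u. set u \<subseteq> Z) w f s e"
    then have f: "strict_mono f" and e: "\<And>i. set (seg w (f i) (f (Suc i))) \<subseteq> Z \<longleftrightarrow> e"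
      by (auto simp: factors_def)
    show "w \<in> {w. finite {n. w n \<notin> Z}} \<longleftrightarrow> e"
    proof
      assume e': e
      have inZ: "w n \<in> Z" if n: "f 0 \<le> n" for n
      proof -
        obtain i where "f i \<le> n" "n < f (Suc i)" using ex_block[OF f n] .
        then show ?thesis using e[of i] e' by (auto simp: seg_def)
      qed
      then have "{n. w n \<notin> Z} \<subseteq> {..<f 0}" by (auto simp: not_le[symmetric] dest: inZ)
      then show "w \<in> {w. finite {n. w n \<notin> Z}}" by (auto intro: finite_subset)
    next
      assume "w \<in> {w. finite {n. w n \<notin> Z}}"
      then obtain N where N: "\<And>n. w n \<notin> Z \<Longrightarrow> n < N"
        using finite_nat_set_iff_bounded by auto
      have "set (seg w (f N) (f (Suc N))) \<subseteq> Z"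
        using N strict_mono_imp_increasing[OF f, of N] by (force simp: seg_def)
      then show e using e by simp
    qed
  qed auto
  then show ?thesis
    unfolding recognizable_def by (rule ex_recog)
qed

lemma recognizable_empty: "recognizable L {}"
  using recognizable_Int[OF recognizable_always recognizable_Compl[OF recognizable_always], of L
    UNIV UNIV]
  by simp

lemma recognizable_UN:
  "finite I \<Longrightarrow> (\<And>i. i \<in> I \<Longrightarrow> recognizable L (A i)) \<Longrightarrow> recognizable L (\<Union>i\<in>I. A i)"
  by (induction rule: finite_induct) (auto intro: recognizable_empty recognizable_Un)

section \<open>The golden ratio\<close>

abbreviation \<phi> :: real where "\<phi> \<equiv> golden_ratio"
abbreviation \<psi> :: real where "\<psi> \<equiv> 1 - golden_ratio"
abbreviation \<gamma> :: real where "\<gamma> \<equiv> golden_ratio - 1"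

lemma golden_bounds: "3/2 < \<phi>" "\<phi> < 5/3"
proof -
  have "2 < sqrt 5" by (rule real_less_rsqrt) simp
  then show "3/2 < \<phi>" by (simp add: golden_ratio_def)
  have "sqrt 5 < 7/3" by (rule real_less_lsqrt) (simp_all add: power2_eq_square)
  then show "\<phi> < 5/3" by (simp add: golden_ratio_def)
qed

lemma golden_sq: "\<phi> * \<phi> = \<phi> + 1"
  by (simp add: golden_ratio_def field_simps)

lemma golden_inverse: "\<phi> * \<gamma> = 1"
  using golden_sq by (simp add: algebra_simps)

text \<open>Infinite descent for the norm form of the ring generated by \<phi>: the equation forces
  \<open>u\<close> and \<open>v\<close> to be even, and halving both gives a smaller
  solution.\<close>

lemma golden_norm_zero:
  fixes u v :: int
  assumes "u * u + u * v = v * v"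
  shows "u = 0 \<and> v = 0"
  using assms
proof (induction "nat (\<bar>u\<bar> + \<bar>v\<bar>)" arbitrary: u v rule: less_induct)
  case less
  have "even (u * u + u * v + v * v)" using less.prems by simp
  then have "even u" "even v" by (auto simp: even_add even_mult_iff)
  then obtain a b where ab: "u = 2 * a" "v = 2 * b" by (auto elim!: evenE)
  show ?case
  proof (rule ccontr)
    assume *: "\<not> (u = 0 \<and> v = 0)"
    have "a * a + a * b = b * b" using less.prems ab by simp
    then have "a = 0 \<and> b = 0"
      by (intro less.hyps) (use ab * in auto)
    then show False using * ab by simp
  qed
qed

lemma golden_irrational:
  fixes u v :: int
  assumes "of_int u + of_int v * \<phi> = 0"
  shows "u = 0 \<and> v = 0"
proof -
  have "(of_int u + of_int v * \<phi>) * (of_int u + of_int v * \<psi>)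
      = of_int u * of_int u + of_int u * of_int v - of_int v * of_int v * (\<phi> * \<phi> - \<phi>)"
    by (simp add: algebra_simps)
  then have "real_of_int (u * u + u * v) = of_int (v * v)"
    using assms golden_sq by simp
  then show ?thesis
    by (intro golden_norm_zero) (simp only: of_int_eq_iff)
qed

lemma golden_fib: "\<phi> * real (fib n) = real (fib (Suc n)) - \<psi> ^ n"
proof (induction n rule: fib.induct)
  case (3 n)
  have "\<phi> * real (fib (Suc (Suc n))) = real (fib (Suc (Suc (Suc n)))) - (\<psi> ^ Suc n + \<psi> ^ n)"
    using 3 by (simp add: algebra_simps)
  also have "\<psi> ^ Suc n + \<psi> ^ n = \<psi> ^ n * (\<psi> + 1)" by (simp add: algebra_simps)
  also have "\<psi> + 1 = \<psi> * \<psi>" using golden_sq by (simp add: algebra_simps)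
  also have "\<psi> ^ n * (\<psi> * \<psi>) = \<psi> ^ Suc (Suc n)" by simp
  finally show ?case .
qed simp_all

lemma less_fib: "n < fib (n + 2)"
proof (induction n)
  case (Suc n)
  have "fib (Suc n + 2) = fib (n + 2) + fib (n + 1)" by (simp add: numeral_eq_Suc)
  then show ?case using Suc fib_neq_0_nat[of "n + 1"] by simp
qed simp

lemma psi_power: "\<psi> ^ n = (if even n then 1 else -1) * \<gamma> ^ n"
proof -
  have "\<psi> = (-1) * \<gamma>" by simp
  then have "\<psi> ^ n = (-1) ^ n * \<gamma> ^ n" by (metis power_mult_distrib)
  then show ?thesis by (auto simp: minus_one_power_iff)
qed

lemma gamma_sums: "(\<lambda>n. \<gamma> ^ n) sums (\<phi> + 1)"
proof -
  have "(\<lambda>n. \<gamma> ^ n) sums (1 / (1 - \<gamma>))"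
    by (rule geometric_sums) (use golden_bounds in simp)
  moreover have "(\<phi> + 1) * (1 - \<gamma>) = 1"
    using golden_sq by (simp add: algebra_simps)
  then have "1 / (1 - \<gamma>) = \<phi> + 1"
    by (metis mult_zero_right nonzero_divide_eq_eq zero_neq_one)
  ultimately show ?thesis by simp
qed

lemma bounded_sums:
  assumes "\<And>n. \<bar>c n\<bar> \<le> D"
  shows "summable (\<lambda>n. c n * \<gamma> ^ n)" "\<bar>\<Sum>n. c n * \<gamma> ^ n\<bar> \<le> D * (\<phi> + 1)"
proof -
  have S: "(\<lambda>n. D * \<gamma> ^ n) sums (D * (\<phi> + 1))"
    by (rule sums_mult[OF gamma_sums])
  have le: "norm (c n * \<gamma> ^ n) \<le> D * \<gamma> ^ n" for n
    using assms golden_bounds by (simp add: abs_mult mult_right_mono)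
  show "summable (\<lambda>n. c n * \<gamma> ^ n)"
    by (rule summable_comparison_test'[OF sums_summable[OF S]]) (rule le)
  have "norm (\<Sum>n. c n * \<gamma> ^ n) \<le> (\<Sum>n. D * \<gamma> ^ n)"
    by (rule norm_suminf_le[OF le sums_summable[OF S]])
  then show "\<bar>\<Sum>n. c n * \<gamma> ^ n\<bar> \<le> D * (\<phi> + 1)"
    using sums_unique[OF S] by simp
qed

section \<open>Linear equations between expansions\<close>

text \<open>A pair \<open>(u, v)\<close> stands for the element \<open>u + v \<phi>\<close> of the ring of integers; \<open>cjg\<close> is its
  Galois conjugate.\<close>

definition emb :: "int \<times> int \<Rightarrow> real" where "emb s = of_int (fst s) + of_int (snd s) * \<phi>"
definition cjg :: "int \<times> int \<Rightarrow> real" where "cjg s = of_int (fst s) + of_int (snd s) * \<psi>"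
text \<open>One step of long division in base \<phi>: remove the digit \<open>c\<close> from the
  remainder \<open>s\<close> and multiply by \<phi>, using
  \<open>\<phi> (x + y \<phi>) = y + (x + y) \<phi>\<close>.\<close>

definition shift :: "int \<times> int \<Rightarrow> int \<times> int \<Rightarrow> int \<times> int" where
  "shift s c = (snd s - snd c, (fst s - fst c) + (snd s - snd c))"

lemma emb_shift: "emb (shift s c) = \<phi> * (emb s - emb c)"
proof -
  define x y where "x = real_of_int (fst s - fst c)" and "y = real_of_int (snd s - snd c)"
  have "emb (shift s c) = y + (x + y) * \<phi>" by (simp add: emb_def shift_def x_def y_def)
  also have "\<dots> = x * \<phi> + y * (\<phi> * \<phi>)" by (simp add: golden_sq algebra_simps)
  also have "\<dots> = \<phi> * (x + y * \<phi>)" by (simp add: algebra_simps)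
  also have "x + y * \<phi> = emb s - emb c" by (simp add: emb_def x_def y_def algebra_simps)
  finally show ?thesis .
qed

lemma cjg_shift: "cjg (shift s c) = \<psi> * (cjg s - cjg c)"
proof -
  define x y where "x = real_of_int (fst s - fst c)" and "y = real_of_int (snd s - snd c)"
  have psi: "\<psi> * \<psi> = \<psi> + 1" using golden_sq by (simp add: algebra_simps)
  have "cjg (shift s c) = y + (x + y) * \<psi>" by (simp add: cjg_def shift_def x_def y_def)
  also have "\<dots> = x * \<psi> + y * (\<psi> + 1)" by (simp add: algebra_simps)
  also have "\<dots> = \<psi> * (x + y * \<psi>)" unfolding psi[symmetric] by (simp add: algebra_simps)
  also have "x + y * \<psi> = cjg s - cjg c" by (simp add: cjg_def x_def y_def algebra_simps)
  finally show ?thesis .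
qed

text \<open>The pair \<open>(emb s, cjg s)\<close> embeds the ring as a lattice in the plane, which
  meets a bounded region in finitely many points. Explicitly, \<open>emb s - cjg s\<close> is
  \<open>snd s\<close> times \<open>2 \<phi> - 1\<close>.\<close>

lemma finite_states: "finite {s. \<bar>emb s\<bar> \<le> C \<and> \<bar>cjg s\<bar> \<le> C'}"
proof -
  have "\<bar>snd s\<bar> \<le> \<lceil>C + C'\<rceil> \<and> \<bar>fst s\<bar> \<le> \<lceil>C + 2 * (C + C')\<rceil>"
    if s: "\<bar>emb s\<bar> \<le> C" "\<bar>cjg s\<bar> \<le> C'" for s
  proof -
    have "of_int (snd s) * (2 * \<phi> - 1) = emb s - cjg s"
      by (simp add: emb_def cjg_def algebra_simps)
    then have "\<bar>of_int (snd s)\<bar> * \<bar>2 * \<phi> - 1\<bar> = \<bar>emb s - cjg s\<bar>"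
      by (metis abs_mult)
    also have "\<dots> \<le> C + C'" using s by linarith
    also have "\<bar>2 * \<phi> - 1\<bar> = 2 * \<phi> - 1" using golden_bounds by simp
    finally have "\<bar>of_int (snd s)\<bar> * (2 * \<phi> - 1) \<le> C + C'" .
    moreover have "\<bar>real_of_int (snd s)\<bar> * 1 \<le> \<bar>of_int (snd s)\<bar> * (2 * \<phi> - 1)"
      using golden_bounds by (intro mult_left_mono) auto
    ultimately have 1: "\<bar>real_of_int (snd s)\<bar> \<le> C + C'" by simp
    have "real_of_int (fst s) = emb s - of_int (snd s) * \<phi>" by (simp add: emb_def)
    then have "\<bar>real_of_int (fst s)\<bar> \<le> C + \<bar>of_int (snd s)\<bar> * \<phi>"
      using s golden_bounds abs_triangle_ineq4[of "emb s" "of_int (snd s) * \<phi>"] by (simp add: abs_mult)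
    also have "\<dots> \<le> C + (C + C') * 2"
      using 1 golden_bounds by (intro add_left_mono mult_mono) auto
    finally show ?thesis using 1 by (auto simp: le_ceiling_iff)
  qed
  then have "{s. \<bar>emb s\<bar> \<le> C \<and> \<bar>cjg s\<bar> \<le> C'} \<subseteq>
      {- \<lceil>C + 2 * (C + C')\<rceil>..\<lceil>C + 2 * (C + C')\<rceil>} \<times> {- \<lceil>C + C'\<rceil>..\<lceil>C + C'\<rceil>}"
    by (force simp: abs_le_iff)
  then show ?thesis by (rule finite_subset) simp
qed

text \<open>The remainders of the expansion form the orbit of \<open>\<tau>\<close> under an expanding map whose conjugate
  contracts, so the equation holds iff this orbit stays in a finite set of algebraic integers.\<close>

lemma recognizable_expansion:
  fixes \<delta> :: "bool \<Rightarrow> nat \<Rightarrow> int \<times> int"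
  shows "recognizable L {w. (\<lambda>n. emb (\<delta> (even n) (w n)) * \<gamma> ^ n) sums emb \<tau>}"
proof -
  let ?c = "\<lambda>w n. \<delta> (even n) (w n)"
  let ?B = "(\<lambda>(p, a). \<bar>emb (\<delta> p a)\<bar> + \<bar>cjg (\<delta> p a)\<bar>) ` (UNIV \<times> {..<L})"
  define D where "D = Max ?B"
  have D: "\<bar>emb (\<delta> p a)\<bar> \<le> D" "\<bar>cjg (\<delta> p a)\<bar> \<le> D" if "a < L" for p a
  proof -
    have "\<bar>emb (\<delta> p a)\<bar> + \<bar>cjg (\<delta> p a)\<bar> \<le> D"
      unfolding D_def by (rule Max_ge) (use that in auto)
    then show "\<bar>emb (\<delta> p a)\<bar> \<le> D" "\<bar>cjg (\<delta> p a)\<bar> \<le> D" by linarith+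
  qed
  \<comment> \<open>\<open>C\<close> bounds all tails of the expansion, as the powers of \<gamma>
    sum to \<open>\<phi> + 1\<close>. The absolute value covers the empty alphabet, where the
    maximum \<open>D\<close> is unspecified.\<close>
  define C where "C = \<bar>D\<bar> * (\<phi> + 1)"
  \<comment> \<open>The conjugate map preserves the bound \<open>C'\<close>: it adds at most
    \<open>D\<close> and then multiplies by \<psi>, whose absolute value is
    \<open>\<gamma> < 1\<close>.\<close>
  define C' where "C' = \<bar>cjg \<tau>\<bar> + \<bar>D\<bar> * (\<phi> + 1)"
  let ?S = "{s. \<bar>emb s\<bar> \<le> C \<and> \<bar>cjg s\<bar> \<le> C'}"
  \<comment> \<open>A state holds the parity of the position, on which the digit depends, and the
    remainder; \<open>None\<close> is the sink entered when the remainder leaves the finite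
    set.\<close>
  define \<Delta> where "\<Delta> a q = (\<not> fst q, case snd q of None \<Rightarrow> None
      | Some s \<Rightarrow> let s' = shift s (\<delta> (fst q) a) in if s' \<in> ?S then Some s' else None)"
    for a and q :: "bool \<times> (int \<times> int) option"
  define q0 where "q0 = (True, if \<tau> \<in> ?S then Some \<tau> else None)"
  define st where "st w n = rec_nat \<tau> (\<lambda>k s. shift s (\<delta> (even k) (w k))) n" for w n
  have st: "st w 0 = \<tau>" "st w (Suc n) = shift (st w n) (\<delta> (even n) (w n))" for w n
    by (simp_all add: st_def)
  have "recognizable L {w. \<forall>n. snd (run \<Delta> q0 w n) \<noteq> None}"
  proof (rule recognizable_safety)
    show "finite ((UNIV :: bool set) \<times> insert None (Some ` ?S))"
      by (intro finite_cartesian_product finite.insertI finite_imageI finite_states) simp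
    show "q0 \<in> (UNIV :: bool set) \<times> insert None (Some ` ?S)" by (simp add: q0_def)
    show "\<Delta> a x \<in> (UNIV :: bool set) \<times> insert None (Some ` ?S)" for a x
      by (auto simp: \<Delta>_def Let_def split: option.split)
    show "\<not> snd (\<Delta> a x) \<noteq> None" if "\<not> snd x \<noteq> None" for a x
      using that by (auto simp: \<Delta>_def split: option.splits)
  qed
  moreover have "(\<forall>n. snd (run \<Delta> q0 w n) \<noteq> None) \<longleftrightarrow> (\<lambda>n. emb (?c w n) * \<gamma> ^ n) sums emb \<tau>"
    if w: "\<And>n. w n < L" for w
  proof -
    have run: "run \<Delta> q0 w n = (even n, if \<forall>k\<le>n. st w k \<in> ?S then Some (st w n) else None)" for n
      by (induction n) (auto simp: q0_def st \<Delta>_def Let_def le_Suc_eq)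
    have cjg: "\<bar>cjg (st w n)\<bar> \<le> C'" for n
    proof (induction n)
      case 0
      show ?case using golden_bounds by (simp add: st C'_def)
    next
      case (Suc n)
      have "\<bar>cjg (st w (Suc n))\<bar> = \<gamma> * \<bar>cjg (st w n) - cjg (?c w n)\<bar>"
        using golden_bounds by (simp add: st cjg_shift abs_mult)
      also have "\<dots> \<le> \<gamma> * (C' + \<bar>D\<bar>)"
        using Suc D(2)[OF w, of "even n" n] golden_bounds by (intro mult_left_mono) linarith+
      also have "\<dots> = \<gamma> * \<bar>cjg \<tau>\<bar> + \<bar>D\<bar> * (\<gamma> * (\<phi> + 1) + \<gamma>)"
        by (simp add: C'_def algebra_simps)
      also have "\<gamma> * (\<phi> + 1) + \<gamma> = 2 * \<phi> - 1"
        using golden_sq by (simp add: algebra_simps)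
      also have "\<gamma> * \<bar>cjg \<tau>\<bar> + \<bar>D\<bar> * (2 * \<phi> - 1) \<le> 1 * \<bar>cjg \<tau>\<bar> + \<bar>D\<bar> * (\<phi> + 1)"
        using golden_bounds by (intro add_mono mult_mono) auto
      finally show ?case by (simp add: C'_def)
    qed
    have sum: "(\<Sum>i<n. emb (?c w i) * \<gamma> ^ i) = emb \<tau> - emb (st w n) * \<gamma> ^ n" for n
    proof (induction n)
      case (Suc n)
      have "emb (st w (Suc n)) * \<gamma> ^ Suc n = (\<phi> * \<gamma>) * ((emb (st w n) - emb (?c w n)) * \<gamma> ^ n)"
        by (simp add: st emb_shift)
      also have "\<dots> = emb (st w n) * \<gamma> ^ n - emb (?c w n) * \<gamma> ^ n"
        by (simp only: golden_inverse mult_1 left_diff_distrib)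
      finally show ?case
        by (simp only: sum.lessThan_Suc Suc.IH)
    qed (simp add: st)
    have "(\<forall>n. snd (run \<Delta> q0 w n) \<noteq> None) \<longleftrightarrow> (\<forall>n. \<bar>emb (st w n)\<bar> \<le> C)"
      unfolding run using cjg by auto
    also have "\<dots> \<longleftrightarrow> (\<lambda>n. emb (?c w n) * \<gamma> ^ n) sums emb \<tau>"
    proof
      assume *: "\<forall>n. \<bar>emb (st w n)\<bar> \<le> C"
      have "(\<lambda>n. \<gamma> ^ n) \<longlonglongrightarrow> 0"
        by (rule LIMSEQ_power_zero) (use golden_bounds in simp)
      moreover have "norm (emb (st w n) * \<gamma> ^ n) \<le> norm (\<gamma> ^ n) * C" for n
        using *[rule_format, of n] golden_bounds
        by (simp add: abs_mult mult.commute mult_left_mono)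
      ultimately have "(\<lambda>n. emb (st w n) * \<gamma> ^ n) \<longlonglongrightarrow> 0"
        by (rule tendsto_0_le[OF _ always_eventually, rule_format])
      then show "(\<lambda>n. emb (?c w n) * \<gamma> ^ n) sums emb \<tau>"
        unfolding sums_def sum using tendsto_diff[OF tendsto_const, of _ 0 sequentially "emb \<tau>"] by simp
    next
      assume S: "(\<lambda>n. emb (?c w n) * \<gamma> ^ n) sums emb \<tau>"
      show "\<forall>n. \<bar>emb (st w n)\<bar> \<le> C"
      proof
        fix n
        have "(\<lambda>i. emb (?c w (i + n)) * \<gamma> ^ (i + n)) sums (emb (st w n) * \<gamma> ^ n)"
          using sums_split_initial_segment[OF S, of n] sum[of n] by simp
        then have "(\<lambda>i. \<gamma> ^ n * (emb (?c w (i + n)) * \<gamma> ^ i)) sums (\<gamma> ^ n * emb (st w n))"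
          by (simp add: power_add mult_ac)
        then have "(\<lambda>i. emb (?c w (i + n)) * \<gamma> ^ i) sums emb (st w n)"
          using golden_bounds by (subst (asm) sums_mult_iff) auto
        moreover have "\<bar>emb (?c w (i + n))\<bar> \<le> \<bar>D\<bar>" for i
          using D(1)[OF w, of "even (i + n)" "i + n"] by linarith
        ultimately show "\<bar>emb (st w n)\<bar> \<le> C"
          using bounded_sums(2)[of "\<lambda>i. emb (?c w (i + n))" "\<bar>D\<bar>"] by (simp add: C_def sums_iff)
      qed
    qed
    finally show ?thesis .
  qed
  ultimately show ?thesis
    by (elim recognizable_cong) simp
qed

lemma sums_iff_eq: "f sums x \<Longrightarrow> f sums y \<longleftrightarrow> x = y" for x :: real
  using sums_unique2 by auto

section \<open>Encoding real numbers by three tracks\<close>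

definition bits :: "nat \<Rightarrow> (nat \<Rightarrow> nat) \<Rightarrow> nat set" where
  "bits j w = {n. j \<in> set_decode (w n)}"

text \<open>A real number is written as an integer in (redundant, signed) Fibonacci numeration plus a
  bounded expansion in powers of \<open>1/\<phi>\<close>; note that \<open>\<gamma> = 1/\<phi>\<close>.\<close>

definition rep :: "nat set \<Rightarrow> nat set \<Rightarrow> nat set \<Rightarrow> real" where
  "rep A A' B = real (\<Sum>i\<in>A. fib i) - real (\<Sum>i\<in>A'. fib i) + (\<Sum>n. of_bool (n \<in> B) * \<gamma> ^ n)"

text \<open>Variable \<open>i\<close> owns three binary tracks of the letters: \<open>3 * i\<close>
  and \<open>3 * i + 1\<close> for positive and negative Fibonacci digits, \<open>3 * i + 2\<close>
  for the fractional digits.\<close>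

definition tval :: "nat \<Rightarrow> (nat \<Rightarrow> nat) \<Rightarrow> real" where
  "tval i w = rep (bits (3 * i) w) (bits (3 * i + 1) w) (bits (3 * i + 2) w)"

definition proper :: "nat \<Rightarrow> (nat \<Rightarrow> nat) \<Rightarrow> bool" where
  "proper i w \<longleftrightarrow> finite (bits (3 * i) w) \<and> finite (bits (3 * i + 1) w)"

definition bit :: "nat \<Rightarrow> nat \<Rightarrow> int" where "bit j a = of_bool (j \<in> set_decode a)"
definition zdig :: "nat \<Rightarrow> nat \<Rightarrow> int" where "zdig i a = bit (3 * i) a - bit (3 * i + 1) a"
definition rdig :: "nat \<Rightarrow> nat \<Rightarrow> int" where "rdig i a = bit (3 * i + 2) a"

definition ipart :: "nat \<Rightarrow> (nat \<Rightarrow> nat) \<Rightarrow> int" where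
  "ipart i w = int (\<Sum>n\<in>bits (3 * i) w. fib n) - int (\<Sum>n\<in>bits (3 * i + 1) w. fib n)"
text \<open>The companion integer, with all Fibonacci indices raised by one. On proper words it
  differs from \<open>\<phi> * ipart\<close> by a bounded error.\<close>

definition ipart' :: "nat \<Rightarrow> (nat \<Rightarrow> nat) \<Rightarrow> int" where
  "ipart' i w = int (\<Sum>n\<in>bits (3 * i) w. fib (Suc n)) - int (\<Sum>n\<in>bits (3 * i + 1) w. fib (Suc n))"
definition rpart :: "nat \<Rightarrow> (nat \<Rightarrow> nat) \<Rightarrow> real" where
  "rpart i w = (\<Sum>n. of_int (rdig i (w n)) * \<gamma> ^ n)"

lemma tval_eq: "tval i w = of_int (ipart i w) + rpart i w"
  by (simp add: tval_def rep_def ipart_def rpart_def rdig_def bit_def bits_def)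

lemma rpart_sums: "(\<lambda>n. of_int (rdig i (w n)) * \<gamma> ^ n) sums rpart i w"
  unfolding rpart_def
  by (intro summable_sums bounded_sums(1)[of _ 1]) (simp add: rdig_def bit_def)

lemma rpart_bound: "\<bar>rpart i w\<bar> \<le> 3"
proof -
  have "\<bar>rpart i w\<bar> \<le> 1 * (\<phi> + 1)"
    unfolding rpart_def by (intro bounded_sums(2)) (simp add: rdig_def bit_def)
  then show ?thesis using golden_bounds by simp
qed

definition sgn_pow :: "bool \<Rightarrow> int" where "sgn_pow p = (if p then 1 else - 1)"

text \<open>A digit at \<open>n\<close> contributes
  \<open>fib (Suc n) - fib n * \<phi> = \<psi> ^ n\<close>. The alternating sign of
  \<open>\<psi> ^ n\<close> is moved into the digit, which leaves a series in powers of \<gamma> and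
  makes digits depend on parity.\<close>

lemma zdig_sums:
  assumes "proper i w"
  shows "(\<lambda>n. of_int (sgn_pow (even n) * zdig i (w n)) * \<gamma> ^ n) sums
    (of_int (ipart' i w) - of_int (ipart i w) * \<phi>)"
proof -
  have *: "(\<lambda>n. of_bool (n \<in> A) * \<psi> ^ n) sums (real (\<Sum>n\<in>A. fib (Suc n)) - real (\<Sum>n\<in>A. fib n) * \<phi>)"
    if "finite A" for A
  proof -
    have "(\<lambda>n. if n \<in> A then \<psi> ^ n else 0) sums (\<Sum>n\<in>A. \<psi> ^ n)"
      by (rule sums_If_finite_set[OF that])
    moreover have "(\<lambda>n. if n \<in> A then \<psi> ^ n else 0) = (\<lambda>n. of_bool (n \<in> A) * \<psi> ^ n)" by auto
    moreover have "\<psi> ^ n = real (fib (Suc n)) - real (fib n) * \<phi>" for n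
      using golden_fib[of n] by (simp add: mult.commute)
    ultimately show ?thesis by (simp add: sum_subtractf sum_distrib_right)
  qed
  have "(\<lambda>n. of_bool (n \<in> bits (3 * i) w) * \<psi> ^ n - of_bool (n \<in> bits (3 * i + 1) w) * \<psi> ^ n) sums
     (of_int (ipart' i w) - of_int (ipart i w) * \<phi>)"
    using sums_diff[OF *[of "bits (3 * i) w"] *[of "bits (3 * i + 1) w"]] assms
    by (simp add: proper_def ipart_def ipart'_def algebra_simps)
  moreover have "of_bool (n \<in> bits (3 * i) w) * \<psi> ^ n - of_bool (n \<in> bits (3 * i + 1) w) * \<psi> ^ n
      = of_int (sgn_pow (even n) * zdig i (w n)) * \<gamma> ^ n" for n
    unfolding psi_power by (auto simp: zdig_def bit_def bits_def sgn_pow_def)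
  ultimately show ?thesis by simp
qed

lemma zdig_bound:
  assumes "proper i w"
  shows "\<bar>of_int (ipart' i w) - of_int (ipart i w) * \<phi>\<bar> \<le> 3"
proof -
  have "\<bar>\<Sum>n. of_int (sgn_pow (even n) * zdig i (w n)) * \<gamma> ^ n\<bar> \<le> 1 * (\<phi> + 1)"
    by (rule bounded_sums(2)) (auto simp: sgn_pow_def zdig_def bit_def)
  then show ?thesis using golden_bounds sums_unique[OF zdig_sums[OF assms]] by simp
qed

text \<open>The conjunction of the two expansions below says that \<open>j\<close> and \<open>y\<close> are the same integer.
  As \<open>y\<close> and \<open>k - j \<phi>\<close> are bounded, only finitely many values of \<open>j\<close> and \<open>k\<close> matter.\<close>

lemma recognizable_integer_equation:
  assumes "\<And>w. w \<in> V \<Longrightarrow> (\<lambda>n. emb (\<delta> (even n) (w n)) * \<gamma> ^ n) sums (of_int (k w) - of_int (j w) * \<phi>)"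
    and "\<And>w. w \<in> V \<Longrightarrow> (\<lambda>n. emb (\<delta>' (even n) (w n)) * \<gamma> ^ n) sums y w"
    and bounds: "\<And>w. w \<in> V \<Longrightarrow> \<bar>of_int (k w) - of_int (j w) * \<phi>\<bar> \<le> 10"
      "\<And>w. w \<in> V \<Longrightarrow> \<bar>y w\<bar> \<le> 12"
  shows "\<exists>S. recognizable L S \<and> (\<forall>w\<in>V. w \<in> S \<longleftrightarrow> y w = of_int (j w))"
proof -
  let ?E = "\<lambda>\<delta> \<tau>. {w. (\<lambda>n. emb (\<delta> (even n) (w n)) * \<gamma> ^ n) sums emb \<tau>}"
  \<comment> \<open>If \<open>y w\<close> equals \<open>j w\<close>, then \<open>j w\<close> is at
    most 12 in absolute value, so \<open>k w\<close> is at most \<open>10 + 12 * (5/3) = 30\<close>;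
    the range up to 40 is roomy.\<close>
  define S where "S = (\<Union>(a, b)\<in>{-40..40} \<times> {-40..40}. ?E \<delta> (b, - a) \<inter> ?E \<delta>' (a, 0))"
  have "recognizable L S"
    unfolding S_def
    by (intro recognizable_UN) (auto intro!: recognizable_Int recognizable_expansion)
  moreover have "w \<in> S \<longleftrightarrow> y w = of_int (j w)" if w: "w \<in> V" for w
  proof
    have E: "w \<in> ?E \<delta> (b, - a) \<longleftrightarrow> b = k w \<and> a = j w" "w \<in> ?E \<delta>' (a, 0) \<longleftrightarrow> y w = of_int a" for a b
    proof -
      have "w \<in> ?E \<delta> (b, - a) \<longleftrightarrow> of_int (k w) - of_int (j w) * \<phi> = emb (b, - a)"
        by (simp add: sums_iff_eq[OF assms(1)[OF w]])
      also have "\<dots> \<longleftrightarrow> of_int (k w - b) + of_int (a - j w) * \<phi> = 0"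
        by (auto simp: emb_def algebra_simps)
      also have "\<dots> \<longleftrightarrow> b = k w \<and> a = j w"
        using golden_irrational[of "k w - b" "a - j w"] by auto
      finally show "w \<in> ?E \<delta> (b, - a) \<longleftrightarrow> b = k w \<and> a = j w" .
      show "w \<in> ?E \<delta>' (a, 0) \<longleftrightarrow> y w = of_int a"
        using sums_iff_eq[OF assms(2)[OF w], of "of_int a"] emb_def[of "(a, 0)"] by simp
    qed
    show "w \<in> S \<Longrightarrow> y w = of_int (j w)"
      using E unfolding S_def by auto
    assume y: "y w = of_int (j w)"
    have j: "\<bar>real_of_int (j w)\<bar> \<le> 12" using bounds(2)[OF w] y by simp
    have "\<bar>of_int (k w)\<bar> \<le> 10 + \<bar>of_int (j w)\<bar> * \<phi>"
      using bounds(1)[OF w] golden_bounds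
        abs_triangle_ineq[of "of_int (k w) - of_int (j w) * \<phi>" "of_int (j w) * \<phi>"]
      by (simp add: abs_mult)
    also have "\<dots> \<le> 10 + 12 * (5/3)"
      using j golden_bounds by (intro add_left_mono mult_mono) auto
    finally have "\<bar>real_of_int (k w)\<bar> \<le> 30" by simp
    then have "(j w, k w) \<in> {-40..40} \<times> {-40..40}" using j by auto
    then show "w \<in> S" unfolding S_def using E y by blast
  qed
  ultimately show ?thesis by blast
qed

section \<open>Recognising addition, multiplication by \<phi> and integrality\<close>

text \<open>With fractional parts on one side and integer parts on the other, the equation says that
  a bounded real equals the integer \<open>?j\<close>, the carry, whose companion is
  \<open>?k\<close>. Three errors of at most 3 stay within the bounds 10 and 12.\<close>

lemma recognizable_add:
  "\<exists>S. recognizable L S \<and> (\<forall>w. proper 0 w \<and> proper 1 w \<and> proper 2 w \<longrightarrow>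
     (w \<in> S \<longleftrightarrow> tval 0 w + tval 1 w = tval 2 w))"
proof -
  let ?V = "{w. proper 0 w \<and> proper 1 w \<and> proper 2 w}"
  let ?k = "\<lambda>w. ipart' 0 w + ipart' 1 w - ipart' 2 w" and ?j = "\<lambda>w. ipart 0 w + ipart 1 w - ipart 2 w"
  let ?y = "\<lambda>w. rpart 2 w - rpart 0 w - rpart 1 w"
  have "\<exists>S. recognizable L S \<and> (\<forall>w\<in>?V. w \<in> S \<longleftrightarrow> ?y w = of_int (?j w))"
  proof (rule recognizable_integer_equation[where k = ?k and
        \<delta> = "\<lambda>p a. (sgn_pow p * (zdig 0 a + zdig 1 a - zdig 2 a), 0)" and
        \<delta>' = "\<lambda>p a. (rdig 2 a - rdig 0 a - rdig 1 a, 0)"])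
    fix w assume w: "w \<in> ?V"
    show "(\<lambda>n. emb (sgn_pow (even n) * (zdig 0 (w n) + zdig 1 (w n) - zdig 2 (w n)), 0) * \<gamma> ^ n) sums
        (of_int (?k w) - of_int (?j w) * \<phi>)"
      using sums_diff[OF sums_add[OF zdig_sums[of 0 w] zdig_sums[of 1 w]] zdig_sums[of 2 w]] w
      by (simp add: emb_def algebra_simps)
    show "(\<lambda>n. emb (rdig 2 (w n) - rdig 0 (w n) - rdig 1 (w n), 0) * \<gamma> ^ n) sums ?y w"
      using sums_diff[OF sums_diff[OF rpart_sums[of 2 w] rpart_sums[of 0 w]] rpart_sums[of 1 w]]
      by (simp add: emb_def algebra_simps)
    have "of_int (?k w) - of_int (?j w) * \<phi> = (of_int (ipart' 0 w) - of_int (ipart 0 w) * \<phi>)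
        + (of_int (ipart' 1 w) - of_int (ipart 1 w) * \<phi>) -
          (of_int (ipart' 2 w) - of_int (ipart 2 w) * \<phi>)"
      by (simp add: algebra_simps)
    then show "\<bar>of_int (?k w) - of_int (?j w) * \<phi>\<bar> \<le> 10"
      using zdig_bound[of 0 w] zdig_bound[of 1 w] zdig_bound[of 2 w] w by auto
    show "\<bar>?y w\<bar> \<le> 12"
      using rpart_bound[of 0 w] rpart_bound[of 1 w] rpart_bound[of 2 w] by linarith
  qed
  moreover have "?y w = of_int (?j w) \<longleftrightarrow> tval 0 w + tval 1 w = tval 2 w" for w
    by (auto simp: tval_eq)
  ultimately show ?thesis by simp
qed

text \<open>By \<open>golden_fib\<close>, multiplying the integer part \<open>n\<close> by \<open>\<phi>\<close> gives the integer with shifted digits,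
  up to the bounded error \<open>n' - n \<phi>\<close>, where \<open>n'\<close> is \<open>ipart'\<close>.\<close>

lemma recognizable_scale:
  "\<exists>S. recognizable L S \<and> (\<forall>w. proper 0 w \<and> proper 1 w \<longrightarrow> (w \<in> S \<longleftrightarrow> tval 1 w = \<phi> * tval 0 w))"
proof -
  let ?V = "{w. proper 0 w \<and> proper 1 w}"
  let ?e = "\<lambda>w. of_int (ipart' 0 w) - of_int (ipart 0 w) * \<phi>"
  \<comment> \<open>\<open>ipart' 0\<close> plays the integer part of the product. Raising its
    indices once more gives \<open>ipart' 0 + ipart 0\<close>, by the Fibonacci recurrence; this is
    the companion subtracted in \<open>?k\<close>.\<close>
  let ?k = "\<lambda>w. ipart' 1 w - ipart' 0 w - ipart 0 w" and ?j = "\<lambda>w. ipart 1 w - ipart' 0 w"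
  let ?y = "\<lambda>w. \<phi> * rpart 0 w - rpart 1 w - ?e w"
  have k: "of_int (?k w) - of_int (?j w) * \<phi> = (of_int (ipart' 1 w) - of_int (ipart 1 w) * \<phi>) - \<psi> *
    ?e w" for w
  proof -
    have "\<psi> * ?e w = of_int (ipart' 0 w) - of_int (ipart 0 w) * \<phi> - of_int (ipart' 0 w) * \<phi>
        + of_int (ipart 0 w) * (\<phi> * \<phi>)"
      by (simp add: algebra_simps)
    then show ?thesis by (simp add: golden_sq algebra_simps)
  qed
  have "\<exists>S. recognizable L S \<and> (\<forall>w\<in>?V. w \<in> S \<longleftrightarrow> ?y w = of_int (?j w))"
  proof (rule recognizable_integer_equation[where k = ?k and
        \<delta> = "\<lambda>p a. (sgn_pow p * (zdig 1 a - zdig 0 a), sgn_pow p * zdig 0 a)" and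
        \<delta>' = "\<lambda>p a. (- rdig 1 a - sgn_pow p * zdig 0 a, rdig 0 a)"])
    fix w assume w: "w \<in> ?V"
    show "(\<lambda>n. emb (sgn_pow (even n) * (zdig 1 (w n) - zdig 0 (w n)), sgn_pow (even n) * zdig 0
      (w n)) * \<gamma> ^ n)
        sums (of_int (?k w) - of_int (?j w) * \<phi>)"
      unfolding k
      using sums_diff[OF zdig_sums[of 1 w] sums_mult[OF zdig_sums[of 0 w], of \<psi>]] w
      by (simp add: emb_def algebra_simps)
    show "(\<lambda>n. emb (- rdig 1 (w n) - sgn_pow (even n) * zdig 0 (w n), rdig 0 (w n)) * \<gamma> ^ n) sums ?y w"
      using sums_diff[OF sums_diff[OF sums_mult[OF rpart_sums[of 0 w], of \<phi>] rpart_sums[of 1 w]]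
        zdig_sums[of 0 w]] w
      by (simp add: emb_def algebra_simps)
    have b: "\<bar>?e w\<bar> \<le> 3" "\<bar>of_int (ipart' 1 w) - of_int (ipart 1 w) * \<phi>\<bar> \<le> 3"
      using zdig_bound[of 0 w] zdig_bound[of 1 w] w by auto
    have "\<bar>\<psi> * ?e w\<bar> \<le> 1 * 3"
      unfolding abs_mult using b(1) golden_bounds by (intro mult_mono) auto
    then show "\<bar>of_int (?k w) - of_int (?j w) * \<phi>\<bar> \<le> 10"
      unfolding k using b(2) by linarith
    have "\<bar>\<phi> * rpart 0 w\<bar> \<le> 2 * 3"
      unfolding abs_mult using rpart_bound[of 0 w] golden_bounds by (intro mult_mono) auto
    then show "\<bar>?y w\<bar> \<le> 12"
      using rpart_bound[of 1 w] b(1) by linarith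
  qed
  moreover have "?y w = of_int (?j w) \<longleftrightarrow> tval 1 w = \<phi> * tval 0 w" for w
    by (auto simp: tval_eq algebra_simps)
  ultimately show ?thesis by simp
qed

text \<open>Integrality depends on the fractional part alone, which is at most 3 in absolute value,
  so finitely many expansions have to be tested.\<close>

lemma recognizable_int:
  "\<exists>S. recognizable L S \<and> (\<forall>w. w \<in> S \<longleftrightarrow> tval 0 w \<in> \<int>)"
proof -
  define S where "S = (\<Union>a\<in>{-3..3}. {w. (\<lambda>n. emb (rdig 0 (w n), 0) * \<gamma> ^ n) sums emb (a, 0)})"
  have "recognizable L S"
    unfolding S_def
    by (intro recognizable_UN recognizable_expansion[of L "\<lambda>_ a. (rdig 0 a, 0)"]) auto
  moreover have "w \<in> S \<longleftrightarrow> tval 0 w \<in> \<int>" for w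
  proof -
    have "w \<in> {w. (\<lambda>n. emb (rdig 0 (w n), 0) * \<gamma> ^ n) sums emb (a, 0)} \<longleftrightarrow> rpart 0 w = of_int a" for a
      using sums_iff_eq[OF rpart_sums[of 0 w], of "of_int a"] by (simp add: emb_def)
    then have "w \<in> S \<longleftrightarrow> (\<exists>a\<in>{-3..3}. rpart 0 w = of_int a)"
      unfolding S_def by blast
    also have "\<dots> \<longleftrightarrow> rpart 0 w \<in> \<int>"
      using rpart_bound[of 0 w] by (auto elim!: Ints_cases)
    also have "\<dots> \<longleftrightarrow> tval 0 w \<in> \<int>"
      unfolding tval_eq by (metis Ints_add Ints_diff Ints_of_int add_diff_cancel_left')
    finally show ?thesis .
  qed
  ultimately show ?thesis by blast
qed

section \<open>Existence of representations\<close>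

text \<open>Greedy expansion as in Zeckendorf's theorem. The index bound \<open>k + 1\<close> in the
  induction ensures that \<open>fib (k + 2)\<close> is not taken twice.\<close>

lemma nat_fib_sum:
  "n < fib (k + 2) \<Longrightarrow> \<exists>A\<subseteq>{..k + 1}. (\<Sum>i\<in>A. fib i) = n"
proof (induction k arbitrary: n)
  case 0
  then show ?case by (intro exI[of _ "{}"]) auto
next
  case (Suc k)
  show ?case
  proof (cases "n < fib (k + 2)")
    case True
    then obtain A where "A \<subseteq> {..k + 1}" "(\<Sum>i\<in>A. fib i) = n" using Suc.IH by blast
    then show ?thesis by (intro exI[of _ A]) auto
  next
    case False
    have "n - fib (k + 2) < fib (k + 2)"
      using Suc.prems fib_mono[of "k + 1" "k + 2"] by (simp add: numeral_eq_Suc)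
    then obtain A where A: "A \<subseteq> {..k + 1}" "(\<Sum>i\<in>A. fib i) = n - fib (k + 2)"
      using Suc.IH by blast
    have "finite A" "k + 2 \<notin> A" using A(1) finite_subset by auto
    then have "(\<Sum>i\<in>insert (k + 2) A. fib i) = n" using A(2) False by simp
    moreover have "insert (k + 2) A \<subseteq> {..Suc k + 1}" using A(1) by auto
    ultimately show ?thesis by blast
  qed
qed

lemma nat_eq_fib_sum: "\<exists>A. finite A \<and> (\<Sum>i\<in>A. fib i) = n"
  using nat_fib_sum[OF less_fib] finite_subset by blast

text \<open>Greedy expansion in base \<phi>. The remainders stay between 0 and
  \<open>\<phi> + 1\<close>: removing the digit leaves at most \<phi>, and
  \<open>\<phi> * \<phi> = \<phi> + 1\<close>.\<close>

lemma fraction_expansion: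
  assumes "0 \<le> r" "r \<le> 1"
  shows "\<exists>B. r = (\<Sum>n. of_bool (n \<in> B) * \<gamma> ^ n)"
proof -
  define x where "x n = rec_nat r (\<lambda>_ s. \<phi> * (s - of_bool (1 \<le> s))) n" for n
  have x: "x 0 = r" "x (Suc n) = \<phi> * (x n - of_bool (1 \<le> x n))" for n by (simp_all add: x_def)
  define B where "B = {n. 1 \<le> x n}"
  have bound: "0 \<le> x n \<and> x n \<le> \<phi> + 1" for n
  proof (induction n)
    case 0
    show ?case using assms golden_bounds by (simp add: x)
  next
    case (Suc n)
    have "0 \<le> x n - of_bool (1 \<le> x n) \<and> x n - of_bool (1 \<le> x n) \<le> \<phi>"
      using Suc golden_bounds by auto
    then have "0 \<le> x (Suc n) \<and> x (Suc n) \<le> \<phi> * \<phi>"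
      unfolding x using golden_bounds by (simp add: mult_left_mono)
    then show ?case by (simp add: golden_sq)
  qed
  have sum: "(\<Sum>i<n. of_bool (i \<in> B) * \<gamma> ^ i) = r - x n * \<gamma> ^ n" for n
  proof (induction n)
    case (Suc n)
    have "x (Suc n) * \<gamma> ^ Suc n = (\<phi> * \<gamma>) * ((x n - of_bool (n \<in> B)) * \<gamma> ^ n)"
      by (simp add: x B_def)
    also have "\<dots> = x n * \<gamma> ^ n - of_bool (n \<in> B) * \<gamma> ^ n"
      by (simp only: golden_inverse mult_1 left_diff_distrib)
    finally show ?case by (simp only: sum.lessThan_Suc Suc.IH)
  qed (simp add: x)
  have "(\<lambda>n. \<gamma> ^ n) \<longlonglongrightarrow> 0"
    by (rule LIMSEQ_power_zero) (use golden_bounds in simp)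
  moreover have "norm (x n * \<gamma> ^ n) \<le> norm (\<gamma> ^ n) * (\<phi> + 1)" for n
    using bound[of n] golden_bounds by (simp add: abs_mult mult.commute mult_left_mono)
  ultimately have "(\<lambda>n. x n * \<gamma> ^ n) \<longlonglongrightarrow> 0"
    by (rule tendsto_0_le[OF _ always_eventually, rule_format])
  then have "(\<lambda>n. of_bool (n \<in> B) * \<gamma> ^ n) sums r"
    unfolding sums_def sum using tendsto_diff[OF tendsto_const, of _ 0 sequentially r] by simp
  then show ?thesis by (auto simp: sums_iff)
qed

text \<open>Together with \<open>rep_nonneg\<close>, the clause on \<open>A'\<close> characterises
  the non-negative numbers as those with a representation free of negative digits. The order is
  obtained from this.\<close>

lemma rep_surj: "\<exists>A A' B. finite A \<and> finite A' \<and> (0 \<le> x \<longrightarrow> A' = {}) \<and> rep A A' B = x"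
proof -
  have "0 \<le> x - \<lfloor>x\<rfloor>" "x - \<lfloor>x\<rfloor> \<le> 1" by linarith+
  then obtain B where B: "x - \<lfloor>x\<rfloor> = (\<Sum>n. of_bool (n \<in> B) * \<gamma> ^ n)"
    using fraction_expansion by blast
  obtain A A' where A: "finite A" "(\<Sum>i\<in>A. fib i) = nat \<lfloor>x\<rfloor>"
      "finite A'" "(\<Sum>i\<in>A'. fib i) = nat (- \<lfloor>x\<rfloor>)"
    using nat_eq_fib_sum by metis
  show ?thesis
  proof (cases "0 \<le> x")
    case True
    then have "rep A {} B = x" using A B[symmetric] by (simp add: rep_def)
    then show ?thesis using A by blast
  next
    case False
    then have "rep {} A' B = x" using A B[symmetric] by (simp add: rep_def)
    then show ?thesis using A False by blast
  qed
qed

lemma rep_nonneg: "0 \<le> rep A {} B"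
proof -
  have "summable (\<lambda>n. of_bool (n \<in> B) * \<gamma> ^ n)"
    by (rule bounded_sums(1)[of _ 1]) simp
  then show ?thesis
    unfolding rep_def using golden_bounds by (auto intro!: add_nonneg_nonneg suminf_nonneg sum_nonneg)
qed

section \<open>Recognition of relations between real numbers\<close>

text \<open>Words that are not proper may be treated arbitrarily, so negation is plain
  complementation; properness is enforced where a variable is quantified.\<close>

definition represents :: "nat \<Rightarrow> nat \<Rightarrow> ((nat \<Rightarrow> real) \<Rightarrow> bool) \<Rightarrow> bool" where
  "represents K d \<Phi> \<longleftrightarrow> (\<exists>A. recog (2 ^ (3 * K)) d A \<and>
     (\<forall>w. (\<forall>n. w n < 2 ^ (3 * K)) \<longrightarrow> (\<forall>i<K. proper i w) \<longrightarrow> (w \<in> A \<longleftrightarrow> \<Phi> (\<lambda>i. tval i w))))"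

lemma representsI:
  assumes "recog (2 ^ (3 * K)) d A"
    and "\<And>w. (\<And>n. w n < 2 ^ (3 * K)) \<Longrightarrow> (\<And>i. i < K \<Longrightarrow> proper i w) \<Longrightarrow> w \<in> A \<longleftrightarrow> \<Phi> (\<lambda>i. tval i w)"
  shows "represents K d \<Phi>"
  using assms unfolding represents_def by blast

lemma representsE:
  assumes "represents K d \<Phi>"
  obtains A where "recog (2 ^ (3 * K)) d A"
    and "\<And>w. (\<And>n. w n < 2 ^ (3 * K)) \<Longrightarrow> (\<And>i. i < K \<Longrightarrow> proper i w) \<Longrightarrow> w \<in> A \<longleftrightarrow> \<Phi> (\<lambda>i. tval i w)"
  using assms unfolding represents_def by blast

lemma represents_neg: "represents K d \<Phi> \<Longrightarrow> represents K (negd d) (\<lambda>e. \<not> \<Phi> e)"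
  by (elim representsE, rule representsI, erule recog_negd) simp

lemma represents_conj:
  assumes "represents K d \<Phi>" "represents K d' \<Phi>'"
  shows "represents K (conjd (2 ^ (3 * K)) d d') (\<lambda>e. \<Phi> e \<and> \<Phi>' e)"
  using assms by (elim representsE) (rule representsI, erule recog_conjd, assumption, simp)

lemma mem_set_decode_bound: "a < 2 ^ m \<Longrightarrow> x \<in> set_decode a \<Longrightarrow> x < m"
proof (rule ccontr)
  assume "a < 2 ^ m" "x \<in> set_decode a" "\<not> x < m"
  then have "a < 2 ^ x" by (meson less_le_trans not_less one_le_numeral power_increasing)
  with \<open>x \<in> set_decode a\<close> show False by (simp add: set_decode_def)
qed

section \<open>Quantification over the tracks of one variable\<close>

definition same_off :: "nat \<Rightarrow> nat \<Rightarrow> nat \<Rightarrow> nat \<Rightarrow> bool" where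
  "same_off K i a b \<longleftrightarrow> (\<forall>x<3 * K. x = 3 * i \<or> x = 3 * i + 1 \<or> x = 3 * i + 2 \<or>
     (x \<in> set_decode a \<longleftrightarrow> x \<in> set_decode b))"

lemma decidable_same_off: "decidable (\<lambda>z. same_off (pfst z) (pfst (psnd z)) (pfst (psnd (psnd z)))
  (psnd (psnd (psnd z))))"
  unfolding same_off_def by (intro computable_intros)

text \<open>The guard \<open>g\<close> restricts the guessed tracks: to proper ones for the real
  quantifier, and moreover to those without negative digits for the order.\<close>

definition exd :: "nat \<Rightarrow> nat \<Rightarrow> nat \<Rightarrow> nat \<Rightarrow> nat" where
  "exd K i g d = projd (2 ^ (3 * K)) (same_off K i) (conjd (2 ^ (3 * K)) g d)"

lemma computable_exd [computable_intros]:
  assumes "computable K" "computable I" "computable G" "computable D"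
  shows "computable (\<lambda>n. exd (K n) (I n) (G n) (D n))"
proof -
  have *: "decidable (\<lambda>n. same_off (A n) (B n) (C n) (E n))" if "computable A" "computable B"
    "computable C" "computable E" for A B C E
    using decidable_comp[OF decidable_same_off, of "\<lambda>n. pair (A n) (pair (B n) (pair (C n) (E n)))"] that
    by (simp add: computable_intros)
  show ?thesis
    unfolding exd_def by (intro computable_intros * assms computable_comp[OF assms(1)]
      computable_comp[OF assms(2)])
qed

text \<open>A guessed word differs from \<open>w\<close> only on the tracks of variable
  \<open>i\<close>, so all other variables keep their values and their properness. The guard makes
  variable \<open>i\<close> proper as well, hence the meaning of \<open>d\<close> applies to the
  guessed word.\<close>

lemma represents_ex_restricted:
  assumes i: "i < K" and g: "recog (2 ^ (3 * K)) g G"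
    and G: "\<And>w. w \<in> G \<longleftrightarrow> R (bits (3 * i) w) (bits (3 * i + 1) w) (bits (3 * i + 2) w)"
    and R: "\<And>A A' B. R A A' B \<Longrightarrow> finite A \<and> finite A'"
    and d: "represents K d \<Phi>"
  shows "represents K (exd K i g d) (\<lambda>e. \<exists>A A' B. R A A' B \<and> \<Phi> (e(i := rep A A' B)))"
proof -
  let ?L = "2 ^ (3 * K) :: nat"
  obtain S where S: "recog ?L d S" and S': "\<And>w. (\<And>n. w n < ?L) \<Longrightarrow> (\<And>i. i < K \<Longrightarrow> proper i w) \<Longrightarrow>
      w \<in> S \<longleftrightarrow> \<Phi> (\<lambda>i. tval i w)"
    using d by (rule representsE) blast
  show ?thesis
  proof (rule representsI, unfold exd_def, rule recog_projd[OF recog_conjd[OF g S]])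
    fix w assume w: "\<And>n. w n < ?L" and pw: "\<And>j. j < K \<Longrightarrow> proper j w"
    have bits_eq: "bits x w' = bits x w"
      if w': "\<And>n. w' n < ?L \<and> same_off K i (w n) (w' n)" and x: "x \<noteq> 3 * i" "x \<noteq> 3 * i + 1"
        "x \<noteq> 3 * i + 2"
      for w' x
      using w' w mem_set_decode_bound[of _ "3 * K" x] x unfolding same_off_def bits_def
      by (metis (no_types, lifting))
    have tval_eq: "tval j w' = tval j w" "proper j w' = proper j w"
      if w': "\<And>n. w' n < ?L \<and> same_off K i (w n) (w' n)" and "j \<noteq> i" for w' j
    proof -
      have "bits (3 * j) w' = bits (3 * j) w" "bits (3 * j + 1) w' = bits (3 * j + 1) w"
        "bits (3 * j + 2) w' = bits (3 * j + 2) w"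
        by (rule bits_eq[OF w']; use that(2) in presburger)+
      then show "tval j w' = tval j w" "proper j w' = proper j w"
        unfolding tval_def proper_def by (simp_all flip: numeral_2_eq_2)
    qed
    show "w \<in> {w. \<exists>w'. (\<forall>n. w' n < ?L \<and> same_off K i (w n) (w' n)) \<and> w' \<in> G \<inter> S} \<longleftrightarrow>
      (\<exists>A A' B. R A A' B \<and> \<Phi> ((\<lambda>i. tval i w)(i := rep A A' B)))"
    proof
      assume "w \<in> {w. \<exists>w'. (\<forall>n. w' n < ?L \<and> same_off K i (w n) (w' n)) \<and> w' \<in> G \<inter> S}"
      then obtain w' where w': "\<And>n. w' n < ?L \<and> same_off K i (w n) (w' n)" "w' \<in> G" "w' \<in> S" by blast
      have R': "R (bits (3 * i) w') (bits (3 * i + 1) w') (bits (3 * i + 2) w')" using G w'(2) by blast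
      have "proper j w'" if "j < K" for j
        using tval_eq(2)[OF w'(1), of j] pw[OF that] R[OF R'] by (cases "j = i") (auto simp: proper_def)
      then have "\<Phi> (\<lambda>i. tval i w')" using S' w' by blast
      moreover have "(\<lambda>i. tval i w') = (\<lambda>i. tval i w)(i := tval i w')"
        using tval_eq(1)[OF w'(1)] by auto
      ultimately have "\<Phi> ((\<lambda>i. tval i w)(i := tval i w'))" by simp
      then show "\<exists>A A' B. R A A' B \<and> \<Phi> ((\<lambda>i. tval i w)(i := rep A A' B))"
        using R' unfolding tval_def[of i w'] by blast
    next
      assume "\<exists>A A' B. R A A' B \<and> \<Phi> ((\<lambda>i. tval i w)(i := rep A A' B))"
      then obtain A A' B where RA: "R A A' B" and \<Phi>: "\<Phi> ((\<lambda>i. tval i w)(i := rep A A' B))" by blast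
      define D where "D n = {x. x < 3 * K \<and> (if x = 3 * i then n \<in> A else if x = 3 * i + 1 then n \<in> A'
        else if x = 3 * i + 2 then n \<in> B else x \<in> set_decode (w n))}" for n
      define w' where "w' n = set_encode (D n)" for n
      have fin: "finite (D n)" for n unfolding D_def by simp
      have dec: "set_decode (w' n) = D n" for n unfolding w'_def using fin by simp
      have w'1: "w' n < ?L \<and> same_off K i (w n) (w' n)" for n
        unfolding same_off_def dec by (auto simp: D_def w'_def intro!: set_encode_less)
      have b: "bits (3 * i) w' = A" "bits (3 * i + 1) w' = A'" "bits (3 * i + 2) w' = B"
        using i unfolding bits_def dec by (auto simp: D_def)
      have "w' \<in> G" using G RA b by simp
      moreover have "proper j w'" if "j < K" for j
        using tval_eq(2)[OF w'1, of j] pw[OF that] R[OF RA] b by (cases "j = i") (auto simp: proper_def)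
      moreover have "(\<lambda>j. tval j w') = (\<lambda>i. tval i w)(i := rep A A' B)"
        using tval_eq(1)[OF w'1] b by (auto simp: tval_def[of i w'])
      ultimately show "w \<in> {w. \<exists>w'. (\<forall>n. w' n < ?L \<and> same_off K i (w n) (w' n)) \<and> w' \<in> G \<inter> S}"
        using S'[of w'] w'1 \<Phi> by auto
    qed
  qed
qed

section \<open>Instantiating ternary relations at arbitrary variables\<close>

text \<open>A letter for \<open>K\<close> variables is mapped to one for three variables, whence 9
  tracks and the alphabet size \<open>512 = 2 ^ 9\<close>. An atomic relation at the variables
  \<open>i\<close>, \<open>j\<close>, \<open>k\<close> is then the inverse image of one fixed
  language.\<close>

definition select :: "nat \<Rightarrow> nat \<Rightarrow> nat \<Rightarrow> nat \<Rightarrow> nat" where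
  "select i j k a = set_encode {x. x < 9 \<and>
     (if x < 3 then 3 * i + x else if x < 6 then 3 * j + (x - 3) else 3 * k + (x - 6)) \<in> set_decode a}"

lemma select_less: "select i j k a < 512"
proof -
  have "select i j k a < 2 ^ 9" unfolding select_def by (rule set_encode_less) auto
  then show ?thesis by simp
qed

lemma computable_select: "computable (\<lambda>z. select (pfst z) (pfst (psnd z)) (pfst (psnd (psnd z)))
  (psnd (psnd (psnd z))))"
  unfolding select_def by (intro computable_intros)

definition atomd :: "nat \<Rightarrow> nat \<Rightarrow> nat \<Rightarrow> nat \<Rightarrow> nat \<Rightarrow> nat" where
  "atomd K d i j k = mapd (2 ^ (3 * K)) (select i j k) d"

lemma computable_atomd [computable_intros]:
  assumes "computable K" "computable D" "computable I" "computable J" "computable M"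
  shows "computable (\<lambda>n. atomd (K n) (D n) (I n) (J n) (M n))"
proof -
  have *: "computable (\<lambda>n. select (A n) (B n) (C n) (E n))" if "computable A" "computable B"
    "computable C" "computable E" for A B C E
    using computable_comp[OF computable_select, of "\<lambda>n. pair (A n) (pair (B n) (pair (C n) (E n)))"] that
    by (simp add: computable_intros)
  show ?thesis
    unfolding atomd_def
    by (intro computable_intros * assms computable_comp[OF assms(3)] computable_comp[OF assms(4)]
      computable_comp[OF assms(5)])
qed

lemma recog_atomd:
  "recog 512 d S \<Longrightarrow> recog L (mapd L (select i j k) d) {w. select i j k \<circ> w \<in> S}"
  by (erule recog_mapd) (rule select_less)

lemma bits_select:
  "x < 3 \<Longrightarrow> bits x (select i j k \<circ> w) = bits (3 * i + x) w"
  "x < 3 \<Longrightarrow> bits (3 + x) (select i j k \<circ> w) = bits (3 * j + x) w"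
  "x < 3 \<Longrightarrow> bits (6 + x) (select i j k \<circ> w) = bits (3 * k + x) w"
  by (auto simp: bits_def select_def)

lemma tval_select:
  "tval 0 (select i j k \<circ> w) = tval i w" "tval 1 (select i j k \<circ> w) = tval j w"
  "tval 2 (select i j k \<circ> w) = tval k w"
  "proper 0 (select i j k \<circ> w) = proper i w" "proper 1 (select i j k \<circ> w) = proper j w"
  "proper 2 (select i j k \<circ> w) = proper k w"
  using bits_select(1)[of 0 i j k w] bits_select(1)[of 1 i j k w] bits_select(1)[of 2 i j k w]
    bits_select(2)[of 0 i j k w] bits_select(2)[of 1 i j k w] bits_select(2)[of 2 i j k w]
    bits_select(3)[of 0 i j k w] bits_select(3)[of 1 i j k w] bits_select(3)[of 2 i j k w]
  unfolding tval_def proper_def by (simp_all flip: numeral_2_eq_2)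

lemma represents_atom:
  assumes d: "represents 3 d (\<lambda>e. \<Phi> (e 0) (e 1) (e 2))" and "i < K" "j < K" "k < K"
  shows "represents K (atomd K d i j k) (\<lambda>e. \<Phi> (e i) (e j) (e k))"
proof -
  obtain S where S: "recog 512 d S" and S': "\<And>w. (\<And>n. w n < 512) \<Longrightarrow> (\<And>i. i < 3 \<Longrightarrow> proper i w) \<Longrightarrow>
      w \<in> S \<longleftrightarrow> \<Phi> (tval 0 w) (tval 1 w) (tval 2 w)"
    using d by (rule representsE) auto
  show ?thesis
  proof (rule representsI, unfold atomd_def, rule recog_atomd[OF S])
    fix w assume w: "\<And>n. w n < 2 ^ (3 * K)" "\<And>i. i < K \<Longrightarrow> proper i w"
    have "(select i j k \<circ> w) n < 512" for n
      using select_less by simp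
    moreover have "proper x (select i j k \<circ> w)" if "x < 3" for x
      using that tval_select(4-6)[of i j k w] w(2) assms(2-4) by (auto simp: less_Suc_eq numeral_eq_Suc)
    ultimately show "w \<in> {w. select i j k \<circ> w \<in> S} \<longleftrightarrow> \<Phi> (tval i w) (tval j w) (tval k w)"
      using S'[of "select i j k \<circ> w"] tval_select(1-3)[of i j k w] by simp
  qed
qed

lemma ex_proper_data: "\<exists>d. recog 512 d {w. proper 0 w}"
proof -
  have "recognizable 512 ({w. finite {n. w n \<notin> {a. 0 \<notin> set_decode a}}} \<inter>
      {w. finite {n. w n \<notin> {a. 1 \<notin> set_decode a}}})"
    by (intro recognizable_Int recognizable_eventually)
  moreover have "{w. finite {n. w n \<notin> {a. 0 \<notin> set_decode a}}} \<inter>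
      {w. finite {n. w n \<notin> {a. 1 \<notin> set_decode a}}} = {w. proper 0 w}"
    by (auto simp: proper_def bits_def)
  ultimately show ?thesis unfolding recognizable_def by simp
qed

definition properd :: nat where "properd = (SOME d. recog 512 d {w. proper 0 w})"

lemma recog_properd: "recog 512 properd {w. proper 0 w}"
  unfolding properd_def using ex_proper_data by (rule someI_ex)

definition exrd :: "nat \<Rightarrow> nat \<Rightarrow> nat \<Rightarrow> nat" where
  "exrd K i d = exd K i (mapd (2 ^ (3 * K)) (select i i i) properd) d"

lemma computable_exrd [computable_intros]:
  assumes "computable K" "computable I" "computable D"
  shows "computable (\<lambda>n. exrd (K n) (I n) (D n))"
  unfolding exrd_def atomd_def[symmetric] by (intro computable_intros assms)

lemma represents_ex:
  assumes "i < K" "represents K d \<Phi>"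
  shows "represents K (exrd K i d) (\<lambda>e. \<exists>x. \<Phi> (e(i := x)))"
proof -
  let ?G = "{w. select i i i \<circ> w \<in> {w. proper 0 w}}"
  have "represents K (exrd K i d) (\<lambda>e. \<exists>A A' B. (finite A \<and> finite A') \<and> \<Phi> (e(i := rep A A' B)))"
    unfolding exrd_def
    by (rule represents_ex_restricted[OF assms(1) recog_atomd[OF recog_properd] _ _ assms(2)])
      (unfold mem_Collect_eq tval_select, auto simp: proper_def)
  moreover have "(\<exists>A A' B. (finite A \<and> finite A') \<and> \<Phi> (e(i := rep A A' B))) \<longleftrightarrow> (\<exists>x. \<Phi> (e(i := x)))" for e
    using rep_surj by metis
  ultimately show ?thesis by simp
qed

lemma represents_of_recognizable:
  assumes "\<exists>S. recognizable 512 S \<and> (\<forall>w. proper 0 w \<and> proper 1 w \<and> proper 2 w \<longrightarrow>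
     (w \<in> S \<longleftrightarrow> \<Phi> (tval 0 w) (tval 1 w) (tval 2 w)))"
  shows "\<exists>d. represents 3 d (\<lambda>e. \<Phi> (e 0) (e 1) (e 2))"
  using assms unfolding recognizable_def represents_def by fastforce

lemma ex_addd: "\<exists>d. represents 3 d (\<lambda>e. e 0 + e 1 = e 2)"
  by (rule represents_of_recognizable[OF recognizable_add])

lemma ex_scaled: "\<exists>d. represents 3 d (\<lambda>e. e 1 = \<phi> * e 0)"
  by (rule represents_of_recognizable[of "\<lambda>x y z. y = \<phi> * x"]) (use recognizable_scale[of 512] in blast)

lemma ex_intd: "\<exists>d. represents 3 d (\<lambda>e. e 0 \<in> \<int>)"
  by (rule represents_of_recognizable[of "\<lambda>x y z. x \<in> \<int>"]) (use recognizable_int[of 512] in blast)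

text \<open>Representations are redundant, so equal numbers may have different tracks. Equality is
  derived from addition, with a third number satisfying \<open>z + z = z\<close>, which is
  0.\<close>

lemma ex_eqd: "\<exists>d. represents 3 d (\<lambda>e. e 0 = e 1)"
proof -
  obtain d where d: "represents 3 d (\<lambda>e. e 0 + e 1 = e 2)" using ex_addd ..
  have "represents 3 (exrd 3 2 (conjd (2 ^ (3 * 3)) (atomd 3 d 2 2 2) (atomd 3 d 0 2 1)))
    (\<lambda>e. \<exists>x. (e(2 := x)) 2 + (e(2 := x)) 2 = (e(2 := x)) 2 \<and> (e(2 := x)) 0 + (e(2 := x)) 2 =
      (e(2 := x)) 1)"
    by (intro represents_ex represents_conj represents_atom[OF d]) simp_all
  then show ?thesis by auto
qed

lemma ex_lessd: "\<exists>d. represents 3 d (\<lambda>e. e 0 < e 1)"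
proof -
  obtain d d' where d: "represents 3 d (\<lambda>e. e 0 + e 1 = e 2)" and d': "represents 3 d' (\<lambda>e. e 0 = e 1)"
    using ex_addd ex_eqd by blast
  \<comment> \<open>Track \<open>7 = 3 * 2 + 1\<close> holds the negative digits of variable 2.
    Keeping it empty makes that variable, the difference of variables 1 and 0, non-negative.\<close>
  let ?G = "{w. select 2 2 2 \<circ> w \<in> {w. proper 0 w}} \<inter> {w. \<forall>n. w n \<in> {a. 7 \<notin> set_decode a}}"
  have "recognizable 512 ?G"
    using recog_atomd[OF recog_properd, of 512 2 2 2]
    by (intro recognizable_Int recognizable_always) (auto simp: recognizable_def)
  then obtain g where g: "recog (2 ^ (3 * 3)) g ?G"
    by (auto simp: recognizable_def)
  have "represents 3 (exd 3 2 g (atomd 3 d 0 2 1))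
    (\<lambda>e. \<exists>A A' B. (finite A \<and> A' = {}) \<and> (e(2 := rep A A' B)) 0 + (e(2 := rep A A' B)) 2 =
      (e(2 := rep A A' B)) 1)"
    by (rule represents_ex_restricted[OF _ g _ _ represents_atom[OF d]])
      (unfold Int_iff mem_Collect_eq tval_select, auto simp: proper_def bits_def)
  from represents_conj[OF this represents_neg[OF d']]
  have "represents 3 (conjd (2 ^ (3 * 3)) (exd 3 2 g (atomd 3 d 0 2 1)) (negd d'))
    (\<lambda>e. (\<exists>A A' B. (finite A \<and> A' = {}) \<and> e 0 + rep A A' B = e 1) \<and> e 0 \<noteq> e 1)" by simp
  moreover have "(\<exists>A A' B. (finite A \<and> A' = {}) \<and> x + rep A A' B = y) \<and> x \<noteq> y \<longleftrightarrow> x < y" for x y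
  proof
    assume "(\<exists>A A' B. (finite A \<and> A' = {}) \<and> x + rep A A' B = y) \<and> x \<noteq> y"
    then obtain A B where "x + rep A {} B = y" "x \<noteq> y" by blast
    then show "x < y" using rep_nonneg[of A B] by linarith
  next
    assume "x < y"
    then obtain A A' B where "finite A" "A' = {}" "rep A A' B = y - x"
      using rep_surj[of "y - x"] by auto
    then show "(\<exists>A A' B. (finite A \<and> A' = {}) \<and> x + rep A A' B = y) \<and> x \<noteq> y"
      using \<open>x < y\<close> by (intro conjI exI[of _ A] exI[of _ A'] exI[of _ B]) auto
  qed
  ultimately show ?thesis by auto
qed

section \<open>The decision procedure\<close>

text \<open>Constants are computable however they are chosen, so the semigroups of the atomic relations need
  not be explicit.\<close>

definition addd :: nat where "addd = (SOME d. represents 3 d (\<lambda>e. e 0 + e 1 = e 2))"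
definition scaled :: nat where "scaled = (SOME d. represents 3 d (\<lambda>e. e 1 = \<phi> * e 0))"
definition intd :: nat where "intd = (SOME d. represents 3 d (\<lambda>e. e 0 \<in> \<int>))"
definition eqd :: nat where "eqd = (SOME d. represents 3 d (\<lambda>e. e 0 = e 1))"
definition lessd :: nat where "lessd = (SOME d. represents 3 d (\<lambda>e. e 0 < e 1))"

lemma represents_atoms:
  assumes "i < K" "j < K" "k < K"
  shows "represents K (atomd K addd i j k) (\<lambda>e. e i + e j = e k)"
    "represents K (atomd K scaled i j k) (\<lambda>e. e j = \<phi> * e i)"
    "represents K (atomd K intd i j k) (\<lambda>e. e i \<in> \<int>)"
    "represents K (atomd K eqd i j k) (\<lambda>e. e i = e j)"
    "represents K (atomd K lessd i j k) (\<lambda>e. e i < e j)"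
  using represents_atom[OF someI_ex[OF ex_addd] assms]
    represents_atom[of scaled "\<lambda>x y z. y = \<phi> * x", OF someI_ex[OF ex_scaled, folded scaled_def] assms]
    represents_atom[of intd "\<lambda>x y z. x \<in> \<int>", OF someI_ex[OF ex_intd, folded intd_def] assms]
    represents_atom[of eqd "\<lambda>x y z. x = y", OF someI_ex[OF ex_eqd, folded eqd_def] assms]
    represents_atom[of lessd "\<lambda>x y z. x < y", OF someI_ex[OF ex_lessd, folded lessd_def] assms]
  by (simp_all add: addd_def)

text \<open>The variable \<open>i\<close> lives on track \<open>2 i\<close>, the value of the term with code \<open>c\<close> on track \<open>2 c + 1\<close>.\<close>

definition bindd :: "nat \<Rightarrow> nat \<Rightarrow> nat \<Rightarrow> nat \<Rightarrow> nat" where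
  "bindd K c d r = exrd K (2 * c + 1) (conjd (2 ^ (3 * K)) d r)"

lemma computable_bindd [computable_intros]:
  assumes "computable K" "computable C" "computable D" "computable R"
  shows "computable (\<lambda>n. bindd (K n) (C n) (D n) (R n))"
  unfolding bindd_def by (intro computable_intros assms)

definition defines_tm :: "nat \<Rightarrow> nat \<Rightarrow> S_tm \<Rightarrow> bool" where
  "defines_tm K d t \<longleftrightarrow> represents K d (\<lambda>e. e (2 * S_tm_code t + 1) = S_tm_val \<phi> (\<lambda>i. e (2 * i)) t)"

text \<open>Values of terms have odd indices and variables even ones, so quantifying the odd index
  does not change the value of the term. The quantifier has a unique witness and amounts to
  substitution.\<close>

lemma represents_bind:
  assumes "defines_tm K d t" "represents K r Q" "2 * S_tm_code t + 1 < K"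
  shows "represents K (bindd K (S_tm_code t) d r)
    (\<lambda>e. Q (e(2 * S_tm_code t + 1 := S_tm_val \<phi> (\<lambda>i. e (2 * i)) t)))"
proof -
  let ?a = "2 * S_tm_code t + 1"
  have par: "(e(?a := x)) (2 * i) = e (2 * i)" for e :: "nat \<Rightarrow> real" and x i
  proof -
    have "2 * i \<noteq> ?a" by presburger
    then show ?thesis by simp
  qed
  have "represents K (bindd K (S_tm_code t) d r)
    (\<lambda>e. \<exists>x. (e(?a := x)) ?a = S_tm_val \<phi> (\<lambda>i. (e(?a := x)) (2 * i)) t \<and> Q (e(?a := x)))"
    using represents_ex[OF assms(3) represents_conj[OF assms(1)[unfolded defines_tm_def] assms(2)]]
    by (simp add: bindd_def)
  then show ?thesis unfolding par by simp
qed

text \<open>The strict inequality needs a positive tag, as \<open>pair 0 0 = 0\<close>. Constructors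
  with arguments of their own kind have the tags 1, 2 and 3, so codes decrease along the
  recursion.\<close>

lemma less_pr: "y < pair (Suc k) y" "x \<le> pair x y" "y \<le> pair x y"
proof -
  have "y \<le> triangle y" by (induction y) auto
  also have "\<dots> \<le> triangle (Suc k + y)" by (rule triangle_mono) simp
  finally show "y < pair (Suc k) y" by (simp add: prod_encode_def)
qed (rule le_prod_encode_1 le_prod_encode_2)+

definition tm_step :: "nat \<Rightarrow> nat \<Rightarrow> nat \<Rightarrow> nat" where
  "tm_step K x m =
    (if pfst x = 0 then atomd K eqd (2 * psnd x) (2 * x + 1) 0
     else if pfst x = 1 then
       bindd K (pfst (psnd x)) (app m (pfst (psnd x))) (bindd K (psnd (psnd x)) (app m (psnd (psnd x)))
         (atomd K addd (2 * pfst (psnd x) + 1) (2 * psnd (psnd x) + 1) (2 * x + 1)))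
     else bindd K (psnd x) (app m (psnd x)) (atomd K scaled (2 * psnd x + 1) (2 * x + 1) 0))"

text \<open>One \<open>K\<close> serves a term and all its subterms: their codes are smaller, so the
  bound on the code covers every index that occurs. Relations of two places are padded with the
  index 0.\<close>

lemma ex_tm_data:
  "\<exists>f. computable2 f \<and> (\<forall>K t. 2 * S_tm_code t + 1 < K \<longrightarrow> defines_tm K (f K (S_tm_code t)) t)"
proof -
  have "computable (\<lambda>z. tm_step (pfst z) (pfst (psnd z)) (psnd (psnd z)))"
    unfolding tm_step_def by (intro computable_intros)
  then obtain f where f: "computable2 f"
    and step: "\<And>K x. \<exists>m. f K x = tm_step K x m \<and> (\<forall>y<x. app m y = f K y)"
    using course_of_values by blast
  have "defines_tm K (f K (S_tm_code t)) t" if "2 * S_tm_code t + 1 < K" for K t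
    using that
  proof (induction t)
    case (SVar i)
    obtain m where "f K (S_tm_code (SVar i)) = tm_step K (S_tm_code (SVar i)) m" using step by blast
    then show ?case
      using SVar le_prod_encode_2[of i 0] represents_atoms(4)[of "2 * i" K "2 * pair 0 i + 1" 0]
      by (simp add: defines_tm_def tm_step_def eq_commute)
  next
    case (SAdd s t)
    let ?c = "S_tm_code (SAdd s t)"
    have lt: "S_tm_code s < ?c" "S_tm_code t < ?c"
      using less_pr(1)[of "pair (S_tm_code s) (S_tm_code t)" 0]
        less_pr(2,3)[of "S_tm_code s" "S_tm_code t"] less_pr(3)[of "S_tm_code t" "S_tm_code s"] by auto
    obtain m where m: "f K ?c = tm_step K ?c m" "\<forall>y<?c. app m y = f K y" using step by blast
    let ?a = "2 * S_tm_code s + 1" and ?b = "2 * S_tm_code t + 1"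
    have "represents K (f K ?c) (\<lambda>e. (\<lambda>e. (\<lambda>e. e ?a + e ?b = e (2 * ?c + 1))
        (e(?b := S_tm_val \<phi> (\<lambda>i. e (2 * i)) t))) (e(?a := S_tm_val \<phi> (\<lambda>i. e (2 * i)) s)))"
      (is "represents K _ ?Q")
    proof -
      have "f K ?c = bindd K (S_tm_code s) (f K (S_tm_code s)) (bindd K (S_tm_code t) (f K (S_tm_code t))
          (atomd K addd ?a ?b (2 * ?c + 1)))"
        using m lt by (simp add: tm_step_def)
      then show ?thesis
        using SAdd lt by (simp only:) (intro represents_bind represents_atoms; simp)
    qed
    moreover have "?Q e \<longleftrightarrow> e (2 * ?c + 1) = S_tm_val \<phi> (\<lambda>i. e (2 * i)) (SAdd s t)" for e
    proof -
      have "2 * i \<noteq> ?a" "2 * i \<noteq> ?b" for i by presburger+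
      \<comment> \<open>For \<open>s = t\<close> both bindings update the same index, with the same
        value.\<close>
      then show ?thesis using lt by (cases "s = t") (auto simp del: S_tm_code.simps)
    qed
    ultimately show ?case unfolding defines_tm_def by simp
  next
    case (SScale s)
    let ?c = "S_tm_code (SScale s)"
    have lt: "S_tm_code s < ?c"
      using less_pr(1)[of "S_tm_code s" 1] by (simp add: numeral_2_eq_2)
    obtain m where m: "f K ?c = tm_step K ?c m" "\<forall>y<?c. app m y = f K y" using step by blast
    let ?a = "2 * S_tm_code s + 1"
    have "represents K (f K ?c) (\<lambda>e. (\<lambda>e. e (2 * ?c + 1) = \<phi> * e ?a)
      (e(?a := S_tm_val \<phi> (\<lambda>i. e (2 * i)) s)))"
      (is "represents K _ ?Q")
    proof -
      have "f K ?c = bindd K (S_tm_code s) (f K (S_tm_code s)) (atomd K scaled ?a (2 * ?c + 1) 0)"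
        using m lt by (simp add: tm_step_def)
      then show ?thesis
        using SScale lt by (simp only:) (intro represents_bind represents_atoms; simp)
    qed
    moreover have "?Q e \<longleftrightarrow> e (2 * ?c + 1) = S_tm_val \<phi> (\<lambda>i. e (2 * i)) (SScale s)" for e
      using lt by (auto simp del: S_tm_code.simps)
    ultimately show ?case unfolding defines_tm_def by simp
  qed
  with f show ?thesis by blast
qed

definition atom_step :: "(nat \<Rightarrow> nat \<Rightarrow> nat) \<Rightarrow> nat \<Rightarrow> nat \<Rightarrow> nat" where
  "atom_step f K x =
    (if pfst x = 2 then bindd K (psnd x) (f K (psnd x)) (atomd K intd (2 * psnd x + 1) 0 0)
     else bindd K (pfst (psnd x)) (f K (pfst (psnd x))) (bindd K (psnd (psnd x)) (f K (psnd (psnd x)))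
       (atomd K (if pfst x = 0 then eqd else lessd) (2 * pfst (psnd x) + 1) (2 * psnd (psnd x) + 1) 0)))"

lemma represents_atom_step:
  assumes f: "\<And>K t. 2 * S_tm_code t + 1 < K \<Longrightarrow> defines_tm K (f K (S_tm_code t)) t"
    and K: "2 * S_atom_code b + 1 < K"
  shows "represents K (atom_step f K (S_atom_code b)) (\<lambda>e. S_struct \<phi> (\<lambda>i. e (2 * i)) b)"
proof -
  have bin: "represents K (bindd K (S_tm_code s) (f K (S_tm_code s))
    (bindd K (S_tm_code t) (f K (S_tm_code t))
      (atomd K d (2 * S_tm_code s + 1) (2 * S_tm_code t + 1) 0)))
      (\<lambda>e. R (S_tm_val \<phi> (\<lambda>i. e (2 * i)) s) (S_tm_val \<phi> (\<lambda>i. e (2 * i)) t))"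
    if d: "represents K (atomd K d (2 * S_tm_code s + 1) (2 * S_tm_code t + 1) 0)
        (\<lambda>e. R (e (2 * S_tm_code s + 1)) (e (2 * S_tm_code t + 1)))"
      and st: "2 * S_tm_code s + 1 < K" "2 * S_tm_code t + 1 < K" for d R s t
  proof -
    let ?a = "2 * S_tm_code s + 1" and ?b = "2 * S_tm_code t + 1"
    have "represents K (bindd K (S_tm_code s) (f K (S_tm_code s))
      (bindd K (S_tm_code t) (f K (S_tm_code t))
      (atomd K d ?a ?b 0))) (\<lambda>e. (\<lambda>e. (\<lambda>e. R (e ?a) (e ?b))
        (e(?b := S_tm_val \<phi> (\<lambda>i. e (2 * i)) t))) (e(?a := S_tm_val \<phi> (\<lambda>i. e (2 * i)) s)))"
      (is "represents K _ ?Q")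
      by (intro represents_bind f st d)
    moreover have "?Q e \<longleftrightarrow> R (S_tm_val \<phi> (\<lambda>i. e (2 * i)) s) (S_tm_val \<phi> (\<lambda>i. e (2 * i)) t)" for e
    proof -
      have "2 * i \<noteq> ?a" "2 * i \<noteq> ?b" for i by presburger+
      then show ?thesis by (cases "s = t") auto
    qed
    ultimately show ?thesis by simp
  qed
  have lt: "2 * S_tm_code s + 1 < K \<and> 2 * S_tm_code t + 1 < K"
    if "2 * pair k (pair (S_tm_code s) (S_tm_code t)) + 1 < K" for k s t
    using that less_pr(2,3)[of "S_tm_code s" "S_tm_code t"] less_pr(3)[of "S_tm_code t" "S_tm_code s"]
      less_pr(3)[of "pair (S_tm_code s) (S_tm_code t)" k] by linarith
  show ?thesis
  proof (cases b)
    case (SEq s t)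
    then show ?thesis
      using bin[of eqd s t "(=)", OF represents_atoms(4)] lt[of 0 s t] K by (simp add: atom_step_def)
  next
    case (SLess s t)
    then show ?thesis
      using bin[of lessd s t "(<)", OF represents_atoms(5)] lt[of 1 s t] K by (simp add: atom_step_def)
  next
    case (SInt t)
    have t: "2 * S_tm_code t + 1 < K"
      using K SInt less_pr(3)[of "S_tm_code t" 2] by simp
    show ?thesis
      using represents_bind[OF f[OF t] represents_atoms(3)[of "2 * S_tm_code t + 1" K 0 0] t] t SInt
      by (simp add: atom_step_def)
  qed
qed

definition fm_step :: "(nat \<Rightarrow> nat \<Rightarrow> nat) \<Rightarrow> nat \<Rightarrow> nat \<Rightarrow> nat \<Rightarrow> nat" where
  "fm_step g K x m =
    (if pfst x = 0 then g K (psnd x)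
     else if pfst x = 1 then negd (app m (psnd x))
     else if pfst x = 2 then conjd (2 ^ (3 * K)) (app m (pfst (psnd x))) (app m (psnd (psnd x)))
     else exrd K (2 * pfst (psnd x)) (app m (psnd (psnd x))))"

text \<open>Induction on the formula with \<open>K\<close> fixed, since negation, conjunction and
  projection keep the alphabet. Quantifying the variable \<open>i\<close> of the formula means
  quantifying the even index \<open>2 * i\<close>.\<close>

lemma ex_fm_data:
  "\<exists>f. computable2 f \<and> (\<forall>K p. 2 * fm_code S_atom_code p + 1 < K \<longrightarrow>
     represents K (f K (fm_code S_atom_code p)) (\<lambda>e. sat (S_struct \<phi>) (\<lambda>i. e (2 * i)) p))"
proof -
  obtain h where h: "computable2 h" and h': "\<And>K t. 2 * S_tm_code t + 1 < K \<Longrightarrow> defines_tm K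
    (h K (S_tm_code t)) t"
    using ex_tm_data by blast
  define g where "g = atom_step h"
  have "computable2 g"
    unfolding g_def computable2_def atom_step_def by (intro computable_intros computable2D[OF h])
  then have "computable (\<lambda>z. fm_step g (pfst z) (pfst (psnd z)) (psnd (psnd z)))"
    unfolding fm_step_def by (intro computable_intros computable2D[of g])
  then obtain f where f: "computable2 f"
    and step: "\<And>K x. \<exists>m. f K x = fm_step g K x m \<and> (\<forall>y<x. app m y = f K y)"
    using course_of_values by blast
  have "represents K (f K (fm_code S_atom_code p)) (\<lambda>e. sat (S_struct \<phi>) (\<lambda>i. e (2 * i)) p)"
    if "2 * fm_code S_atom_code p + 1 < K" for K p
    using that
  proof (induction p)
    case (Atom b)
    let ?c = "fm_code S_atom_code (Atom b)"
    obtain m where "f K ?c = fm_step g K ?c m" using step by blast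
    then show ?case
      using represents_atom_step[OF h', of b K] Atom less_pr(3)[of "S_atom_code b" 0]
      by (simp add: fm_step_def g_def)
  next
    case (Neg p)
    let ?c = "fm_code S_atom_code (Neg p)"
    have lt: "fm_code S_atom_code p < ?c" using less_pr(1)[of "fm_code S_atom_code p" 0] by simp
    obtain m where m: "f K ?c = fm_step g K ?c m" "\<forall>y<?c. app m y = f K y" using step by blast
    have "f K ?c = negd (f K (fm_code S_atom_code p))"
      using m lt by (simp add: fm_step_def)
    then show ?case using represents_neg Neg lt by simp
  next
    case (Conj p q)
    let ?c = "fm_code S_atom_code (Conj p q)"
    have lt: "fm_code S_atom_code p < ?c" "fm_code S_atom_code q < ?c"
      using less_pr(1)[of "pair (fm_code S_atom_code p) (fm_code S_atom_code q)" 1]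
        less_pr(2)[of "fm_code S_atom_code p" "fm_code S_atom_code q"]
        less_pr(3)[of "fm_code S_atom_code q" "fm_code S_atom_code p"] by (auto simp: numeral_2_eq_2)
    obtain m where m: "f K ?c = fm_step g K ?c m" "\<forall>y<?c. app m y = f K y" using step by blast
    have "f K ?c = conjd (2 ^ (3 * K)) (f K (fm_code S_atom_code p)) (f K (fm_code S_atom_code q))"
      using m lt by (simp add: fm_step_def)
    then show ?case using represents_conj Conj lt by simp
  next
    case (Ex i p)
    let ?c = "fm_code S_atom_code (Ex i p)"
    have lt: "fm_code S_atom_code p < ?c" "i < ?c"
      using less_pr(1)[of "pair i (fm_code S_atom_code p)" 2]
        less_pr(2)[of i "fm_code S_atom_code p"]
        less_pr(3)[of "fm_code S_atom_code p" i] by (auto simp: numeral_3_eq_3)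
    obtain m where m: "f K ?c = fm_step g K ?c m" "\<forall>y<?c. app m y = f K y" using step by blast
    have "f K ?c = exrd K (2 * i) (f K (fm_code S_atom_code p))"
      using m lt by (simp add: fm_step_def)
    moreover have "(\<lambda>j. (e(2 * i := x)) (2 * j)) = (\<lambda>j. e (2 * j))(i := x)"
      for e :: "nat \<Rightarrow> real" and x by auto
    ultimately show ?case
      using represents_ex[OF _ Ex.IH, of "2 * i"] Ex.prems lt by simp
  qed
  with f show ?thesis by blast
qed

section \<open>Recognising sentences\<close>

text \<open>The functions below return \<open>0\<close> for numbers that are not codes, and otherwise \<open>2\<close> or \<open>1\<close>
  according to whether the variable \<open>i\<close> occurs (freely) or not.\<close>

definition join :: "nat \<Rightarrow> nat \<Rightarrow> nat" where
  "join a b = (if a = 0 \<or> b = 0 then 0 else if a = 2 \<or> b = 2 then 2 else 1)"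

lemma computable_join [computable_intros]: "computable A \<Longrightarrow> computable B \<Longrightarrow> computable
  (\<lambda>n. join (A n) (B n))"
  unfolding join_def by (intro computable_intros)

definition tm_occ_step :: "nat \<Rightarrow> nat \<Rightarrow> nat \<Rightarrow> nat" where
  "tm_occ_step i x m =
    (if pfst x = 0 then if psnd x = i then 2 else 1
     else if pfst x = 1 then join (app m (pfst (psnd x))) (app m (psnd (psnd x)))
     else if pfst x = 2 then app m (psnd x) else 0)"

lemma pair_cases:
  obtains k r where "x = pair k r"
  by (metis prod.collapse prod_decode_inverse)

lemma ex_tm_occ:
  "\<exists>f. computable2 f \<and> (\<forall>i t. f i (S_tm_code t) = (if i \<in> S_tm_vars t then 2 else 1)) \<and>
    (\<forall>i x. f i x \<noteq> 0 \<longrightarrow> x \<in> range S_tm_code)"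
proof -
  have "computable (\<lambda>z. tm_occ_step (pfst z) (pfst (psnd z)) (psnd (psnd z)))"
    unfolding tm_occ_step_def by (intro computable_intros)
  then obtain f where f: "computable2 f"
    and step: "\<And>i x. \<exists>m. f i x = tm_occ_step i x m \<and> (\<forall>y<x. app m y = f i y)"
    using course_of_values by blast
  have eqs: "f i (pair 0 j) = (if j = i then 2 else 1)"
    "f i (pair 1 (pair a b)) = join (f i a) (f i b)" "f i (pair 2 a) = f i a"
    "k \<notin> {0, 1, 2} \<Longrightarrow> f i (pair k a) = 0" for i j a b k
    using step[of i "pair 0 j"] step[of i "pair 1 (pair a b)"] step[of i "pair 2 a"]
      step[of i "pair k a"]
      less_pr(1)[of "pair a b" 0] less_pr(2,3)[of a b] less_pr(3)[of b a] less_pr(1)[of a 1]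
    by (auto simp: tm_occ_step_def numeral_2_eq_2)
  have "f i (S_tm_code t) = (if i \<in> S_tm_vars t then 2 else 1)" for i t
    by (induction t) (auto simp: eqs[simplified] join_def)
  moreover have "x \<in> range S_tm_code" if "f i x \<noteq> 0" for i x
    using that
  proof (induction x rule: less_induct)
    case (less x)
    obtain k r where x: "x = pair k r" by (rule pair_cases)
    obtain a b where r: "r = pair a b" by (rule pair_cases)
    consider "k = 0" | "k = 1" | "k = 2" | "k \<notin> {0, 1, 2}" by blast
    then show ?case
    proof cases
      case 1
      then show ?thesis using x by (auto intro: range_eqI[of _ _ "SVar r"])
    next
      case 2
      then have "f i a \<noteq> 0" "f i b \<noteq> 0" using less.prems x r eqs by
        (auto simp: join_def split: if_splits)
      moreover have "a < x" "b < x"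
        using less_pr(1)[of "pair a b" 0] less_pr(2,3)[of a b] less_pr(3)[of b a] 2 x r by auto
      ultimately obtain s t where "a = S_tm_code s" "b = S_tm_code t" using less.IH by blast
      then show ?thesis using x r 2 by (auto intro: range_eqI[of _ _ "SAdd s t"])
    next
      case 3
      then have "f i r \<noteq> 0" using less.prems x eqs by simp
      moreover have "r < x" using less_pr(1)[of r 1] 3 x by (simp add: numeral_2_eq_2)
      ultimately obtain s where "r = S_tm_code s" using less.IH by blast
      then show ?thesis using x 3 by (auto intro: range_eqI[of _ _ "SScale s"])
    next
      case 4
      then show ?thesis using less.prems x eqs(4) by simp
    qed
  qed
  ultimately show ?thesis using f by blast
qed

lemma ex_atom_occ:
  "\<exists>f. computable2 f \<and> (\<forall>i b. f i (S_atom_code b) = (if i \<in> S_vars b then 2 else 1)) \<and>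
    (\<forall>i x. f i x \<noteq> 0 \<longrightarrow> x \<in> range S_atom_code)"
proof -
  obtain h where h: "computable2 h" "\<And>i t. h i (S_tm_code t) = (if i \<in> S_tm_vars t then 2 else 1)"
    "\<And>i x. h i x \<noteq> 0 \<Longrightarrow> x \<in> range S_tm_code"
    using ex_tm_occ by blast
  define f where "f i x = (if pfst x = 0 \<or> pfst x = 1 then join (h i (pfst (psnd x)))
    (h i (psnd (psnd x)))
    else if pfst x = 2 then h i (psnd x) else 0)" for i x
  have "computable2 f"
    unfolding computable2_def f_def by (intro computable_intros computable2D[OF h(1)])
  moreover have "f i (S_atom_code b) = (if i \<in> S_vars b then 2 else 1)" for i b
    by (cases b) (auto simp: f_def h(2) join_def)
  moreover have "x \<in> range S_atom_code" if nz: "f i x \<noteq> 0" for i x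
  proof -
    obtain k r where x: "x = pair k r" by (rule pair_cases)
    obtain a b where r: "r = pair a b" by (rule pair_cases)
    consider "k = 0 \<or> k = 1" | "k = 2" | "k \<notin> {0, 1, 2}" by blast
    then show ?thesis
    proof cases
      case 1
      then have "h i a \<noteq> 0" "h i b \<noteq> 0" using nz x r by (auto simp: f_def join_def split: if_splits)
      then obtain s t where "a = S_tm_code s" "b = S_tm_code t" using h(3) by blast
      then show ?thesis
        using x r 1 by (auto intro: range_eqI[of _ _ "SEq s t"] range_eqI[of _ _ "SLess s t"])
    next
      case 2
      then obtain s where "r = S_tm_code s" using h(3)[of i r] nz x by (auto simp: f_def)
      then show ?thesis using x 2 by (auto intro: range_eqI[of _ _ "SInt s"])
    next
      case 3
      then show ?thesis using nz x by (simp add: f_def)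
    qed
  qed
  ultimately show ?thesis by blast
qed

definition fm_occ_step :: "(nat \<Rightarrow> nat \<Rightarrow> nat) \<Rightarrow> nat \<Rightarrow> nat \<Rightarrow> nat \<Rightarrow> nat" where
  "fm_occ_step g i x m =
    (if pfst x = 0 then g i (psnd x)
     else if pfst x = 1 then app m (psnd x)
     else if pfst x = 2 then join (app m (pfst (psnd x))) (app m (psnd (psnd x)))
     else if pfst x = 3 then
       if i = pfst (psnd x) \<and> app m (psnd (psnd x)) \<noteq> 0 then 1 else app m (psnd (psnd x))
     else 0)"

lemma ex_fm_occ:
  "\<exists>f. computable2 f \<and> (\<forall>i p. f i (fm_code S_atom_code p) = (if i \<in> fv S_vars p then 2 else 1)) \<and>
    (\<forall>i x. f i x \<noteq> 0 \<longrightarrow> x \<in> range (fm_code S_atom_code))"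
proof -
  obtain g where g: "computable2 g" "\<And>i b. g i (S_atom_code b) = (if i \<in> S_vars b then 2 else 1)"
    "\<And>i x. g i x \<noteq> 0 \<Longrightarrow> x \<in> range S_atom_code"
    using ex_atom_occ by blast
  have "computable (\<lambda>z. fm_occ_step g (pfst z) (pfst (psnd z)) (psnd (psnd z)))"
    unfolding fm_occ_step_def by (intro computable_intros computable2D[OF g(1)])
  then obtain f where f: "computable2 f"
    and step: "\<And>i x. \<exists>m. f i x = fm_occ_step g i x m \<and> (\<forall>y<x. app m y = f i y)"
    using course_of_values by blast
  have eqs: "f i (pair 0 a) = g i a" "f i (pair 1 a) = f i a"
    "f i (pair 2 (pair a b)) = join (f i a) (f i b)"
    "f i (pair 3 (pair a b)) = (if i = a \<and> f i b \<noteq> 0 then 1 else f i b)"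
    "k \<notin> {0, 1, 2, 3} \<Longrightarrow> f i (pair k a) = 0" for i a b k
    using step[of i "pair 0 a"] step[of i "pair 1 a"] step[of i "pair 2 (pair a b)"]
      step[of i "pair 3 (pair a b)"]
      step[of i "pair k a"] less_pr(1)[of "pair a b" 1] less_pr(1)[of "pair a b" 2] less_pr(2,3)[of a b]
      less_pr(3)[of b a] less_pr(1)[of a 0]
    by (auto simp: fm_occ_step_def numeral_2_eq_2 numeral_3_eq_3)
  have "f i (fm_code S_atom_code p) = (if i \<in> fv S_vars p then 2 else 1)" for i p
    by (induction p) (auto simp: eqs[simplified] join_def g(2))
  moreover have "x \<in> range (fm_code S_atom_code)" if "f i x \<noteq> 0" for i x
    using that
  proof (induction x rule: less_induct)
    case (less x)
    obtain k r where x: "x = pair k r" by (rule pair_cases)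
    obtain a b where r: "r = pair a b" by (rule pair_cases)
    have le: "a \<le> r" "b \<le> r" using r less_pr(2,3) by simp_all
    consider "k = 0" | "k = 1" | "k = 2" | "k = 3" | "k \<notin> {0, 1, 2, 3}" by blast
    then show ?case
    proof cases
      case 1
      then obtain c where "r = S_atom_code c" using less.prems x eqs(1) g(3)[of i r] by auto
      then show ?thesis using x 1 by (auto intro: range_eqI[of _ _ "Atom c"])
    next
      case 2
      then have "f i r \<noteq> 0" "r < x" using less.prems x eqs less_pr(1)[of r 0] by auto
      then obtain p where "r = fm_code S_atom_code p" using less.IH by blast
      then show ?thesis using x 2 by (auto intro: range_eqI[of _ _ "Neg p"])
    next
      case 3
      then have "f i a \<noteq> 0" "f i b \<noteq> 0" using less.prems x r eqs by
        (auto simp: join_def split: if_splits)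
      moreover have "a < x" "b < x"
        using less_pr(1)[of r 1] le 3 x by (auto simp: numeral_2_eq_2)
      ultimately obtain p q where "a = fm_code S_atom_code p" "b = fm_code S_atom_code q"
        using less.IH by blast
      then show ?thesis using x r 3 by (auto intro: range_eqI[of _ _ "Conj p q"])
    next
      case 4
      then have "f i b \<noteq> 0" using less.prems x r eqs by (auto split: if_splits)
      moreover have "b < x" using less_pr(1)[of r 2] le 4 x by (auto simp: numeral_3_eq_3)
      ultimately obtain p where "b = fm_code S_atom_code p" using less.IH by blast
      then show ?thesis using x r 4 by (auto intro: range_eqI[of _ _ "Ex a p"])
    next
      case 5
      then show ?thesis using less.prems x eqs(5) by simp
    qed
  qed
  ultimately show ?thesis using f by blast
qed

lemma S_tm_vars_le_code: "i \<in> S_tm_vars t \<Longrightarrow> i \<le> S_tm_code t"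
proof (induction t)
  case (SAdd s t)
  then show ?case
    using less_pr(3)[of "pair (S_tm_code s) (S_tm_code t)" 1] less_pr(2)[of "S_tm_code s" "S_tm_code t"]
      less_pr(3)[of "S_tm_code t" "S_tm_code s"] by (auto simp del: One_nat_def)
next
  case (SScale t)
  then show ?case using less_pr(3)[of "S_tm_code t" 2] by auto
qed (simp add: le_prod_encode_2)

lemma S_vars_le_code: "i \<in> S_vars b \<Longrightarrow> i \<le> S_atom_code b"
proof -
  have *: "S_tm_code s \<le> pair k (pair (S_tm_code s) (S_tm_code t))"
    "S_tm_code t \<le> pair k (pair (S_tm_code s) (S_tm_code t))"
    "S_tm_code s \<le> pair k (S_tm_code s)" for k s t
    using less_pr(2,3) order_trans by blast+
  show "i \<in> S_vars b \<Longrightarrow> ?thesis"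
    by (cases b) (use * in \<open>auto dest!: S_tm_vars_le_code intro: order_trans\<close>)
qed

text \<open>This bounds the variables to be tested, so that being a sentence becomes a bounded,
  hence decidable, condition on the code.\<close>

lemma fv_le_code: "i \<in> fv S_vars p \<Longrightarrow> i \<le> fm_code S_atom_code p"
proof (induction p)
  case (Conj p q)
  then show ?case
    using less_pr(3)[of "pair (fm_code S_atom_code p) (fm_code S_atom_code q)" 2]
      less_pr(2)[of "fm_code S_atom_code p" "fm_code S_atom_code q"]
      less_pr(3)[of "fm_code S_atom_code q" "fm_code S_atom_code p"] by auto
next
  case (Atom b)
  then show ?case using S_vars_le_code[of i b] less_pr(3)[of "S_atom_code b" 0] by auto
next
  case (Neg p)
  then show ?case using less_pr(3)[of "fm_code S_atom_code p" 1] by auto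
next
  case (Ex j p)
  then show ?case
    using less_pr(3)[of "pair j (fm_code S_atom_code p)" 3] less_pr(3)[of "fm_code S_atom_code p" j]
      by auto
qed

section \<open>Decidability\<close>

lemma S_tm_val_cong: "(\<And>i. i \<in> S_tm_vars t \<Longrightarrow> e i = e' i) \<Longrightarrow> S_tm_val a e t = S_tm_val a e' t"
  by (induction t) auto

lemma sat_cong: "(\<And>i. i \<in> fv S_vars p \<Longrightarrow> e i = e' i) \<Longrightarrow> sat (S_struct a) e p \<longleftrightarrow> sat (S_struct a) e' p"
proof (induction p arbitrary: e e')
  case (Atom b)
  then show ?case
    by (cases b) (auto simp: S_tm_val_cong[of _ e e'])
next
  case (Conj p q)
  have "sat (S_struct a) e p \<longleftrightarrow> sat (S_struct a) e' p" "sat (S_struct a) e q \<longleftrightarrow> sat (S_struct a) e' q"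
    by (rule Conj.IH; use Conj.prems in simp)+
  then show ?case by simp
next
  case (Neg p)
  have "sat (S_struct a) e p \<longleftrightarrow> sat (S_struct a) e' p"
    by (rule Neg.IH; use Neg.prems in simp)
  then show ?case by simp
next
  case (Ex i p)
  have "sat (S_struct a) (e(i := x)) p \<longleftrightarrow> sat (S_struct a) (e'(i := x)) p" for x
    by (rule Ex.IH) (use Ex.prems in auto)
  then show ?case by simp
qed

text \<open>The value of the word of \<open>Suc k\<close> zeros, multiplied up one letter at a
  time.\<close>

definition zero_power :: "nat \<Rightarrow> nat \<Rightarrow> nat" where
  "zero_power d k = rec_nat (letD d 0) (\<lambda>_ r. mulD d r (letD d 0)) k"

text \<open>The constant zero word is proper and represents 0 at every variable. Cut into blocks of
  \<open>Suc k\<close> zeros it has the linked pair \<open>(x, x)\<close> as soon as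
  \<open>x = zero_power d k\<close> is idempotent, and Ramsey's theorem supplies such a
  \<open>k\<close>. A sentence can be evaluated at this one assignment.\<close>

lemma represents_zero:
  assumes "represents K d \<Phi>"
  shows "\<exists>k. mulD d (zero_power d k) (zero_power d k) = zero_power d k"
    and "mulD d (zero_power d k) (zero_power d k) = zero_power d k \<Longrightarrow> accD d (zero_power d k)
      (zero_power d k) \<longleftrightarrow> \<Phi> (\<lambda>_. 0)"
proof -
  let ?L = "2 ^ (3 * K) :: nat" and ?w = "\<lambda>_::nat. 0::nat"
  obtain A where A: "recog ?L d A" and A': "\<And>w. (\<And>n. w n < ?L) \<Longrightarrow> (\<And>i. i < K \<Longrightarrow> proper i w) \<Longrightarrow>
      w \<in> A \<longleftrightarrow> \<Phi> (\<lambda>i. tval i w)"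
    using assms by (rule representsE) blast
  have R: "recognizes ?L (val d) (mulD d) (accD d) A" using A by (simp add: recog_def)
  have seg: "seg ?w i j = replicate (j - i) 0" for i j
    by (simp add: seg_def map_replicate_const)
  have val: "val d (replicate (Suc k) 0) = zero_power d k" for k
  proof (induction k)
    case (Suc k)
    have "replicate (Suc (Suc k)) (0::nat) = replicate (Suc k) 0 @ [0]"
      by (metis replicate_Suc replicate_append_same)
    moreover have "val d (replicate (Suc k) 0 @ [0]) = mulD d (val d (replicate (Suc k) 0)) (val d [0])"
      by (rule recognizesD(2)[OF R]) (auto simp: words_def)
    ultimately have "val d (replicate (Suc (Suc k)) 0) = mulD d (zero_power d k) (letD d 0)"
      by (simp only: Suc val.simps)
    then show ?case by (simp only: zero_power_def nat.rec(2))
  qed (simp add: zero_power_def)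
  obtain h s e where h: "strict_mono h" and fac: "factors (val d) ?w (Suc \<circ> h) s e" and ee:
    "mulD d e e = e"
    by (rule ramsey_factors[OF R, of ?w Suc]) (auto simp: strict_mono_def)
  have "e = val d (replicate (h 1 - h 0) 0)" using fac by (simp add: factors_def seg)
  moreover have "h 1 - h 0 = Suc (h 1 - h 0 - 1)" using strict_monoD[OF h, of 0 1] by simp
  ultimately have "e = zero_power d (h 1 - h 0 - 1)" using val by metis
  with ee show "\<exists>k. mulD d (zero_power d k) (zero_power d k) = zero_power d k" by blast
  assume idem: "mulD d (zero_power d k) (zero_power d k) = zero_power d k"
  have "factors (val d) ?w (\<lambda>i. Suc k * Suc i) (zero_power d k) (zero_power d k)"
    unfolding factors_def seg using val[of k] by (auto simp: strict_mono_def add_less_le_mono)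
  then have "?w \<in> A \<longleftrightarrow> accD d (zero_power d k) (zero_power d k)"
    by (intro recognizesD(3)[OF R] idem) auto
  moreover have "?w \<in> A \<longleftrightarrow> \<Phi> (\<lambda>_. 0)"
    using A'[of ?w] by (simp add: proper_def bits_def tval_def rep_def)
  ultimately show "accD d (zero_power d k) (zero_power d k) \<longleftrightarrow> \<Phi> (\<lambda>_. 0)" by simp
qed

lemma decidable_golden_theory: "decidable_theory S_atom_code (theory_of S_vars (S_struct \<phi>))"
proof -
  let ?c = "fm_code S_atom_code"
  let ?T = "?c ` theory_of S_vars (S_struct \<phi>)"
  obtain f where f: "computable2 f" and f': "\<And>K p. 2 * ?c p + 1 < K \<Longrightarrow>
      represents K (f K (?c p)) (\<lambda>e. sat (S_struct \<phi>) (\<lambda>i. e (2 * i)) p)"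
    using ex_fm_data by blast
  obtain g where g: "computable2 g" "\<And>i p. g i (?c p) = (if i \<in> fv S_vars p then 2 else 1)"
    "\<And>i x. g i x \<noteq> 0 \<Longrightarrow> x \<in> range ?c"
    using ex_fm_occ by blast
  define D where "D m = f (2 * m + 2) m" for m
  define sentence where "sentence m \<longleftrightarrow> (\<forall>i<Suc m. g i m = 1)" for m
  \<comment> \<open>An idempotent power is guaranteed only for codes of sentences; the first
    disjunct keeps the search total.\<close>
  define exponent where "exponent m = (LEAST k. \<not> sentence m \<or>
    mulD (D m) (zero_power (D m) k) (zero_power (D m) k) = zero_power (D m) k)" for m
  define decide where "decide m \<longleftrightarrow> sentence m \<and>
    accD (D m) (zero_power (D m) (exponent m)) (zero_power (D m) (exponent m))" for m
  have sentence: "sentence m \<longleftrightarrow> (\<exists>p. m = ?c p \<and> fv S_vars p = {})" for m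
  proof
    assume *: "sentence m"
    then have "g 0 m \<noteq> 0" by (simp add: sentence_def)
    then obtain p where p: "m = ?c p" using g(3) by blast
    have "i \<notin> fv S_vars p" for i
      using * g(2)[of i p] fv_le_code[of i p] p by (auto simp: sentence_def less_Suc_eq_le)
    then show "\<exists>p. m = ?c p \<and> fv S_vars p = {}" using p by blast
  qed (auto simp: sentence_def g(2))
  have D: "represents (2 * ?c p + 2) (D (?c p)) (\<lambda>e. sat (S_struct \<phi>) (\<lambda>i. e (2 * i)) p)" for p
    unfolding D_def by (rule f') simp
  have total: "\<exists>k. \<not> sentence m \<or> mulD (D m) (zero_power (D m) k) (zero_power (D m) k) = zero_power
    (D m) k" for m
    using represents_zero(1)[OF D] sentence by metis
  have "decide m \<longleftrightarrow> m \<in> ?T" for m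
  proof
    assume m: "decide m"
    then obtain p where p: "m = ?c p" "fv S_vars p = {}" by (auto simp: decide_def sentence)
    have "mulD (D m) (zero_power (D m) (exponent m)) (zero_power (D m) (exponent m)) = zero_power
      (D m) (exponent m)"
      using LeastI_ex[OF total[of m]] m by (simp add: exponent_def decide_def)
    from represents_zero(2)[OF D[of p], folded p(1), OF this] have "sat (S_struct \<phi>) (\<lambda>_. 0) p"
      using m by (simp add: decide_def)
    then have "sat (S_struct \<phi>) e p" for e
      using sat_cong[of p "\<lambda>_. 0" e] p(2) by simp
    then show "m \<in> ?T" using p by (auto simp: theory_of_def)
  next
    assume "m \<in> ?T"
    then obtain p where p: "m = ?c p" "fv S_vars p = {}" "\<And>e. sat (S_struct \<phi>) e p"
      by (auto simp: theory_of_def)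
    then have s: "sentence m" using sentence by blast
    have "mulD (D m) (zero_power (D m) (exponent m)) (zero_power (D m) (exponent m)) = zero_power
      (D m) (exponent m)"
      using LeastI_ex[OF total[of m]] s by (simp add: exponent_def)
    from represents_zero(2)[OF D[of p], folded p(1), OF this] show "decide m"
      using p(3) s by (simp add: decide_def)
  qed
  moreover have "decidable decide"
  proof -
    have D': "computable D" unfolding D_def by (intro computable2D[OF f] computable_intros)
    have s: "decidable sentence" unfolding sentence_def by
      (intro computable_intros computable2D[OF g(1)])
    have p: "computable (\<lambda>n. zero_power (A n) (B n))" if "computable A" "computable B" for A B
      unfolding zero_power_def by (intro computable_intros that computable_comp[OF that(1)])
    have e: "computable exponent"
      unfolding exponent_def
      by (intro computable_Least total computable_intros p computable_comp[OF D'] decidable_comp[OF s])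
    show ?thesis
      unfolding decide_def by (intro computable_intros p e s D')
  qed
  ultimately have "computable (\<lambda>m. of_bool (m \<in> ?T))" by (simp add: decidable_def)
  then obtain F where F: "recursive 1 F" "\<And>xs. length xs = 1 \<Longrightarrow> F xs = of_bool (xs ! 0 \<in> ?T)"
    unfolding computable_def recn_def by blast
  then have "F [m] = (if m \<in> ?T then 1 else 0)" for m by simp
  then show ?thesis
    unfolding decidable_theory_def decidable_nat_set_def using F(1) by blast
qed

section \<open>Definable predicates\<close>

text \<open>The parameters of a predicate are \<open>e 0, \<dots>, e (n - 1)\<close>, and a quantifier shifts them as in de
  Bruijn notation. Quantifying over the renaming \<open>\<sigma>\<close> makes substitution of variables trivial.\<close>

definition definable :: "nat \<Rightarrow> ((nat \<Rightarrow> real) \<Rightarrow> bool) \<Rightarrow> bool" where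
  "definable n P \<longleftrightarrow> (\<forall>e e'. (\<forall>i<n. e i = e' i) \<longrightarrow> P e = P e') \<and>
     (\<forall>\<sigma>. \<exists>p. fv R_vars p \<subseteq> \<sigma> ` {..<n} \<and> (\<forall>e. sat (R_struct \<phi>) e p \<longleftrightarrow> P (\<lambda>i. e (\<sigma> i))))"

named_theorems definable_intros

lemma definableI:
  assumes "\<And>e e'. (\<And>i. i < n \<Longrightarrow> e i = e' i) \<Longrightarrow> P e = P e'"
    and "\<And>\<sigma>. \<exists>p. fv R_vars p \<subseteq> \<sigma> ` {..<n} \<and> (\<forall>e. sat (R_struct \<phi>) e p \<longleftrightarrow> P (\<lambda>i. e (\<sigma> i)))"
  shows "definable n P"
  using assms unfolding definable_def by blast

lemma definableD:
  assumes "definable n P"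
  shows "(\<And>i. i < n \<Longrightarrow> e i = e' i) \<Longrightarrow> P e = P e'"
    and "\<exists>p. fv R_vars p \<subseteq> \<sigma> ` {..<n} \<and> (\<forall>e. sat (R_struct \<phi>) e p \<longleftrightarrow> P (\<lambda>i. e (\<sigma> i)))"
  using assms unfolding definable_def by blast+

lemma definable_atomI:
  assumes "\<And>e e'. (\<And>i. i < n \<Longrightarrow> e i = e' i) \<Longrightarrow> P e = P e'"
    and "\<And>\<sigma>. R_vars (a \<sigma>) \<subseteq> \<sigma> ` {..<n}" and "\<And>\<sigma> e. R_struct \<phi> e (a \<sigma>) \<longleftrightarrow> P (\<lambda>i. e (\<sigma> i))"
  shows "definable n P"
  by (rule definableI, rule assms(1), assumption) (metis assms(2,3) fv.simps(1) sat.simps(1))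

lemma definable_eq_var: "i < n \<Longrightarrow> j < n \<Longrightarrow> definable n (\<lambda>e. e i = e j)"
  by (rule definable_atomI[where a = "\<lambda>\<sigma>. REq (RVar (\<sigma> i)) (RVar (\<sigma> j))"]) auto

lemma definable_add_var: "i < n \<Longrightarrow> j < n \<Longrightarrow> k < n \<Longrightarrow> definable n (\<lambda>e. e i = e j + e k)"
  by (rule definable_atomI[where a = "\<lambda>\<sigma>. REq (RVar (\<sigma> i)) (RAdd (RVar (\<sigma> j)) (RVar (\<sigma> k)))"]) auto

lemma definable_less_var: "i < n \<Longrightarrow> j < n \<Longrightarrow> definable n (\<lambda>e. e i < e j)"
  by (rule definable_atomI[where a = "\<lambda>\<sigma>. RLess (RVar (\<sigma> i)) (RVar (\<sigma> j))"]) auto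

lemma definable_int_var: "i < n \<Longrightarrow> definable n (\<lambda>e. e i \<in> \<int>)"
  by (rule definable_atomI[where a = "\<lambda>\<sigma>. RInt (RVar (\<sigma> i))"]) auto

definition zphi :: "real set" where "zphi = {of_int z * \<phi> | z. True}"

lemma definable_zphi_var: "i < n \<Longrightarrow> definable n (\<lambda>e. e i \<in> zphi)"
  unfolding zphi_def
  by (rule definable_atomI[where a = "\<lambda>\<sigma>. RMult (RVar (\<sigma> i))"]) auto

lemma definable_not [definable_intros]:
  assumes "definable n P"
  shows "definable n (\<lambda>e. \<not> P e)"
proof (rule definableI)
  show "(\<not> P e) = (\<not> P e')" if "\<And>i. i < n \<Longrightarrow> e i = e' i" for e e'
    using definableD(1)[OF assms that] by simp
  fix \<sigma>
  obtain p where "fv R_vars p \<subseteq> \<sigma> ` {..<n}" "\<forall>e. sat (R_struct \<phi>) e p \<longleftrightarrow> P (\<lambda>i. e (\<sigma> i))"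
    using definableD(2)[OF assms] by blast
  then show "\<exists>p. fv R_vars p \<subseteq> \<sigma> ` {..<n} \<and> (\<forall>e. sat (R_struct \<phi>) e p \<longleftrightarrow> \<not> P (\<lambda>i. e (\<sigma> i)))"
    by (intro exI[of _ "Neg p"]) simp
qed

lemma definable_conj [definable_intros]:
  assumes "definable n P" "definable n Q"
  shows "definable n (\<lambda>e. P e \<and> Q e)"
proof (rule definableI)
  show "(P e \<and> Q e) = (P e' \<and> Q e')" if "\<And>i. i < n \<Longrightarrow> e i = e' i" for e e'
    using definableD(1)[OF assms(1) that] definableD(1)[OF assms(2) that] by simp
  fix \<sigma>
  obtain p q where "fv R_vars p \<subseteq> \<sigma> ` {..<n}" "\<forall>e. sat (R_struct \<phi>) e p \<longleftrightarrow> P (\<lambda>i. e (\<sigma> i))"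
    "fv R_vars q \<subseteq> \<sigma> ` {..<n}" "\<forall>e. sat (R_struct \<phi>) e q \<longleftrightarrow> Q (\<lambda>i. e (\<sigma> i))"
    using definableD(2)[OF assms(1)] definableD(2)[OF assms(2)] by blast
  then show "\<exists>p. fv R_vars p \<subseteq> \<sigma> ` {..<n} \<and>
      (\<forall>e. sat (R_struct \<phi>) e p \<longleftrightarrow> P (\<lambda>i. e (\<sigma> i)) \<and> Q (\<lambda>i. e (\<sigma> i)))"
    by (intro exI[of _ "Conj p q"]) simp
qed

lemma definable_ex [definable_intros]:
  assumes Q: "definable (Suc n) (\<lambda>e. Q (\<lambda>i. e (Suc i)) (e 0))"
  shows "definable n (\<lambda>e. \<exists>x. Q e x)"
proof (rule definableI)
  have local: "Q e x = Q e' x" if "\<And>i. i < n \<Longrightarrow> e i = e' i" for e e' x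
    using definableD(1)[OF Q, of "case_nat x e" "case_nat x e'"] that by (auto split: nat.split)
  then show "(\<exists>x. Q e x) = (\<exists>x. Q e' x)" if "\<And>i. i < n \<Longrightarrow> e i = e' i" for e e'
    using that by blast
  fix \<sigma> :: "nat \<Rightarrow> nat"
  \<comment> \<open>A bound variable outside the image of \<sigma> avoids capture; the assumption on
    \<open>Q\<close> is then applied to \<sigma> extended by it.\<close>
  obtain k where k: "k \<notin> \<sigma> ` {..<n}"
    using ex_new_if_finite[of "\<sigma> ` {..<n}"] by auto
  obtain p where p: "fv R_vars p \<subseteq> case_nat k \<sigma> ` {..<Suc n}"
    "\<And>e. sat (R_struct \<phi>) e p \<longleftrightarrow> Q (\<lambda>i. e (\<sigma> i)) (e k)"
    using definableD(2)[OF Q, of "case_nat k \<sigma>"] by auto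
  have "fv R_vars (Ex k p) \<subseteq> \<sigma> ` {..<n}"
    using p(1) by (auto simp: lessThan_Suc_eq_insert_0 image_image)
  moreover have "sat (R_struct \<phi>) e (Ex k p) \<longleftrightarrow> (\<exists>x. Q (\<lambda>i. e (\<sigma> i)) x)" for e
  proof -
    have "Q (\<lambda>i. (e(k := x)) (\<sigma> i)) x = Q (\<lambda>i. e (\<sigma> i)) x" for x
      by (rule local) (use k in auto)
    then show ?thesis by (simp add: p(2) del: fun_upd_apply) simp
  qed
  ultimately show "\<exists>p. fv R_vars p \<subseteq> \<sigma> ` {..<n} \<and>
      (\<forall>e. sat (R_struct \<phi>) e p \<longleftrightarrow> (\<exists>x. Q (\<lambda>i. e (\<sigma> i)) x))"
    by blast
qed

lemma definable_disj [definable_intros]: "definable n P \<Longrightarrow> definable n Q \<Longrightarrow> definable n (\<lambda>e. P e \<or> Q e)"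
  using definable_not[OF definable_conj[OF definable_not[of n P] definable_not[of n Q]]] by simp

lemma definable_imp [definable_intros]: "definable n P \<Longrightarrow> definable n Q \<Longrightarrow> definable n (\<lambda>e. P e \<longrightarrow> Q e)"
  unfolding imp_conv_disj by (intro definable_intros)

lemma definable_iff [definable_intros]: "definable n P \<Longrightarrow> definable n Q \<Longrightarrow> definable n (\<lambda>e. P e \<longleftrightarrow> Q e)"
  unfolding iff_conv_conj_imp by (intro definable_intros)

lemma definable_all [definable_intros]:
  assumes "definable (Suc n) (\<lambda>e. Q (\<lambda>i. e (Suc i)) (e 0))"
  shows "definable n (\<lambda>e. \<forall>x. Q e x)"
  using definable_not[OF definable_ex[of n "\<lambda>e x. \<not> Q e x"]] definable_not[OF assms] by simp

lemma definable_rename: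
  assumes P: "definable m P" and \<tau>: "\<And>k. k < m \<Longrightarrow> \<tau> k < n"
  shows "definable n (\<lambda>e. P (\<lambda>k. e (\<tau> k)))"
proof (rule definableI)
  show "P (\<lambda>k. e (\<tau> k)) = P (\<lambda>k. e' (\<tau> k))" if "\<And>i. i < n \<Longrightarrow> e i = e' i" for e e'
    by (rule definableD(1)[OF P]) (use that \<tau> in auto)
  fix \<sigma>
  show "\<exists>p. fv R_vars p \<subseteq> \<sigma> ` {..<n} \<and> (\<forall>e. sat (R_struct \<phi>) e p \<longleftrightarrow> P (\<lambda>k. e (\<sigma> (\<tau> k))))"
  proof -
    obtain p where p: "fv R_vars p \<subseteq> (\<lambda>k. \<sigma> (\<tau> k)) ` {..<m}"
      "\<forall>e. sat (R_struct \<phi>) e p \<longleftrightarrow> P (\<lambda>k. e (\<sigma> (\<tau> k)))"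
      using definableD(2)[OF P, of "\<lambda>k. \<sigma> (\<tau> k)"] by blast
    have "(\<lambda>k. \<sigma> (\<tau> k)) ` {..<m} \<subseteq> \<sigma> ` {..<n}" using \<tau> by auto
    with p show ?thesis by (intro exI[of _ p]) simp
  qed
qed

section \<open>Terms with definable graph\<close>

text \<open>The terms of the language are sums of variables. Asking only for a definable graph lets
  0, differences, absolute values and fixed integer multiples be used as terms too.\<close>

definition definable_term :: "nat \<Rightarrow> ((nat \<Rightarrow> real) \<Rightarrow> real) \<Rightarrow> bool" where
  "definable_term n u \<longleftrightarrow> definable (Suc n) (\<lambda>e. e 0 = u (\<lambda>i. e (Suc i)))"

lemma definable_term_var [definable_intros]: "i < n \<Longrightarrow> definable_term n (\<lambda>e. e i)"
  unfolding definable_term_def by (rule definable_eq_var) simp_all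

lemma definable_term_weaken: "definable_term n u \<Longrightarrow> definable_term (Suc n) (\<lambda>e. u (\<lambda>i. e (Suc i)))"
  unfolding definable_term_def
  by (drule definable_rename[where \<tau> = "case_nat 0 (\<lambda>i. Suc (Suc i))" and n = "Suc (Suc n)"])
    (auto split: nat.splits)

lemma definable_subst1:
  assumes R: "\<And>n i. i < n \<Longrightarrow> definable n (\<lambda>e. R (e i))" and u: "definable_term n u"
  shows "definable n (\<lambda>e. R (u e))"
proof -
  have "definable n (\<lambda>e. \<exists>x. x = u e \<and> R x)"
    by (intro definable_intros R u[unfolded definable_term_def]) simp
  then show ?thesis by simp
qed

lemma definable_subst2:
  assumes R: "\<And>n i j. i < n \<Longrightarrow> j < n \<Longrightarrow> definable n (\<lambda>e. R (e i) (e j))" and u: "definable_term n u"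
    and v: "definable_term n v"
  shows "definable n (\<lambda>e. R (u e) (v e))"
proof -
  have "definable n (\<lambda>e. \<exists>x. x = u e \<and> (\<exists>y. y = v e \<and> R x y))"
    by (intro definable_intros R u[unfolded definable_term_def]
      definable_term_weaken[OF v, unfolded definable_term_def]) simp_all
  then show ?thesis by simp
qed

lemma definable_atoms [definable_intros]:
  assumes "definable_term n u" "definable_term n v"
  shows "definable n (\<lambda>e. u e = v e)" "definable n (\<lambda>e. u e < v e)" "definable n (\<lambda>e. u e \<le> v e)"
proof -
  show 1: "definable n (\<lambda>e. u e = v e)" "definable n (\<lambda>e. u e < v e)"
    using definable_subst2[of "(=)"] definable_subst2[of "(<)"] definable_eq_var definable_less_var
      assms by blast+
  show "definable n (\<lambda>e. u e \<le> v e)"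
    unfolding le_less by (intro definable_disj 1)
qed

lemma definable_int [definable_intros]: "definable_term n u \<Longrightarrow> definable n (\<lambda>e. u e \<in> \<int>)"
  by (rule definable_subst1[of "\<lambda>x. x \<in> \<int>"]) (rule definable_int_var)

lemma definable_zphi [definable_intros]: "definable_term n u \<Longrightarrow> definable n (\<lambda>e. u e \<in> zphi)"
  by (rule definable_subst1[of "\<lambda>x. x \<in> zphi"]) (rule definable_zphi_var)

lemma definable_term_add [definable_intros]:
  assumes u: "definable_term n u" and v: "definable_term n v"
  shows "definable_term n (\<lambda>e. u e + v e)"
proof -
  have "definable (Suc n) (\<lambda>e. \<exists>x. x = u (\<lambda>i. e (Suc i)) \<and> (\<exists>y. y = v (\<lambda>i. e (Suc i)) \<and> e 0 = x + y))"
    by (intro definable_intros definable_add_var definable_term_weaken[OF u, unfolded definable_term_def]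
        definable_term_weaken[OF definable_term_weaken[OF v], unfolded definable_term_def]) simp_all
  then show ?thesis unfolding definable_term_def by simp
qed

lemma definable_term_diff [definable_intros]:
  assumes u: "definable_term n u" and v: "definable_term n v"
  shows "definable_term n (\<lambda>e. u e - v e)"
proof -
  have "definable (Suc n) (\<lambda>e. e 0 + v (\<lambda>i. e (Suc i)) = u (\<lambda>i. e (Suc i)))"
    by (intro definable_intros definable_term_weaken u v) simp
  then show ?thesis unfolding definable_term_def by (simp add: eq_diff_eq)
qed

lemma definable_term_zero [definable_intros]: "definable_term n (\<lambda>e. 0)"
proof -
  have "definable (Suc n) (\<lambda>e. e 0 + e 0 = e 0)" by (intro definable_intros) simp_all
  then show ?thesis unfolding definable_term_def by simp
qed

lemma definable_term_minus [definable_intros]: "definable_term n u \<Longrightarrow> definable_term n (\<lambda>e. - u e)"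
  using definable_term_diff[OF definable_term_zero, of n u] by simp

lemma definable_term_of_nat_mult: "definable_term n u \<Longrightarrow> definable_term n (\<lambda>e. real k * u e)"
proof (induction k)
  case 0
  show ?case using definable_term_zero[of n] by simp
next
  case (Suc k)
  then have "definable_term n (\<lambda>e. u e + real k * u e)" by (intro definable_term_add)
  then show ?case by (simp add: algebra_simps)
qed

lemma definable_term_of_int_mult [definable_intros]:
  assumes "definable_term n u"
  shows "definable_term n (\<lambda>e. of_int k * u e)"
  using definable_term_of_nat_mult[OF assms, of "nat k"]
    definable_term_minus[OF definable_term_of_nat_mult[OF assms, of "nat (- k)"]]
  by (cases "0 \<le> k") simp_all

lemma definable_term_abs [definable_intros]:
  assumes u: "definable_term n u"
  shows "definable_term n (\<lambda>e. \<bar>u e\<bar>)"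
proof -
  have "definable (Suc n) (\<lambda>e. 0 \<le> e 0 \<and> (e 0 = u (\<lambda>i. e (Suc i)) \<or> e 0 = - u (\<lambda>i. e (Suc i))))"
    by (intro definable_intros definable_term_weaken u) simp_all
  moreover have "0 \<le> x \<and> (x = y \<or> x = - y) \<longleftrightarrow> x = \<bar>y\<bar>" for x y :: real by auto
  ultimately show ?thesis unfolding definable_term_def by simp
qed

lemma definable_finite_ex:
  assumes "finite S" and "\<And>s. s \<in> S \<Longrightarrow> definable n (\<lambda>e. P s e)"
  shows "definable n (\<lambda>e. \<exists>s\<in>S. P s e)"
  using assms
proof (induction rule: finite_induct)
  case empty
  have "definable n (\<lambda>e. (0::real) < 0)" by (intro definable_intros)
  then show ?case by simp
next
  case (insert s S)
  then have "definable n (\<lambda>e. P s e \<or> (\<exists>s\<in>S. P s e))" by (intro definable_disj) auto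
  then show ?case by simp
qed

section \<open>Fibonacci numbers as best approximations\<close>

definition best :: "real \<Rightarrow> real \<Rightarrow> bool" where
  "best p y \<longleftrightarrow> p \<in> \<int> \<and> y \<in> zphi \<and> 0 < y \<and>
     (\<forall>p' y'. p' \<in> \<int> \<and> y' \<in> zphi \<and> 0 < y' \<and> y' \<le> y \<and> \<bar>p' - y'\<bar> \<le> \<bar>p - y\<bar> \<longrightarrow> p' = p \<and> y' = y)"

lemma definable_best [definable_intros]: "i < n \<Longrightarrow> j < n \<Longrightarrow> definable n (\<lambda>e. best (e i) (e j))"
  unfolding best_def by (intro definable_intros) simp_all

lemma abs_psi_power: "\<bar>\<psi> ^ k\<bar> = \<gamma> ^ k"
proof -
  have "\<bar>\<psi>\<bar> = \<gamma>" using golden_bounds by simp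
  then show ?thesis by (simp add: power_abs)
qed

lemma fib_approx: "real (fib (Suc k)) - real (fib k) * \<phi> = \<psi> ^ k"
  using golden_fib[of k] by (simp add: mult.commute)

text \<open>Two successive pairs of neighbouring Fibonacci numbers have determinant 1 or -1 and so
  form a basis of the integer pairs.\<close>

lemma fib_basis:
  fixes p q :: int
  shows "\<exists>a b. q = a * int (fib k) + b * int (fib (Suc k)) \<and>
    p = a * int (fib (Suc k)) + b * int (fib (Suc (Suc k)))"
proof (induction k)
  case 0
  show ?case by (intro exI[of _ "p - q"] exI[of _ q]) simp
next
  case (Suc k)
  then obtain a b where "q = a * int (fib k) + b * int (fib (Suc k))"
    "p = a * int (fib (Suc k)) + b * int (fib (Suc (Suc k)))" by blast
  then show ?case by (intro exI[of _ "b - a"] exI[of _ a]) (simp add: algebra_simps)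
qed

lemma fib_basis_error:
  fixes p q :: int
  assumes "q = a * int (fib k) + b * int (fib (Suc k))"
    and "p = a * int (fib (Suc k)) + b * int (fib (Suc (Suc k)))"
  shows "\<bar>of_int p - of_int q * \<phi>\<bar> = \<gamma> ^ k * \<bar>of_int a - of_int b * \<gamma>\<bar>"
proof -
  have "of_int p - of_int q * \<phi> = of_int a * (real (fib (Suc k)) - real (fib k) * \<phi>)
      + of_int b * (real (fib (Suc (Suc k))) - real (fib (Suc k)) * \<phi>)"
    unfolding assms by (simp add: algebra_simps)
  also have "\<dots> = \<psi> ^ k * (of_int a - of_int b * \<gamma>)"
    unfolding fib_approx by (simp add: algebra_simps)
  finally show ?thesis by (simp add: abs_mult abs_psi_power)
qed

text \<open>In the coordinates of \<open>fib_basis\<close> the error is \<open>\<gamma> ^ k\<close>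
  times the absolute value of \<open>a - b \<gamma>\<close>. If \<open>b\<close> were nonzero, the
  bounds on \<open>q\<close> would give \<open>a\<close> the opposite sign and make the second
  factor at least \<open>1 + \<gamma>\<close>.\<close>

lemma best_approximation:
  fixes p q :: int
  assumes q: "0 < q" "q < int (fib (Suc k))" and le: "\<bar>of_int p - of_int q * \<phi>\<bar> \<le> \<gamma> ^ k"
  shows "q = int (fib k) \<and> p = int (fib (Suc k))"
proof -
  obtain a b where ab: "q = a * int (fib k) + b * int (fib (Suc k))"
    "p = a * int (fib (Suc k)) + b * int (fib (Suc (Suc k)))"
    using fib_basis by blast
  have "\<gamma> ^ k * \<bar>of_int a - of_int b * \<gamma>\<bar> \<le> \<gamma> ^ k * 1"
    using le fib_basis_error[OF ab] by simp
  then have small: "\<bar>of_int a - of_int b * \<gamma>\<bar> \<le> 1"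
    using golden_bounds by (simp add: mult_le_cancel_left_pos)
  define c where "c = of_int b * \<gamma>"
  have c: "-1 \<le> of_int a - c" "of_int a - c \<le> 1" using small unfolding c_def abs_le_iff by simp_all
  have fk: "0 \<le> int (fib k)" by simp
  have "b = 0"
  proof (rule ccontr)
    assume "b \<noteq> 0"
    then consider "b \<ge> 1" | "b \<le> -1" by linarith
    then show False
    proof cases
      case 1
      then have "1 * int (fib (Suc k)) \<le> b * int (fib (Suc k))" by (intro mult_right_mono) auto
      then have "a * int (fib k) < 0" using ab(1) q(2) by linarith
      then have "a < 0" using fk by (simp add: mult_less_0_iff)
      then have "real_of_int a \<le> -1" by linarith
      moreover have "\<gamma> \<le> c"
        using mult_right_mono[of 1 "of_int b" \<gamma>] 1 golden_bounds by (simp add: c_def)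
      ultimately show False using c golden_bounds by linarith
    next
      case 2
      then have "b * int (fib (Suc k)) \<le> (-1) * int (fib (Suc k))" by (intro mult_right_mono) auto
      then have "0 < a * int (fib k)" using ab(1) q(1) by linarith
      then have "0 < a" using fk by (simp add: zero_less_mult_iff)
      then have "1 \<le> real_of_int a" by linarith
      moreover have "c \<le> - \<gamma>"
        using mult_right_mono[of "of_int b" "-1" \<gamma>] 2 golden_bounds by (simp add: c_def)
      ultimately show False using c golden_bounds by linarith
    qed
  qed
  then have "0 < a" using ab(1) q(1) fk by (simp add: zero_less_mult_iff)
  moreover have "real_of_int \<bar>a\<bar> \<le> 1" using small \<open>b = 0\<close> by simp
  ultimately have "a = 1" by linarith
  then show ?thesis using ab \<open>b = 0\<close> by simp
qed

lemma fib_less: "2 \<le> i \<Longrightarrow> i < j \<Longrightarrow> fib i < fib j"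
proof -
  assume "2 \<le> i" "i < j"
  obtain i' where "i = Suc i'" "0 < i'" using \<open>2 \<le> i\<close> by (cases i) auto
  then have "fib i < fib (Suc i)" using fib_neq_0_nat[of i'] by simp
  also have "\<dots> \<le> fib j" using \<open>i < j\<close> by (intro fib_mono) simp
  finally show ?thesis .
qed

lemma fib_less_iff: "2 \<le> i \<Longrightarrow> 2 \<le> j \<Longrightarrow> fib i < fib j \<longleftrightarrow> i < j"
  by (metis fib_less linorder_neqE_nat order_less_asym order_less_irrefl)

lemma ex_fib_interval:
  assumes "1 \<le> q"
  obtains k where "2 \<le> k" "fib k \<le> q" "q < fib (Suc k)"
proof -
  define k where "k = (LEAST k. q < fib (Suc k))"
  have "q < fib (Suc (q + 1))" using less_fib[of q] by simp
  then have k: "q < fib (Suc k)" unfolding k_def by (rule LeastI)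
  have "2 \<le> k"
  proof (rule ccontr)
    assume "\<not> 2 \<le> k"
    then have "Suc k \<le> 2" by simp
    then have "fib (Suc k) \<le> fib 2" by (rule fib_mono)
    then show False using k assms by simp
  qed
  moreover have "fib k \<le> q"
  proof -
    have "k - 1 < k" using \<open>2 \<le> k\<close> by simp
    then have "\<not> q < fib (Suc (k - 1))" unfolding k_def by (rule not_less_Least)
    then show ?thesis using \<open>2 \<le> k\<close> by simp
  qed
  ultimately show ?thesis using k that by blast
qed

lemma zphiE:
  assumes "y \<in> zphi"
  obtains q :: int where "y = of_int q * \<phi>"
  using assms unfolding zphi_def by blast

text \<open>For \<open>fib k \<le> q < fib (Suc k)\<close> either the error is at most
  \<open>\<gamma> ^ k\<close> and \<open>best_approximation\<close> identifies the pair, or the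
  Fibonacci pair is a competitor and minimality equates the two. Indices start at 2 because
  \<open>fib 1 = fib 2\<close>: of the two pairs with \<open>y = \<phi>\<close> the second is
  closer.\<close>

lemma best_iff: "best p y \<longleftrightarrow> (\<exists>k\<ge>2. p = real (fib (Suc k)) \<and> y = real (fib k) * \<phi>)"
proof
  assume b: "best p y"
  obtain p0 q where pq: "p = of_int p0" "y = of_int q * \<phi>"
    using b unfolding best_def by (metis Ints_cases zphiE)
  have q: "0 < q" using b pq golden_bounds by (simp add: best_def zero_less_mult_iff)
  obtain k where k: "2 \<le> k" "fib k \<le> nat q" "nat q < fib (Suc k)"
  proof (rule ex_fib_interval)
    show "1 \<le> nat q" using q by simp
  qed
  show "\<exists>k\<ge>2. p = real (fib (Suc k)) \<and> y = real (fib k) * \<phi>"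
  proof (cases "\<bar>p - y\<bar> \<le> \<gamma> ^ k")
    case True
    then have "q = int (fib k) \<and> p0 = int (fib (Suc k))"
      using best_approximation[of q k p0] q k pq by (simp add: zless_nat_eq_int_zless nat_less_iff)
    then show ?thesis using pq k(1) by auto
  next
    case False
    have "real (fib (Suc k)) \<in> \<int>" "real (fib k) * \<phi> \<in> zphi"
      unfolding zphi_def by (auto intro: exI[of _ "int (fib k)"])
    moreover have "0 < real (fib k) * \<phi>"
      using fib_neq_0_nat[of k] k(1) golden_bounds by simp
    moreover have "real (fib k) * \<phi> \<le> y"
      unfolding pq using k(2) q golden_bounds by (intro mult_right_mono) linarith+
    moreover have "\<bar>real (fib (Suc k)) - real (fib k) * \<phi>\<bar> \<le> \<bar>p - y\<bar>"
      unfolding fib_approx abs_psi_power using False by simp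
    ultimately show ?thesis using b k(1) unfolding best_def by metis
  qed
next
  assume "\<exists>k\<ge>2. p = real (fib (Suc k)) \<and> y = real (fib k) * \<phi>"
  then obtain k where k: "2 \<le> k" "p = real (fib (Suc k))" "y = real (fib k) * \<phi>" by blast
  show "best p y"
    unfolding best_def
  proof (intro conjI allI impI)
    show "p \<in> \<int>" "y \<in> zphi" "0 < y"
      using k fib_neq_0_nat[of k] golden_bounds unfolding zphi_def by
        (auto intro: exI[of _ "int (fib k)"])
    fix p' y' assume *: "p' \<in> \<int> \<and> y' \<in> zphi \<and> 0 < y' \<and> y' \<le> y \<and> \<bar>p' - y'\<bar> \<le> \<bar>p - y\<bar>"
    obtain p0 q where pq: "p' = of_int p0" "y' = of_int q * \<phi>" using * by (metis Ints_cases zphiE)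
    have "0 < q" using * pq golden_bounds by (simp add: zero_less_mult_iff)
    moreover have "q < int (fib (Suc k))"
    proof -
      have "of_int q * \<phi> \<le> real (fib k) * \<phi>" using * pq k by simp
      then have "real_of_int q \<le> real (fib k)" using golden_bounds by
        (simp add: mult_le_cancel_right_pos)
      then show ?thesis using fib_less[OF k(1), of "Suc k"] by linarith
    qed
    moreover have "\<bar>of_int p0 - of_int q * \<phi>\<bar> \<le> \<gamma> ^ k"
      using * pq k fib_approx[of k] abs_psi_power[of k] by simp
    ultimately have "q = int (fib k) \<and> p0 = int (fib (Suc k))" by (rule best_approximation)
    then show "p' = p" "y' = y" using pq k by auto
  qed
qed

definition next_best :: "real \<Rightarrow> real \<Rightarrow> real \<Rightarrow> real \<Rightarrow> bool" where
  "next_best p y p' y' \<longleftrightarrow> best p y \<and> best p' y' \<and> y < y' \<and> (\<forall>q z. best q z \<and> y < z \<longrightarrow> y' \<le> z)"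

lemma definable_next_best [definable_intros]:
  "i < n \<Longrightarrow> j < n \<Longrightarrow> k < n \<Longrightarrow> l < n \<Longrightarrow> definable n (\<lambda>e. next_best (e i) (e j) (e k) (e l))"
  unfolding next_best_def by (intro definable_intros) simp_all

lemma next_best_iff: "next_best p y p' y' \<longleftrightarrow> (\<exists>k\<ge>2. p = real (fib (Suc k)) \<and> y = real (fib k) * \<phi> \<and>
    p' = real (fib (Suc (Suc k))) \<and> y' = real (fib (Suc k)) * \<phi>)"
proof -
  have less: "real a * \<phi> < real b * \<phi> \<longleftrightarrow> a < b" for a b
    using golden_bounds by (simp add: mult_less_cancel_right_pos)
  have le: "real a * \<phi> \<le> real b * \<phi> \<longleftrightarrow> a \<le> b" for a b
    using golden_bounds by (simp add: mult_le_cancel_right_pos)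
  show ?thesis
  proof
    assume s: "next_best p y p' y'"
    then obtain k j where k: "2 \<le> k" "p = real (fib (Suc k))" "y = real (fib k) * \<phi>"
      and j: "2 \<le> j" "p' = real (fib (Suc j))" "y' = real (fib j) * \<phi>"
      unfolding next_best_def best_iff by blast
    have "best (real (fib (Suc (Suc k)))) (real (fib (Suc k)) * \<phi>)"
      unfolding best_iff using k(1) by (intro exI[of _ "Suc k"]) simp
    moreover have "y < real (fib (Suc k)) * \<phi>"
      unfolding k less using fib_less[OF k(1)] by simp
    ultimately have "y' \<le> real (fib (Suc k)) * \<phi>" using s unfolding next_best_def by blast
    then have "\<not> fib (Suc k) < fib j" unfolding j le by simp
    then have "j \<le> Suc k" using fib_less_iff[of "Suc k" j] k(1) j(1) by simp
    moreover have "k < j"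
      using s fib_less_iff[OF k(1) j(1)] unfolding next_best_def k j less by simp
    ultimately have "j = Suc k" by simp
    then show "\<exists>k\<ge>2. p = real (fib (Suc k)) \<and> y = real (fib k) * \<phi> \<and>
        p' = real (fib (Suc (Suc k))) \<and> y' = real (fib (Suc k)) * \<phi>"
      using k j by auto
  next
    assume "\<exists>k\<ge>2. p = real (fib (Suc k)) \<and> y = real (fib k) * \<phi> \<and>
        p' = real (fib (Suc (Suc k))) \<and> y' = real (fib (Suc k)) * \<phi>"
    then obtain k where k: "2 \<le> k" "p = real (fib (Suc k))" "y = real (fib k) * \<phi>"
      "p' = real (fib (Suc (Suc k)))" "y' = real (fib (Suc k)) * \<phi>" by blast
    have "y' \<le> z" if b: "best q z" "y < z" for q z
    proof -
      obtain j where j: "2 \<le> j" "z = real (fib j) * \<phi>" using b(1) unfolding best_iff by blast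
      then have "k < j" using b(2) k(3) fib_less_iff[OF k(1) j(1)] less by simp
      then show ?thesis using k(5) j(2) le fib_mono[of "Suc k" j] by simp
    qed
    moreover have "best p y" unfolding best_iff using k by blast
    moreover have "best p' y'" unfolding best_iff using k by (intro exI[of _ "Suc k"]) simp
    moreover have "y < y'" unfolding k less using fib_less[OF k(1)] by simp
    ultimately show "next_best p y p' y'" unfolding next_best_def by blast
  qed
qed

text \<open>A tuple standing for an index \<open>k\<close>. Best pairs match
  \<open>fib (Suc k)\<close> with \<open>fib k * \<phi>\<close>, so \<open>f\<close> and
  \<open>f'\<close>, which belong to the same Fibonacci number, come from two neighbouring pairs. A
  chain of four pairs also yields three consecutive powers of \<gamma> as errors.\<close>

definition scale :: "real \<Rightarrow> real \<Rightarrow> real \<Rightarrow> real \<Rightarrow> real \<Rightarrow> real \<Rightarrow> real \<Rightarrow> bool" where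
  "scale f f' g g' d d' d'' \<longleftrightarrow> (\<exists>y h h' p. next_best f y g f' \<and> next_best g f' h g' \<and> next_best h g'
    p h' \<and>
     d = \<bar>g - f'\<bar> \<and> d' = \<bar>h - g'\<bar> \<and> d'' = \<bar>p - h'\<bar>)"

lemma definable_scale [definable_intros]:
  "i1 < n \<Longrightarrow> i2 < n \<Longrightarrow> i3 < n \<Longrightarrow> i4 < n \<Longrightarrow> i5 < n \<Longrightarrow> i6 < n \<Longrightarrow> i7 < n \<Longrightarrow>
    definable n (\<lambda>e. scale (e i1) (e i2) (e i3) (e i4) (e i5) (e i6) (e i7))"
  unfolding scale_def by (intro definable_intros) simp_all

lemma scale_iff: "scale f f' g g' d d' d'' \<longleftrightarrow> (\<exists>k\<ge>3. f = real (fib k) \<and> f' = real (fib k) * \<phi> \<and>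
    g = real (fib (Suc k)) \<and> g' = real (fib (Suc k)) * \<phi> \<and>
    d = \<gamma> ^ k \<and> d' = \<gamma> ^ Suc k \<and> d'' = \<gamma> ^ Suc (Suc k))"
proof
  assume "scale f f' g g' d d' d''"
  then obtain y h h' p where s: "next_best f y g f'" "next_best g f' h g'" "next_best h g' p h'"
    and d: "d = \<bar>g - f'\<bar>" "d' = \<bar>h - g'\<bar>" "d'' = \<bar>p - h'\<bar>" unfolding scale_def by blast
  obtain k where k: "2 \<le> k" "f = real (fib (Suc k))" "g = real (fib (Suc (Suc k)))"
    "f' = real (fib (Suc k)) * \<phi>"
    using s(1) unfolding next_best_iff by blast
  have inj: "i = j" if "fib i = fib j" "2 \<le> i" "2 \<le> j" for i j
    using that fib_less_iff[of i j] fib_less_iff[of j i] by (metis linorder_neqE_nat less_irrefl)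
  obtain k2 where k2: "2 \<le> k2" "g = real (fib (Suc k2))" "h = real (fib (Suc (Suc k2)))"
    "g' = real (fib (Suc k2)) * \<phi>"
    using s(2) unfolding next_best_iff by blast
  then have "k2 = Suc k" using k inj[of "Suc k2" "Suc (Suc k)"] by simp
  obtain k3 where k3: "2 \<le> k3" "h = real (fib (Suc k3))" "p = real (fib (Suc (Suc k3)))"
    "h' = real (fib (Suc k3)) * \<phi>"
    using s(3) unfolding next_best_iff by blast
  then have "k3 = Suc (Suc k)" using k2 \<open>k2 = Suc k\<close> inj[of "Suc k3" "Suc (Suc (Suc k))"] by simp
  show "\<exists>k\<ge>3. f = real (fib k) \<and> f' = real (fib k) * \<phi> \<and>
    g = real (fib (Suc k)) \<and> g' = real (fib (Suc k)) * \<phi> \<and>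
    d = \<gamma> ^ k \<and> d' = \<gamma> ^ Suc k \<and> d'' = \<gamma> ^ Suc (Suc k)"
  proof (intro exI[of _ "Suc k"] conjI)
    show "d = \<gamma> ^ Suc k" unfolding d k(3,4) fib_approx abs_psi_power ..
    show "d' = \<gamma> ^ Suc (Suc k)" unfolding d k2(3,4) \<open>k2 = Suc k\<close> fib_approx abs_psi_power ..
    show "d'' = \<gamma> ^ Suc (Suc (Suc k))" unfolding d k3(3,4) \<open>k3 = Suc (Suc k)\<close> fib_approx abs_psi_power ..
    show "g' = real (fib (Suc (Suc k))) * \<phi>" unfolding k2(4) \<open>k2 = Suc k\<close> ..
  qed (use k in simp_all)
next
  assume "\<exists>k\<ge>3. f = real (fib k) \<and> f' = real (fib k) * \<phi> \<and>
    g = real (fib (Suc k)) \<and> g' = real (fib (Suc k)) * \<phi> \<and>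
    d = \<gamma> ^ k \<and> d' = \<gamma> ^ Suc k \<and> d'' = \<gamma> ^ Suc (Suc k)"
  then obtain k where k: "3 \<le> k" "f = real (fib k)" "f' = real (fib k) * \<phi>"
    "g = real (fib (Suc k))" "g' = real (fib (Suc k)) * \<phi>"
    "d = \<gamma> ^ k" "d' = \<gamma> ^ Suc k" "d'' = \<gamma> ^ Suc (Suc k)" by blast
  obtain j where j: "k = Suc j" "2 \<le> j" using k(1) by (cases k) auto
  show "scale f f' g g' d d' d''"
    unfolding scale_def
  proof (intro exI conjI)
    show "next_best f (real (fib j) * \<phi>) g f'"
      unfolding next_best_iff using k j by (intro exI[of _ j] conjI; simp)
    show "next_best g f' (real (fib (Suc (Suc k)))) g'"
      unfolding next_best_iff using k by (intro exI[of _ k] conjI; simp)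
    show "next_best (real (fib (Suc (Suc k)))) g' (real (fib (Suc (Suc (Suc k)))))
      (real (fib (Suc (Suc k))) * \<phi>)"
      unfolding next_best_iff using k by (intro exI[of _ "Suc k"] conjI; simp)
    show "d = \<bar>g - f'\<bar>" unfolding k fib_approx abs_psi_power ..
    show "d' = \<bar>real (fib (Suc (Suc k))) - g'\<bar>" unfolding k fib_approx abs_psi_power ..
    show "d'' = \<bar>real (fib (Suc (Suc (Suc k)))) - real (fib (Suc (Suc k))) * \<phi>\<bar>"
      unfolding k fib_approx abs_psi_power ..
  qed
qed

section \<open>Truncations of natural numbers\<close>

definition near :: "nat \<Rightarrow> nat \<Rightarrow> bool" where
  "near k t \<longleftrightarrow> (\<exists>l::int. \<bar>real t - of_int l * \<phi>\<bar> < \<gamma> ^ k)"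

text \<open>Multiplication by \<open>\<phi>\<close> exchanges the roles of \<open>\<int>\<close> and \<open>\<int> \<phi>\<close> at the price of a factor \<open>\<gamma>\<close>.\<close>

lemma near_mult_iff: "(\<exists>s::int. \<bar>real t * \<phi> - of_int s\<bar> < \<gamma> ^ Suc k) \<longleftrightarrow> near k t"
proof -
  have eq: "real t * \<phi> - of_int (l + int t) = \<gamma> * (real t - of_int l * \<phi>)" for l
  proof -
    have "\<gamma> * (real t - of_int l * \<phi>) = \<gamma> * real t - of_int l * (\<phi> * \<gamma>)"
      by (simp add: algebra_simps)
    then show ?thesis unfolding golden_inverse by (simp add: algebra_simps)
  qed
  have iff: "\<bar>real t * \<phi> - of_int (l + int t)\<bar> < \<gamma> ^ Suc k \<longleftrightarrow> \<bar>real t - of_int l * \<phi>\<bar> < \<gamma> ^ k" for l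
    unfolding eq abs_mult using golden_bounds by simp
  show ?thesis
  proof
    assume "\<exists>s::int. \<bar>real t * \<phi> - of_int s\<bar> < \<gamma> ^ Suc k"
    then obtain s :: int where "\<bar>real t * \<phi> - of_int s\<bar> < \<gamma> ^ Suc k" by blast
    then have "\<bar>real t * \<phi> - of_int (s - int t + int t)\<bar> < \<gamma> ^ Suc k"
      by (simp del: power_Suc)
    then show "near k t" using iff unfolding near_def by blast
  next
    assume "near k t"
    then show "\<exists>s::int. \<bar>real t * \<phi> - of_int s\<bar> < \<gamma> ^ Suc k"
      using iff unfolding near_def by blast
  qed
qed

text \<open>\<open>t\<close> is the truncation of \<open>m\<close> that the overview calls
  \<open>n\<^sub>k\<close>.\<close>

definition trunc :: "nat \<Rightarrow> nat \<Rightarrow> nat \<Rightarrow> bool" where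
  "trunc k m t \<longleftrightarrow> t \<le> m \<and> near k t \<and> (\<forall>t'\<le>m. near k t' \<longrightarrow> t' \<le> t)"

lemma near_0: "near k 0"
  unfolding near_def using golden_bounds by (intro exI[of _ 0]) simp

lemma ex_trunc: "\<exists>t. trunc k m t"
proof -
  let ?S = "{t. t \<le> m \<and> near k t}"
  have "finite ?S" "0 \<in> ?S" using near_0 by simp_all
  then have "Max ?S \<in> ?S" by (intro Max_in) auto
  moreover have "t' \<le> Max ?S" if "t' \<le> m" "near k t'" for t'
    using \<open>finite ?S\<close> that by (intro Max_ge) auto
  ultimately show ?thesis unfolding trunc_def by blast
qed

text \<open>Adding \<open>fib (Suc i)\<close> to \<open>t\<close> and \<open>fib i\<close> to
  \<open>l\<close> changes the error by \<open>\<psi> ^ i\<close>. As signs alternate, for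
  \<open>i = Suc k\<close> or \<open>i = Suc (Suc k)\<close> the change opposes the error; being
  smaller than \<open>\<gamma> ^ k\<close>, it keeps the error within the bound.\<close>

lemma near_add_fib:
  assumes "near k t"
  shows "\<exists>j. j \<le> k + 3 \<and> 1 \<le> j \<and> near k (t + fib j)"
proof -
  obtain l :: int where l: "\<bar>real t - of_int l * \<phi>\<bar> < \<gamma> ^ k" using assms unfolding near_def by blast
  define z where "z = real t - of_int l * \<phi>"
  have step: "near k (t + fib (Suc i))" if "\<bar>z + \<psi> ^ i\<bar> < \<gamma> ^ k" for i
  proof -
    have "real (t + fib (Suc i)) - of_int (l + int (fib i)) * \<phi> = z + \<psi> ^ i"
      using fib_approx[of i] by (simp add: z_def algebra_simps)
    then show ?thesis unfolding near_def using that by metis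
  qed
  have g: "0 < \<gamma> ^ i" "\<gamma> ^ Suc i < \<gamma> ^ i" for i
    using golden_bounds by (simp_all add: power_strict_decreasing_iff)
  have g1: "\<gamma> ^ Suc k < \<gamma> ^ k" "\<gamma> ^ Suc (Suc k) < \<gamma> ^ k" using g(2)[of k] g(2)[of "Suc k"] by linarith+
  have "\<exists>i\<in>{Suc k, Suc (Suc k)}. \<bar>z + \<psi> ^ i\<bar> < \<gamma> ^ k"
  proof (cases "z \<ge> 0 \<longleftrightarrow> odd (Suc k)")
    case True
    then have "\<bar>z + \<psi> ^ Suc k\<bar> < \<gamma> ^ k"
      using l g1 g(1)[of "Suc k"] unfolding z_def[symmetric] psi_power[of "Suc k"] 
      by (auto simp del: power_Suc simp: abs_if split: if_splits)
    then show ?thesis by blast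
  next
    case False
    then have "\<bar>z + \<psi> ^ Suc (Suc k)\<bar> < \<gamma> ^ k"
      using l g1 g(1)[of "Suc (Suc k)"] unfolding z_def[symmetric] psi_power[of "Suc (Suc k)"]
      by (auto simp del: power_Suc simp: abs_if split: if_splits)
    then show ?thesis by blast
  qed
  then obtain i where "i \<in> {Suc k, Suc (Suc k)}" "near k (t + fib (Suc i))" using step by blast
  then show ?thesis by (intro exI[of _ "Suc i"]) auto
qed

lemma trunc_gap:
  assumes "trunc k m t"
  shows "m < t + fib (k + 3)"
proof -
  obtain j where j: "j \<le> k + 3" "1 \<le> j" "near k (t + fib j)"
    using near_add_fib assms unfolding trunc_def by blast
  have "0 < fib j" using j(2) by (intro fib_neq_0_nat) simp
  then have "\<not> t + fib j \<le> m" using assms j(3) unfolding trunc_def by force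
  then show ?thesis using fib_mono[OF j(1)] by linarith
qed

text \<open>The errors of \<open>t\<close> and \<open>t'\<close> differ by less than
  \<open>\<gamma> ^ k + \<gamma> ^ Suc k = \<gamma> ^ (k - 1)\<close>, so in the Fibonacci basis
  \<open>a - b \<gamma>\<close> is below 1 in absolute value. The gap bound
  \<open>t - t' < 5 * fib (Suc k)\<close> then leaves \<open>b\<close> below 6 and \<open>a\<close>
  below 7; the range up to 10 is roomy.\<close>

lemma trunc_diff:
  assumes "trunc k m t" "trunc (Suc k) m t'" "1 \<le> k"
  shows "\<exists>a\<in>{-10..10}. \<exists>b\<in>{-10..10}. int t - int t' = a * int (fib k) + b * int (fib (Suc k))"
proof -
  have dec: "\<gamma> ^ Suc k < \<gamma> ^ k" using golden_bounds by (simp add: power_strict_decreasing_iff)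
  obtain l l' :: int where l: "\<bar>real t - of_int l * \<phi>\<bar> < \<gamma> ^ k" "\<bar>real t' - of_int l' * \<phi>\<bar> < \<gamma> ^ Suc k"
    using assms unfolding trunc_def near_def by blast
  have "near k t'" using l(2) dec unfolding near_def by (meson less_trans)
  then have tt: "t' \<le> t" using assms unfolding trunc_def by blast
  have gap: "t < t' + fib (Suc k + 3)" using trunc_gap[OF assms(2)] assms(1) unfolding trunc_def by simp
  obtain j where j: "k = Suc j" using assms(3) by (cases k) auto
  define D where "D = int t - int t'"
  obtain a b where ab: "l - l' = a * int (fib j) + b * int (fib (Suc j))"
    "D = a * int (fib (Suc j)) + b * int (fib (Suc (Suc j)))"
    using fib_basis by blast
  have "\<bar>of_int D - of_int (l - l') * \<phi>\<bar> < \<gamma> ^ k + \<gamma> ^ Suc k"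
    using l by (simp add: D_def algebra_simps)
  also have "\<gamma> ^ k + \<gamma> ^ Suc k = \<gamma> ^ j * (\<phi> * \<gamma>)" unfolding j by (simp add: algebra_simps)
  finally have "\<gamma> ^ j * \<bar>of_int a - of_int b * \<gamma>\<bar> < \<gamma> ^ j * 1"
    unfolding fib_basis_error[OF ab] golden_inverse .
  then have small: "\<bar>of_int a - of_int b * \<gamma>\<bar> < 1"
    using golden_bounds by (simp add: mult_less_cancel_left_pos)
  define F G where "F = real (fib k)" and "G = real (fib (Suc k))"
  have FG: "0 \<le> F" "F \<le> G" "0 < G"
    using fib_mono[of k "Suc k"] fib_neq_0_nat[of "Suc k"] by (auto simp: F_def G_def)
  have D: "of_int D = of_int b * (\<gamma> * F + G) + (of_int a - of_int b * \<gamma>) * F"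
    unfolding ab(2) j[symmetric] F_def G_def by (simp add: algebra_simps)
  have "0 \<le> real_of_int D" "real_of_int D < 5 * G"
  proof -
    show "0 \<le> real_of_int D" using tt by (simp add: D_def)
    have "real (fib (Suc k + 3)) = 3 * G + 2 * F" by (simp add: F_def G_def numeral_3_eq_3)
    moreover have "real_of_int D < real (fib (Suc k + 3))" using gap by (simp add: D_def)
    ultimately show "real_of_int D < 5 * G" using FG by linarith
  qed
  moreover have "\<bar>(of_int a - of_int b * \<gamma>) * F\<bar> \<le> 1 * G"
    unfolding abs_mult using small FG by (intro mult_mono) auto
  ultimately have "\<bar>of_int b * (\<gamma> * F + G)\<bar> < 6 * G" using D by linarith
  moreover have "\<bar>of_int b\<bar> * G \<le> \<bar>of_int b * (\<gamma> * F + G)\<bar>"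
    unfolding abs_mult using FG golden_bounds by (intro mult_left_mono) auto
  ultimately have "\<bar>real_of_int b\<bar> * G < 6 * G" by linarith
  then have b: "\<bar>real_of_int b\<bar> < 6" using FG by simp
  have "\<bar>of_int b * \<gamma>\<bar> \<le> 6 * 1" unfolding abs_mult using b golden_bounds by (intro mult_mono) auto
  then have "\<bar>real_of_int a\<bar> < 7" using small by linarith
  then have "a \<in> {-10..10}" "b \<in> {-10..10}" using b by auto
  then show ?thesis using ab(2)[folded j] unfolding D_def by blast
qed

lemma trunc_3_diff:
  assumes "trunc 3 m t"
  shows "\<exists>a\<in>{-10..10}. \<exists>b\<in>{-10..10}. int m - int t = a * int (fib 3) + b * int (fib (Suc 3))"
proof -
  have fib: "fib 3 = 2" "fib 4 = 3" "fib 6 = 8" by (simp_all add: numeral_eq_Suc)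
  have "m < t + 8" "t \<le> m" using trunc_gap[OF assms] assms fib by (auto simp: trunc_def)
  \<comment> \<open>As \<open>fib 3 = 2\<close> and \<open>fib 4 = 3\<close>, any \<open>x\<close>
    is \<open>- x * 2 + x * 3\<close>; the gap bound \<open>fib 6 = 8\<close> keeps \<open>x\<close>
    in range.\<close>
  then show ?thesis
    using fib by (intro bexI[of _ "- (int m - int t)"] bexI[of _ "int m - int t"]) auto
qed

text \<open>A nonzero \<open>t\<close> would have a partner \<open>l\<close> with
  \<open>0 < l < fib (Suc k)\<close>. By \<open>best_approximation\<close> the two form the
  Fibonacci pair, whose error is exactly \<open>\<gamma> ^ k\<close> and not smaller.\<close>

lemma trunc_eventually_0:
  assumes "trunc k m t" "m + 2 \<le> k"
  shows "t = 0"
proof (rule ccontr)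
  assume "t \<noteq> 0"
  obtain l :: int where l: "\<bar>real t - of_int l * \<phi>\<bar> < \<gamma> ^ k"
    using assms unfolding trunc_def near_def by blast
  have "\<gamma> ^ k \<le> 1" using golden_bounds by (simp add: power_le_one)
  then have "0 < of_int l * \<phi>" "of_int l * \<phi> < real t + 1"
    using l \<open>t \<noteq> 0\<close> by linarith+
  then have "0 < l" using golden_bounds by (simp add: zero_less_mult_iff)
  then have "real_of_int l * 1 \<le> of_int l * \<phi>" using golden_bounds by (intro mult_left_mono) auto
  then have "real_of_int l < real m + 1" using \<open>of_int l * \<phi> < real t + 1\<close> assms(1) by
    (simp add: trunc_def)
  moreover have "m + 1 < fib (Suc k)"
    using less_fib[of "m + 1"] fib_mono[of "m + 1 + 2" "Suc k"] assms(2) by simp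
  ultimately have "l < int (fib (Suc k))" by linarith
  then have "l = int (fib k) \<and> int t = int (fib (Suc k))"
    using \<open>0 < l\<close> l by (intro best_approximation) auto
  then have "\<gamma> ^ k < \<gamma> ^ k" using l fib_approx[of k] abs_psi_power[of k] by simp
  then show False by simp
qed

section \<open>Definability of multiplication by the golden ratio\<close>

definition low_int :: "real \<Rightarrow> real \<Rightarrow> real \<Rightarrow> bool" where
  "low_int d n a \<longleftrightarrow> a \<in> \<int> \<and> 0 \<le> a \<and> a \<le> n \<and> (\<exists>l. l \<in> zphi \<and> \<bar>a - l\<bar> < d) \<and>
     (\<forall>a'. a' \<in> \<int> \<and> 0 \<le> a' \<and> a' \<le> n \<and> (\<exists>l. l \<in> zphi \<and> \<bar>a' - l\<bar> < d) \<longrightarrow> a' \<le> a)"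

definition low_zphi :: "real \<Rightarrow> real \<Rightarrow> real \<Rightarrow> bool" where
  "low_zphi d n a \<longleftrightarrow> a \<in> zphi \<and> 0 \<le> a \<and> a \<le> n \<and> (\<exists>l. l \<in> \<int> \<and> \<bar>a - l\<bar> < d) \<and>
     (\<forall>a'. a' \<in> zphi \<and> 0 \<le> a' \<and> a' \<le> n \<and> (\<exists>l. l \<in> \<int> \<and> \<bar>a' - l\<bar> < d) \<longrightarrow> a' \<le> a)"

text \<open>Sharing the coefficients makes \<open>z = t \<phi>\<close> whenever
  \<open>f' = f \<phi>\<close> and \<open>g' = g \<phi>\<close>. Their finite range turns the
  quantifiers into a finite disjunction of linear conditions.\<close>

definition comb :: "real \<Rightarrow> real \<Rightarrow> real \<Rightarrow> real \<Rightarrow> real \<Rightarrow> real \<Rightarrow> bool" where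
  "comb f f' g g' t z \<longleftrightarrow> (\<exists>a\<in>{-10..10::int}. \<exists>b\<in>{-10..10::int}.
     t = of_int a * f + of_int b * g \<and> z = of_int a * f' + of_int b * g')"

lemma definable_low [definable_intros]:
  assumes "i < n" "j < n" "k < n"
  shows "definable n (\<lambda>e. low_int (e i) (e j) (e k))" "definable n (\<lambda>e. low_zphi (e i) (e j) (e k))"
  unfolding low_int_def low_zphi_def using assms by (intro definable_intros; simp)+

lemma definable_comb [definable_intros]:
  assumes "i1 < n" "i2 < n" "i3 < n" "i4 < n" "definable_term n t" "definable_term n z"
  shows "definable n (\<lambda>e. comb (e i1) (e i2) (e i3) (e i4) (t e) (z e))"
  unfolding comb_def by (intro definable_finite_ex definable_intros assms) simp_all

text \<open>The first condition ties \<open>n\<close> and \<open>y\<close> to their truncations at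
  some scale; the second makes both truncations descend by the same steps at every scale. On the
  side of \<open>zphi\<close> the tolerance is one power of \<gamma> smaller, in accordance with
  \<open>near_mult_iff\<close>.\<close>

definition mulN :: "real \<Rightarrow> real \<Rightarrow> bool" where
  "mulN n y \<longleftrightarrow> n \<in> \<int> \<and> 0 \<le> n \<and> y \<in> zphi \<and> 0 \<le> y \<and>
     (\<exists>f f' g g' d d' d'' a b. scale f f' g g' d d' d'' \<and> low_int d n a \<and> low_zphi d' y b \<and>
        comb f f' g g' (n - a) (y - b)) \<and>
     (\<forall>f f' g g' d d' d'' a b a' b'. scale f f' g g' d d' d'' \<and> low_int d n a \<and> low_zphi d' y b \<and>
        low_int d' n a' \<and> low_zphi d'' y b' \<longrightarrow> comb f f' g g' (a - a') (b - b'))"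

lemma definable_mulN:
  assumes "i < n" "j < n"
  shows "definable n (\<lambda>e. mulN (e i) (e j))"
  unfolding mulN_def using assms by (intro definable_intros; simp)

lemma nonneg_IntE:
  assumes "x \<in> \<int>" "0 \<le> x"
  obtains m where "x = real m"
  using assms by (metis Ints_cases nonneg_int_cases of_int_0_le_iff of_int_of_nat_eq)

lemma nonneg_zphiE:
  assumes "y \<in> zphi" "0 \<le> y"
  obtains m where "y = real m * \<phi>"
proof -
  obtain q :: int where q: "y = of_int q * \<phi>" using assms(1) by (rule zphiE)
  then have "0 \<le> q" using assms(2) golden_bounds by (simp add: zero_le_mult_iff)
  then show ?thesis using that[of "nat q"] q by simp
qed

lemma zphi_of_nat: "real m * \<phi> \<in> zphi"
  unfolding zphi_def by (auto intro: exI[of _ "int m"])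

lemma low_int_iff: "low_int (\<gamma> ^ k) (real m) a \<longleftrightarrow> (\<exists>t. a = real t \<and> trunc k m t)"
proof -
  have near: "(\<exists>l. l \<in> zphi \<and> \<bar>real t - l\<bar> < \<gamma> ^ k) \<longleftrightarrow> near k t" for t
    unfolding near_def zphi_def by auto
  show ?thesis
  proof
    assume a: "low_int (\<gamma> ^ k) (real m) a"
    then obtain t where t: "a = real t" unfolding low_int_def by (metis nonneg_IntE)
    have "t' \<le> t" if "t' \<le> m" "near k t'" for t'
    proof -
      have "real t' \<le> a" using a that unfolding low_int_def near[symmetric] by simp
      then show ?thesis using t by simp
    qed
    then show "\<exists>t. a = real t \<and> trunc k m t"
      using a t near unfolding low_int_def trunc_def by auto
  next
    assume "\<exists>t. a = real t \<and> trunc k m t"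
    then obtain t where t: "a = real t" "trunc k m t" by blast
    have "a' \<le> a" if a': "a' \<in> \<int>" "0 \<le> a'" "a' \<le> real m" "\<exists>l. l \<in> zphi \<and> \<bar>a' - l\<bar> < \<gamma> ^ k" for a'
    proof -
      obtain t' where "a' = real t'" using a' by (metis nonneg_IntE)
      then show ?thesis using a' t near[of t'] unfolding trunc_def by simp
    qed
    then show "low_int (\<gamma> ^ k) (real m) a"
      using t near[of t] unfolding low_int_def trunc_def by auto
  qed
qed

lemma low_zphi_iff: "low_zphi (\<gamma> ^ Suc k) (real m * \<phi>) b \<longleftrightarrow> (\<exists>t. b = real t * \<phi> \<and> trunc k m t)"
proof -
  have near: "(\<exists>l. l \<in> \<int> \<and> \<bar>real t * \<phi> - l\<bar> < \<gamma> ^ Suc k) \<longleftrightarrow> near k t" for t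
    unfolding near_mult_iff[symmetric] Ints_def by auto
  have le: "real a * \<phi> \<le> real b * \<phi> \<longleftrightarrow> a \<le> b" for a b
    using golden_bounds by (simp add: mult_le_cancel_right_pos)
  have pos: "0 \<le> real t * \<phi>" for t using golden_bounds by simp
  show ?thesis
  proof
    assume b: "low_zphi (\<gamma> ^ Suc k) (real m * \<phi>) b"
    then obtain t where t: "b = real t * \<phi>" unfolding low_zphi_def by (metis nonneg_zphiE)
    have "t' \<le> t" if "t' \<le> m" "near k t'" for t'
    proof -
      have "real t' * \<phi> \<le> b"
        using b that zphi_of_nat pos le unfolding low_zphi_def near[symmetric] by blast
      then show ?thesis using t le by simp
    qed
    then show "\<exists>t. b = real t * \<phi> \<and> trunc k m t"
      using b t near le unfolding low_zphi_def trunc_def by blast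
  next
    assume "\<exists>t. b = real t * \<phi> \<and> trunc k m t"
    then obtain t where t: "b = real t * \<phi>" "trunc k m t" by blast
    have "a' \<le> b" if a': "a' \<in> zphi" "0 \<le> a'" "a' \<le> real m * \<phi>" "\<exists>l. l \<in> \<int> \<and> \<bar>a' - l\<bar> < \<gamma> ^ Suc k" for a'
    proof -
      obtain t' where "a' = real t' * \<phi>" using a' by (metis nonneg_zphiE)
      then show ?thesis using a' t near[of t'] le unfolding trunc_def by blast
    qed
    then show "low_zphi (\<gamma> ^ Suc k) (real m * \<phi>) b"
      using t near[of t] le zphi_of_nat pos unfolding low_zphi_def trunc_def by blast
  qed
qed

lemma mult_phi_inject: "real_of_int a * \<phi> = real_of_int b * \<phi> \<longleftrightarrow> a = b"
  using golden_bounds by simp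

lemma mulN_iff: "mulN n y \<longleftrightarrow> (\<exists>m. n = real m \<and> y = real m * \<phi>)"
proof
  assume mul: "mulN n y"
  obtain m m' where m: "n = real m" "y = real m' * \<phi>"
    using mul unfolding mulN_def by (metis nonneg_IntE nonneg_zphiE)
  have comb_diff: "int u - int v = int u' - int v'"
    if cb: "comb (real (fib k)) (real (fib k) * \<phi>) (real (fib (Suc k))) (real (fib (Suc k)) * \<phi>)
      (real u - real v) (real u' * \<phi> - real v' * \<phi>)" for k u v u' v'
  proof -
    obtain a b :: int where ab: "real u - real v = of_int a * real (fib k) + of_int b * real
      (fib (Suc k))"
      "real u' * \<phi> - real v' * \<phi> = of_int a * (real (fib k) * \<phi>) + of_int b * (real (fib (Suc k)) * \<phi>)"
      using cb unfolding comb_def by blast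
    have "of_int (int u' - int v') * \<phi> = (of_int a * real (fib k) + of_int b * real (fib (Suc k))) * \<phi>"
      using ab(2) by (simp add: algebra_simps)
    then have "of_int (int u' - int v') * \<phi> = of_int (int u - int v) * \<phi>" using ab(1) by simp
    then show ?thesis using mult_phi_inject by metis
  qed
  have "\<exists>T. \<forall>k. trunc k m (T k)" for m
    by (rule choice) (use ex_trunc in blast)
  then obtain T T' where T: "\<And>k. trunc k m (T k)" and T': "\<And>k. trunc k m' (T' k)"
    by blast
  have scale: "scale (real (fib k)) (real (fib k) * \<phi>) (real (fib (Suc k))) (real (fib (Suc k)) * \<phi>)
      (\<gamma> ^ k) (\<gamma> ^ Suc k) (\<gamma> ^ Suc (Suc k))" if "3 \<le> k" for k
    unfolding scale_iff using that by blast
  have step: "int (T k) - int (T (Suc k)) = int (T' k) - int (T' (Suc k))" if "3 \<le> k" for k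
  proof (rule comb_diff)
    have "low_int (\<gamma> ^ k) n (real (T k))" "low_int (\<gamma> ^ Suc k) n (real (T (Suc k)))"
      "low_zphi (\<gamma> ^ Suc k) y (real (T' k) * \<phi>)" "low_zphi (\<gamma> ^ Suc (Suc k)) y (real (T' (Suc k)) * \<phi>)"
      unfolding m low_int_iff low_zphi_iff using T T' by blast+
    then show "comb (real (fib k)) (real (fib k) * \<phi>) (real (fib (Suc k))) (real (fib (Suc k)) * \<phi>)
      (real (T k) - real (T (Suc k))) (real (T' k) * \<phi> - real (T' (Suc k)) * \<phi>)"
      using mul scale[OF that] unfolding mulN_def by blast
  qed
  obtain f f' g g' d d' d'' a b where s: "scale f f' g g' d d' d''" "low_int d n a" "low_zphi d' y b"
    "comb f f' g g' (n - a) (y - b)"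
    using mul unfolding mulN_def by blast
  obtain k where k: "3 \<le> k" "f = real (fib k)" "f' = real (fib k) * \<phi>" "g = real (fib (Suc k))"
    "g' = real (fib (Suc k)) * \<phi>" "d = \<gamma> ^ k" "d' = \<gamma> ^ Suc k"
    using s(1) unfolding scale_iff by blast
  have uniq: "t = t'" if "trunc k m t" "trunc k m t'" for k m t t'
    using that unfolding trunc_def by (meson le_antisym)
  have "a = real (T k)" "b = real (T' k) * \<phi>"
    using s(2,3) T[of k] T'[of k] uniq unfolding m k low_int_iff low_zphi_iff by metis+
  then have base: "int m - int (T k) = int m' - int (T' k)"
    using s(4) comb_diff unfolding m k by blast
  have "int (T k) - int (T (k + i)) = int (T' k) - int (T' (k + i))" for i
  proof (induction i)
    case (Suc i)
    then show ?case using step[of "k + i"] k(1) by simp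
  qed simp
  \<comment> \<open>Both truncations vanish that far out, so the telescoped steps give
    \<open>T k = T' k\<close>, and \<open>base\<close> turns this into
    \<open>m = m'\<close>.\<close>
  from this[of "m + m' + 2"] have "int (T k) = int (T' k)"
    using trunc_eventually_0[OF T, of "k + (m + m' + 2)"]
      trunc_eventually_0[OF T', of "k + (m + m' + 2)"]
    by simp
  then show "\<exists>m. n = real m \<and> y = real m * \<phi>" using base m by auto
next
  assume "\<exists>m. n = real m \<and> y = real m * \<phi>"
  then obtain m where m: "n = real m" "y = real m * \<phi>" by blast
  have combI: "comb (real (fib k)) (real (fib k) * \<phi>) (real (fib (Suc k))) (real (fib (Suc k)) * \<phi>)
      (real u - real v) (real u * \<phi> - real v * \<phi>)"
    if uv: "\<exists>a\<in>{-10..10}. \<exists>b\<in>{-10..10}. int u - int v = a * int (fib k) + b * int (fib (Suc k))" for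
      k u v
  proof -
    obtain a b where ab: "a \<in> {-10..10}" "b \<in> {-10..10}"
      "int u - int v = a * int (fib k) + b * int (fib (Suc k))"
      using uv by blast
    have "real_of_int (int u - int v) = of_int a * real (fib k) + of_int b * real (fib (Suc k))"
      unfolding ab(3) by simp
    then have 1: "real u - real v = of_int a * real (fib k) + of_int b * real (fib (Suc k))" by simp
    have "real u * \<phi> - real v * \<phi> = (real u - real v) * \<phi>" by (simp add: algebra_simps)
    also have "\<dots> = of_int a * (real (fib k) * \<phi>) + of_int b * (real (fib (Suc k)) * \<phi>)"
      unfolding 1 by (simp add: algebra_simps)
    finally show ?thesis unfolding comb_def using ab(1,2) 1 by blast
  qed
  have uniq: "t = t'" if "trunc k m t" "trunc k m t'" for k t t'
    using that unfolding trunc_def by (meson le_antisym)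
  obtain t where t: "trunc 3 m t" using ex_trunc by blast
  show "mulN n y"
    unfolding mulN_def
  proof (intro conjI allI impI)
    show "n \<in> \<int>" "0 \<le> n" "y \<in> zphi" "0 \<le> y"
      using m zphi_of_nat golden_bounds by auto
    show "\<exists>f f' g g' d d' d'' a b. scale f f' g g' d d' d'' \<and> low_int d n a \<and> low_zphi d' y b \<and>
        comb f f' g g' (n - a) (y - b)"
    proof (intro exI conjI)
      show "scale (real (fib 3)) (real (fib 3) * \<phi>) (real (fib (Suc 3))) (real (fib (Suc 3)) * \<phi>)
          (\<gamma> ^ 3) (\<gamma> ^ Suc 3) (\<gamma> ^ Suc (Suc 3))"
        unfolding scale_iff by blast
      show "low_int (\<gamma> ^ 3) n (real t)" "low_zphi (\<gamma> ^ Suc 3) y (real t * \<phi>)"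
        unfolding m low_int_iff low_zphi_iff using t by blast+
      show "comb (real (fib 3)) (real (fib 3) * \<phi>) (real (fib (Suc 3))) (real (fib (Suc 3)) * \<phi>)
          (n - real t) (y - real t * \<phi>)"
        unfolding m by (rule combI[OF trunc_3_diff[OF t]])
    qed
    fix f f' g g' d d' d'' a b a' b'
    assume *: "scale f f' g g' d d' d'' \<and> low_int d n a \<and> low_zphi d' y b \<and> low_int d' n a' \<and>
      low_zphi d'' y b'"
    then obtain k where k: "3 \<le> k" "f = real (fib k)" "f' = real (fib k) * \<phi>" "g = real (fib (Suc k))"
      "g' = real (fib (Suc k)) * \<phi>" "d = \<gamma> ^ k" "d' = \<gamma> ^ Suc k" "d'' = \<gamma> ^ Suc (Suc k)"
      unfolding scale_iff by blast
    obtain t t' where t: "trunc k m t" "trunc (Suc k) m t'" using ex_trunc by blast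
    have "a = real t" "b = real t * \<phi>" "a' = real t'" "b' = real t' * \<phi>"
      using * t uniq unfolding m k low_int_iff low_zphi_iff by metis+
    then show "comb f f' g g' (a - a') (b - b')"
      unfolding k using combI[OF trunc_diff[OF t]] k(1) by simp
  qed
qed

text \<open>The negatives are named by quantifiers because definability of \<open>mulN\<close> is
  established for variables.\<close>

definition mulZ :: "real \<Rightarrow> real \<Rightarrow> bool" where
  "mulZ n y \<longleftrightarrow> mulN n y \<or> (\<exists>n' y'. n' = - n \<and> y' = - y \<and> mulN n' y')"

lemma mulZ_iff: "mulZ n y \<longleftrightarrow> (\<exists>m::int. n = of_int m \<and> y = of_int m * \<phi>)"
proof
  assume "mulZ n y"
  then consider m where "n = real m" "y = real m * \<phi>" | m where "- n = real m" "- y = real m * \<phi>"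
    unfolding mulZ_def mulN_iff by blast
  then show "\<exists>m::int. n = of_int m \<and> y = of_int m * \<phi>"
  proof cases
    case 1
    then show ?thesis by (intro exI[of _ "int m" for m]) auto
  next
    case (2 m)
    then show ?thesis by (intro exI[of _ "- int m"]) auto
  qed
next
  assume "\<exists>m::int. n = of_int m \<and> y = of_int m * \<phi>"
  then obtain m :: int where m: "n = of_int m" "y = of_int m * \<phi>" by blast
  show "mulZ n y"
  proof (cases "0 \<le> m")
    case True
    then have "mulN n y" unfolding mulN_iff using m by (intro exI[of _ "nat m"]) simp
    then show ?thesis by (simp add: mulZ_def)
  next
    case False
    then have "mulN (- n) (- y)" unfolding mulN_iff using m by (intro exI[of _ "nat (- m)"]) simp
    then show ?thesis by (simp add: mulZ_def)
  qed
qed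

lemma definable_mulZ [definable_intros]: "i < n \<Longrightarrow> j < n \<Longrightarrow> definable n (\<lambda>e. mulZ (e i) (e j))"
  unfolding mulZ_def by (intro definable_intros definable_mulN) simp_all

text \<open>The group contains the nonzero elements \<open>\<psi> ^ k\<close>, which become
  arbitrarily small; a multiple of one that is shorter than \<open>b - a\<close> falls into the
  interval.\<close>

lemma golden_dense:
  assumes "a < b"
  shows "\<exists>n m :: int. a < of_int n + of_int m * \<phi> \<and> of_int n + of_int m * \<phi> < b"
proof -
  obtain k where k: "\<gamma> ^ k < b - a"
    using real_arch_pow_inv[of "b - a" \<gamma>] assms golden_bounds by auto
  define s where "s = \<psi> ^ k"
  have s: "s = real (fib (Suc k)) - real (fib k) * \<phi>" "\<bar>s\<bar> = \<gamma> ^ k" "0 < \<bar>s\<bar>"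
    using fib_approx[of k] abs_psi_power[of k] golden_bounds by (auto simp: s_def)
  define N where "N = \<lfloor>a / \<bar>s\<bar>\<rfloor> + 1"
  have "a / \<bar>s\<bar> < of_int N" "of_int N \<le> a / \<bar>s\<bar> + 1" unfolding N_def by linarith+
  then have "a < of_int N * \<bar>s\<bar>" "of_int N * \<bar>s\<bar> \<le> a + \<bar>s\<bar>"
    using s(3) by (simp_all add: field_simps)
  moreover define M where "M = (if 0 \<le> s then N else - N)"
  have "of_int M * s = of_int N * \<bar>s\<bar>" by (simp add: M_def)
  ultimately have "a < of_int M * s" "of_int M * s < b"
    using k s(2) by linarith+
  moreover have "of_int M * s = of_int (M * int (fib (Suc k))) + of_int (- (M * int (fib k))) * \<phi>"
    unfolding s(1) by (simp add: algebra_simps)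
  ultimately show ?thesis by metis
qed

text \<open>For \<open>z = n + x\<close> with \<open>x = m \<phi>\<close> the product is
  \<open>n \<phi> + m \<phi> \<phi> = y + x + m\<close>, a sum of quantities already
  available.\<close>

definition mulG :: "real \<Rightarrow> real \<Rightarrow> bool" where
  "mulG z w \<longleftrightarrow> (\<exists>n y m x. mulZ n y \<and> mulZ m x \<and> z = n + x \<and> w = y + x + m)"

lemma mulG_iff: "mulG z w \<longleftrightarrow> (\<exists>n m :: int. z = of_int n + of_int m * \<phi>) \<and> w = \<phi> * z"
proof -
  have "\<phi> * (of_int n + of_int m * \<phi>) = of_int n * \<phi> + of_int m * (\<phi> * \<phi>)" for n m :: int
    by (simp add: algebra_simps)
  then have *: "\<phi> * (of_int n + of_int m * \<phi>) = of_int n * \<phi> + of_int m * \<phi> + of_int m" for n m :: int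
    unfolding golden_sq by (simp add: algebra_simps)
  show ?thesis unfolding mulG_def mulZ_iff using * by metis
qed

lemma definable_mulG [definable_intros]: "i < n \<Longrightarrow> j < n \<Longrightarrow> definable n (\<lambda>e. mulG (e i) (e j))"
  unfolding mulG_def by (intro definable_intros) simp_all

text \<open>Multiplication by \<phi> preserves the order, so \<open>u\<close> and \<open>v\<close>
  correspond iff they make corresponding cuts in the dense group
  \<open>\<int> + \<int> \<phi>\<close>, where the product is already definable.\<close>

lemma golden_mult_iff: "v = \<phi> * u \<longleftrightarrow> (\<forall>z w. mulG z w \<longrightarrow> (z < u \<longleftrightarrow> w < v))"
proof
  assume "v = \<phi> * u"
  then show "\<forall>z w. mulG z w \<longrightarrow> (z < u \<longleftrightarrow> w < v)"
    unfolding mulG_iff using golden_bounds by auto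
next
  assume *: "\<forall>z w. mulG z w \<longrightarrow> (z < u \<longleftrightarrow> w < v)"
  have **: "z < u \<longleftrightarrow> z < v / \<phi>" if "z = of_int n + of_int m * \<phi>" for z and n m :: int
  proof -
    have "mulG z (\<phi> * z)" unfolding mulG_iff using that by blast
    then have "z < u \<longleftrightarrow> \<phi> * z < v" using * by blast
    then show ?thesis using golden_bounds by (simp add: less_divide_eq mult.commute)
  qed
  have "u = v / \<phi>"
  proof (rule ccontr)
    assume "u \<noteq> v / \<phi>"
    then consider "u < v / \<phi>" | "v / \<phi> < u" by linarith
    then show False
    proof cases
      case 1
      then obtain n m :: int where "u < of_int n + of_int m * \<phi>" "of_int n + of_int m * \<phi> < v / \<phi>"
        using golden_dense by blast
      then show False using **[OF refl, of n m] by linarith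
    next
      case 2
      then obtain n m :: int where "v / \<phi> < of_int n + of_int m * \<phi>" "of_int n + of_int m * \<phi> < u"
        using golden_dense by blast
      then show False using **[OF refl, of n m] by linarith
    qed
  qed
  then show "v = \<phi> * u" using golden_bounds by simp
qed

lemma definable_golden_mult: "definable_fun R_vars (R_struct \<phi>) (\<lambda>x. \<phi> * x)"
proof -
  have "definable 2 (\<lambda>e. \<forall>z w. mulG z w \<longrightarrow> (z < e 0 \<longleftrightarrow> w < e 1))"
    by (intro definable_intros) simp_all
  then have "definable 2 (\<lambda>e. e 1 = \<phi> * e 0)" by (simp add: golden_mult_iff)
  from definableD(2)[OF this, of "\<lambda>i. i"] obtain p where p: "fv R_vars p \<subseteq> {..<2}"
    "\<And>e. sat (R_struct \<phi>) e p \<longleftrightarrow> e 1 = \<phi> * e 0" by auto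
  have "{[x, \<phi> * x] |x. True} = {xs. length xs = 2 \<and> sat (R_struct \<phi>) (\<lambda>i. xs ! i) p}"
    unfolding p(2) by (auto simp: numeral_2_eq_2 length_Suc_conv)
  then show ?thesis
    unfolding definable_fun_def definable_set_def using p(1) by blast
qed

theorem theoremB:
  "definable_fun R_vars (R_struct golden_ratio) (\<lambda>x. golden_ratio * x) \<and>
   decidable_theory S_atom_code (theory_of S_vars (S_struct golden_ratio))"
  using definable_golden_mult decidable_golden_theory by blast

end
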